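(* Let $Q$ be a smooth manifold, $\mathcal{D}$ a distribution on $Q$ and $L:TQ\to\mathbb{R}$ a Lagrangian which is regular and regular with respect to $\mathcal{D}$, with Hessian $g$. Let $\nabla$ be the dynamical covariant derivative of the Lagrangian vector field $\Gamma_L$, let $\mathbf{T}$ be the canonical vector field along $\tau:TQ\to Q$, and let $Q:\mathcal{X}(\tau)\to\mathcal{X}^g(\tau,\mathcal{D})$ be the projection on $\mathcal{X}^g(\tau,\mathcal{D})$ defined by $g$. Then the vector field $$\Gamma^2=\Gamma_L-[\nabla(Q(\mathbf{T}))]^V$$ is a SODE extension of the nonholonomic vector field $\Gamma_{(L,\mathcal{D})}$.
   Context: All objects are smooth and repeated indices are summed. (The letter $Q$ denotes both the manifold and a projection operator; the meaning is clear from the context.) $Q$ is an $n$-dimensional manifold, $\tau:TQ\to Q$ the tangent bundle, $\mathcal{D}$ a rank $m$ distribution, $k=n-m$; indices $\alpha,\beta,\gamma$ run over $1,\dots,n$; $a,b$ over $1,\dots,m$; $i$ over $1,\dots,k$. A frame $\{X_\alpha\}=\{X_a,X_i\}$ of vector fields on $Q$ is fixed, globally defined, such that $\{X_a\}$ spans $\mathcal{D}$; $[X_\alpha,X_\beta]=R^\gamma_{\alpha\beta}X_\gamma$. The quasi-velocities $v^\alpha=(v^a,v^i)$ are the functions on $TQ$ given by $v_q=v^\alpha X_\alpha(q)$. $\mathcal{C}$ denotes $\mathcal{D}$ viewed as the submanifold $\{v^i=0\}$ of $TQ$. For $X=X^\alpha\partial/\partial q^\alpha$ on $Q$, $X^C=X^\alpha\frac{\partial}{\partial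 q^\alpha}+\dot q^\beta\frac{\partial X^\alpha}{\partial q^\beta}\frac{\partial}{\partial\dot q^\alpha}$ and $X^V=X^\alpha\frac{\partial}{\partial\dot q^\alpha}$. $\mathcal{X}(\tau)$ is the set of sections of $\tau^*TQ\to TQ$ (vector fields along $\tau$); $X=\xi^\alpha X_\alpha\in\mathcal{X}(\tau)$ with $\xi^\alpha\in C^\infty(TQ)$ has vertical lift $X^V=\xi^\alpha X_\alpha^V$. The canonical vector field along $\tau$ is $\mathbf{T}=v^\alpha X_\alpha$. A SODE is a vector field on $TQ$ of the form $\Gamma=v^\alpha X_\alpha^C+F^\alpha X_\alpha^V$; its base integral curves are the curves $c$ in $Q$ such that $\dot c$ is an integral curve of $\Gamma$. Its dynamical covariant derivative $\nabla:\mathcal{X}(\tau)\to\mathcal{X}(\tau)$ is the additive operator with $\nabla(fX)=f\nabla X+\Gamma(f)X$ for $f\in C^\infty(TQ)$, and $\nabla X_\alpha=\Gamma^\beta_\alpha X_\beta$, where $\Gamma^\beta_\alpha=-\frac12\big(X_\alpha^V(F^\beta)+v^\gamma R^\beta_{\alpha\gamma}\big)$. $L$ is regular if its fibre Hessian is non-singular; then $\Gamma_L$ is the unique SODE with $\Gamma_L(X^V(L))-X^C(L)=0$ for all $X\in\mathcal{X}(Q)$. $L$ is regular with respect to $\mathcal{D}$ if the matrix $(X_a^V(X_b^V(L)))$ is non-singular everywhere on $TQ$; then $\Gamma_{(L,\mathcal{D})}$ is the unique vector field on $\mathcal{C}$ of the form $v^aX_a^C+f^aX_a^V$ satisfying $\Gamma_{(L,\mathcal{D})}(X^V(L))-X^C(L)=0$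 on $\mathcal{C}$ for all $X\in\mathrm{Sec}(\mathcal{D})$. Its base integral curves are the nonholonomic trajectories. A SODE $\Gamma$ is a SODE extension of $\Gamma_{(L,\mathcal{D})}$ if each nonholonomic trajectory is a base integral curve of $\Gamma$; equivalently $\Gamma|_{\mathcal{C}}=\Gamma_{(L,\mathcal{D})}$. The Hessian $g$ of $L$ is the $C^\infty(TQ)$-bilinear form on $\mathcal{X}(\tau)$ determined by $g(X,Y)=X^V(Y^V(L))$ for $X,Y\in\mathcal{X}(Q)$. $\mathcal{X}(\tau,\mathcal{D})$ is the set of sections of $\tau^*\mathcal{D}\to TQ$, and $\mathcal{X}^g(\tau,\mathcal{D})$ is the set of $X\in\mathcal{X}(\tau)$ with $g(X,Y)=0$ for all $Y\in\mathcal{X}(\tau,\mathcal{D})$. One has $\mathcal{X}(\tau)=\mathcal{X}(\tau,\mathcal{D})\oplus\mathcal{X}^g(\tau,\mathcal{D})$, and the operator $Q$ is the projection onto the second summand. *)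

theory Defs
  imports "HOL-Analysis.Analysis" "Jordan_Normal_Form.Determinant"
begin

section \<open>Smooth maps between Euclidean spaces\<close>

text \<open>Only used for open sets \<open>S\<close>, where \<open>at x\<close> is the appropriate filter.\<close>

primrec times_differentiable_on ::
    "nat \<Rightarrow> 'e::euclidean_space set \<Rightarrow> ('e \<Rightarrow> 'b::real_normed_vector) \<Rightarrow> bool" where
  "times_differentiable_on 0 S f \<longleftrightarrow> continuous_on S f"
| "times_differentiable_on (Suc k) S f \<longleftrightarrow>
     (\<forall>x\<in>S. f differentiable (at x)) \<and>
     (\<forall>v. times_differentiable_on k S (\<lambda>x. frechet_derivative f (at x) v))"

definition smooth_on :: "'e::euclidean_space set \<Rightarrow> ('e \<Rightarrow> 'b::real_normed_vector) \<Rightarrow> bool" where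
  "smooth_on S f \<longleftrightarrow> (\<forall>k. times_differentiable_on k S f)"


section \<open>Smooth manifolds\<close>

text \<open>
  A chart is a pair of a domain and a coordinate map (only relevant on the domain). A manifold is
  given by an atlas; its set of points is the union of the chart domains, and its topology is the
  one for which all charts are homeomorphisms onto open sets.
\<close>

type_synonym ('p, 'e) chart = "'p set \<times> ('p \<Rightarrow> 'e)"

definition points :: "('p, 'e) chart set \<Rightarrow> 'p set" where
  "points A = (\<Union>c\<in>A. fst c)"

definition chart_inv :: "('p, 'e) chart \<Rightarrow> 'e \<Rightarrow> 'p" where
  "chart_inv c = inv_into (fst c) (snd c)"

definition atlas_topology :: "('p, 'e::euclidean_space) chart set \<Rightarrow> 'p topology" where
  "atlas_topology A =
     topology (\<lambda>W. W \<subseteq> points A \<and> (\<forall>c\<in>A. open (snd c ` (W \<inter> fst c))))"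

lemma openin_atlas_topology:
  assumes "\<forall>c\<in>A. inj_on (snd c) (fst c)"
  shows "openin (atlas_topology A) W \<longleftrightarrow>
           W \<subseteq> points A \<and> (\<forall>c\<in>A. open (snd c ` (W \<inter> fst c)))"
proof -
  have "istopology (\<lambda>W. W \<subseteq> points A \<and> (\<forall>c\<in>A. open (snd c ` (W \<inter> fst c))))"
    unfolding istopology_def
  proof (intro conjI allI impI ballI)
    fix S T c
    assume S: "S \<subseteq> points A \<and> (\<forall>c\<in>A. open (snd c ` (S \<inter> fst c)))"
      and T: "T \<subseteq> points A \<and> (\<forall>c\<in>A. open (snd c ` (T \<inter> fst c)))" and c: "c \<in> A"
    have "snd c ` (S \<inter> T \<inter> fst c) = snd c ` (S \<inter> fst c) \<inter> snd c ` (T \<inter> fst c)"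
      using assms c by (auto simp: inj_on_def)
    then show "open (snd c ` (S \<inter> T \<inter> fst c))"
      using S T c by auto
  next
    fix K c
    assume K: "\<forall>S\<in>K. S \<subseteq> points A \<and> (\<forall>c\<in>A. open (snd c ` (S \<inter> fst c)))" and c: "c \<in> A"
    have "snd c ` (\<Union>K \<inter> fst c) = (\<Union>S\<in>K. snd c ` (S \<inter> fst c))"
      by auto
    then show "open (snd c ` (\<Union>K \<inter> fst c))"
      using K c by auto
  qed auto
  then show ?thesis
    by (simp add: atlas_topology_def)
qed

definition smooth_manifold :: "('p, 'e::euclidean_space) chart set \<Rightarrow> bool" where
  "smooth_manifold A \<longleftrightarrow>
     (\<forall>c\<in>A. inj_on (snd c) (fst c) \<and> open (snd c ` fst c)) \<and>
     (\<forall>c\<in>A. \<forall>d\<in>A. open (snd c ` (fst c \<inter> fst d)) \<and>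
                   smooth_on (snd c ` (fst c \<inter> fst d)) (snd d \<circ> chart_inv c)) \<and>
     Hausdorff_space (atlas_topology A) \<and> second_countable (atlas_topology A)"

definition smooth_fun ::
    "('p, 'e::euclidean_space) chart set \<Rightarrow> ('p \<Rightarrow> 'b::real_normed_vector) \<Rightarrow> bool" where
  "smooth_fun A f \<longleftrightarrow> (\<forall>c\<in>A. smooth_on (snd c ` fst c) (f \<circ> chart_inv c))"


section \<open>Tangent vectors and vector fields\<close>

text \<open>
  A tangent vector is the family of its coordinate vectors in all charts at the base point, related
  by the Jacobians of the coordinate changes. It is set to zero on everything that is not a chart at
  the base point, so that equality of tangent vectors is equality of functions.
\<close>

type_synonym ('p, 'e) tvec = "('p, 'e) chart \<Rightarrow> 'e"

definition tangent_space ::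
    "('p, 'e::euclidean_space) chart set \<Rightarrow> 'p \<Rightarrow> ('p, 'e) tvec set" where
  "tangent_space A p = {v.
     (\<forall>c. \<not> (c \<in> A \<and> p \<in> fst c) \<longrightarrow> v c = 0) \<and>
     (\<forall>c\<in>A. \<forall>d\<in>A. p \<in> fst c \<inter> fst d \<longrightarrow>
        v d = frechet_derivative (snd d \<circ> chart_inv c) (at (snd c p)) (v c))}"

definition lin_comb ::
    "nat set \<Rightarrow> (nat \<Rightarrow> real) \<Rightarrow> (nat \<Rightarrow> ('p, 'e::euclidean_space) tvec) \<Rightarrow> ('p, 'e) tvec" where
  "lin_comb N w Y = (\<lambda>c. \<Sum>\<alpha>\<in>N. w \<alpha> *\<^sub>R Y \<alpha> c)"

text \<open>Derivative of a function along a tangent vector; the value does not depend on the chart.\<close>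

definition dir_deriv ::
    "('p, 'e::euclidean_space) chart set \<Rightarrow> 'p \<Rightarrow> ('p, 'e) tvec \<Rightarrow> ('p \<Rightarrow> real) \<Rightarrow> real" where
  "dir_deriv A p v f =
     (let c = (SOME c. c \<in> A \<and> p \<in> fst c)
      in frechet_derivative (f \<circ> chart_inv c) (at (snd c p)) (v c))"

definition vf_apply ::
    "('p, 'e::euclidean_space) chart set \<Rightarrow> ('p \<Rightarrow> ('p, 'e) tvec) \<Rightarrow> ('p \<Rightarrow> real) \<Rightarrow> 'p \<Rightarrow> real" where
  "vf_apply A Z f p = dir_deriv A p (Z p) f"

text \<open>Vector fields, again extended by zero outside the manifold.\<close>

definition vector_field ::
    "('p, 'e::euclidean_space) chart set \<Rightarrow> ('p \<Rightarrow> ('p, 'e) tvec) \<Rightarrow> bool" where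
  "vector_field A Z \<longleftrightarrow>
     (\<forall>p\<in>points A. Z p \<in> tangent_space A p) \<and>
     (\<forall>p. p \<notin> points A \<longrightarrow> Z p = (\<lambda>_. 0)) \<and>
     (\<forall>c\<in>A. smooth_on (snd c ` fst c) (\<lambda>x. Z (chart_inv c x) c))"

definition lie_bracket ::
    "('p, 'e::euclidean_space) chart set \<Rightarrow> ('p \<Rightarrow> ('p, 'e) tvec) \<Rightarrow> ('p \<Rightarrow> ('p, 'e) tvec)
       \<Rightarrow> 'p \<Rightarrow> ('p, 'e) tvec" where
  "lie_bracket A Y Z p = (\<lambda>c.
     if c \<in> A \<and> p \<in> fst c then
       frechet_derivative (\<lambda>x. Z (chart_inv c x) c) (at (snd c p)) (Y p c)
       - frechet_derivative (\<lambda>x. Y (chart_inv c x) c) (at (snd c p)) (Z p c)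
     else 0)"


section \<open>Curves\<close>

text \<open>Curves are functions on the real line, considered on an open interval \<open>I\<close>.\<close>

definition smooth_curve ::
    "('p, 'e::euclidean_space) chart set \<Rightarrow> real set \<Rightarrow> (real \<Rightarrow> 'p) \<Rightarrow> bool" where
  "smooth_curve A I \<gamma> \<longleftrightarrow>
     \<gamma> ` I \<subseteq> points A \<and>
     (\<forall>c\<in>A. open (I \<inter> \<gamma> -` fst c) \<and> smooth_on (I \<inter> \<gamma> -` fst c) (snd c \<circ> \<gamma>))"

definition velocity ::
    "('p, 'e::euclidean_space) chart set \<Rightarrow> (real \<Rightarrow> 'p) \<Rightarrow> real \<Rightarrow> ('p, 'e) tvec" where
  "velocity A \<gamma> t = (\<lambda>c.
     if c \<in> A \<and> \<gamma> t \<in> fst c then vector_derivative (snd c \<circ> \<gamma>) (at t) else 0)"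

text \<open>\<open>S\<close> is the domain of the vector field \<open>Z\<close>: the manifold or a submanifold of it.\<close>

definition integral_curve ::
    "('p, 'e::euclidean_space) chart set \<Rightarrow> 'p set \<Rightarrow> ('p \<Rightarrow> ('p, 'e) tvec)
       \<Rightarrow> real set \<Rightarrow> (real \<Rightarrow> 'p) \<Rightarrow> bool" where
  "integral_curve A S Z I \<gamma> \<longleftrightarrow>
     smooth_curve A I \<gamma> \<and> \<gamma> ` I \<subseteq> S \<and> (\<forall>t\<in>I. velocity A \<gamma> t = Z (\<gamma> t))"


section \<open>The tangent bundle\<close>

text \<open>Natural coordinates \<open>(q, \<dot>q)\<close> on the tangent bundle.\<close>

type_synonym ('q, 'e) tpoint = "'q \<times> ('q, 'e) tvec"

definition tangent_chart ::
    "('q, 'e::euclidean_space) chart set \<Rightarrow> ('q, 'e) chart \<Rightarrow> (('q, 'e) tpoint, 'e \<times> 'e) chart" where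
  "tangent_chart A c =
     ({(q, v). q \<in> fst c \<and> v \<in> tangent_space A q}, \<lambda>(q, v). (snd c q, v c))"

definition tangent_bundle ::
    "('q, 'e::euclidean_space) chart set \<Rightarrow> (('q, 'e) tpoint, 'e \<times> 'e) chart set" where
  "tangent_bundle A = tangent_chart A ` A"

text \<open>
  The map \<^term>\<open>tangent_chart A\<close> is injective, so \<open>inv_into A (tangent_chart A) d\<close> below is the chart
  of \<open>Q\<close> which induces the chart \<open>d\<close> of \<open>TQ\<close>. In natural coordinates,
  \<open>X\<^sup>C = (X, DX \<cdot> \<dot>q)\<close>, and \<open>X\<^sup>V = (0, X)\<close> for \<open>X\<close> a vector field along \<open>\<tau>\<close>.
\<close>

definition complete_lift ::
    "('q, 'e::euclidean_space) chart set \<Rightarrow> ('q \<Rightarrow> ('q, 'e) tvec)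
       \<Rightarrow> ('q, 'e) tpoint \<Rightarrow> (('q, 'e) tpoint, 'e \<times> 'e) tvec" where
  "complete_lift A X p = (\<lambda>d.
     if d \<in> tangent_bundle A \<and> p \<in> fst d then
       (let c = inv_into A (tangent_chart A) d; q = fst p; v = snd p
        in (X q c, frechet_derivative (\<lambda>x. X (chart_inv c x) c) (at (snd c q)) (v c)))
     else 0)"

definition vertical_lift ::
    "('q, 'e::euclidean_space) chart set \<Rightarrow> (('q, 'e) tpoint \<Rightarrow> ('q, 'e) tvec)
       \<Rightarrow> ('q, 'e) tpoint \<Rightarrow> (('q, 'e) tpoint, 'e \<times> 'e) tvec" where
  "vertical_lift A X p = (\<lambda>d.
     if d \<in> tangent_bundle A \<and> p \<in> fst d then
       (let c = inv_into A (tangent_chart A) d in (0, X p c))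
     else 0)"

text \<open>Vector fields along \<open>\<tau>\<close>, and vector fields on \<open>Q\<close> regarded as such.\<close>

definition along_tau ::
    "('q, 'e::euclidean_space) chart set \<Rightarrow> (('q, 'e) tpoint \<Rightarrow> ('q, 'e) tvec) set" where
  "along_tau A = {X.
     (\<forall>p\<in>points (tangent_bundle A). X p \<in> tangent_space A (fst p)) \<and>
     (\<forall>p. p \<notin> points (tangent_bundle A) \<longrightarrow> X p = (\<lambda>_. 0)) \<and>
     (\<forall>c\<in>A. let d = tangent_chart A c
            in smooth_on (snd d ` fst d) (\<lambda>x. X (chart_inv d x) c))}"

definition basic ::
    "('q, 'e::euclidean_space) chart set \<Rightarrow> ('q \<Rightarrow> ('q, 'e) tvec) \<Rightarrow> ('q, 'e) tpoint \<Rightarrow> ('q, 'e) tvec" where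
  "basic A X p = (if p \<in> points (tangent_bundle A) then X (fst p) else (\<lambda>_. 0))"


section \<open>Distribution, frame and quasi-velocities\<close>

text \<open>
  The manifold has dimension \<open>n = DIM('e)\<close>. Frame indices \<open>\<alpha>\<close> run over \<open>{..<n}\<close>, the indices \<open>a\<close>
  over \<open>{..<m}\<close> and the indices \<open>i\<close> over \<open>{m..<n}\<close>.
\<close>

definition distribution ::
    "('q, 'e::euclidean_space) chart set \<Rightarrow> nat \<Rightarrow> ('q \<Rightarrow> ('q, 'e) tvec set) \<Rightarrow> bool" where
  "distribution A m D \<longleftrightarrow>
     (\<forall>q\<in>points A. \<exists>W Y. openin (atlas_topology A) W \<and> q \<in> W \<and> (\<forall>a<m. vector_field A (Y a)) \<and>
        (\<forall>r\<in>W. D r = {lin_comb {..<m} w (\<lambda>a. Y a r) | w. True} \<and>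
               (\<forall>w. lin_comb {..<m} w (\<lambda>a. Y a r) = (\<lambda>_. 0) \<longrightarrow> (\<forall>a<m. w a = 0))))"

definition frame ::
    "('q, 'e::euclidean_space) chart set \<Rightarrow> (nat \<Rightarrow> 'q \<Rightarrow> ('q, 'e) tvec) \<Rightarrow> bool" where
  "frame A X \<longleftrightarrow>
     (\<forall>\<alpha><DIM('e). vector_field A (X \<alpha>)) \<and>
     (\<forall>q\<in>points A. \<forall>v\<in>tangent_space A q.
        \<exists>!w. (\<forall>\<alpha>\<ge>DIM('e). w \<alpha> = 0) \<and> v = lin_comb {..<DIM('e)} w (\<lambda>\<alpha>. X \<alpha> q))"

definition adapted_frame ::
    "('q, 'e::euclidean_space) chart set \<Rightarrow> nat \<Rightarrow> ('q \<Rightarrow> ('q, 'e) tvec set)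
       \<Rightarrow> (nat \<Rightarrow> 'q \<Rightarrow> ('q, 'e) tvec) \<Rightarrow> bool" where
  "adapted_frame A m D X \<longleftrightarrow>
     frame A X \<and> m \<le> DIM('e) \<and>
     (\<forall>q\<in>points A. D q = {lin_comb {..<m} w (\<lambda>a. X a q) | w. True})"

definition quasi_velocity ::
    "(nat \<Rightarrow> 'q \<Rightarrow> ('q, 'e::euclidean_space) tvec) \<Rightarrow> nat \<Rightarrow> ('q, 'e) tpoint \<Rightarrow> real" where
  "quasi_velocity X \<alpha> p =
     (THE w. (\<forall>\<alpha>\<ge>DIM('e). w \<alpha> = 0) \<and> snd p = lin_comb {..<DIM('e)} w (\<lambda>\<alpha>. X \<alpha> (fst p))) \<alpha>"

text \<open>The functions \<open>R\<^sup>\<gamma>\<^sub>\<alpha>\<^sub>\<beta>\<close> in \<open>[X\<^sub>\<alpha>, X\<^sub>\<beta>] = R\<^sup>\<gamma>\<^sub>\<alpha>\<^sub>\<beta> X\<^sub>\<gamma>\<close>.\<close>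

definition structure_fun ::
    "('q, 'e::euclidean_space) chart set \<Rightarrow> (nat \<Rightarrow> 'q \<Rightarrow> ('q, 'e) tvec)
       \<Rightarrow> nat \<Rightarrow> nat \<Rightarrow> nat \<Rightarrow> 'q \<Rightarrow> real" where
  "structure_fun A X \<gamma> \<alpha> \<beta> q = quasi_velocity X \<gamma> (q, lie_bracket A (X \<alpha>) (X \<beta>) q)"

definition constraint_manifold ::
    "('q, 'e::euclidean_space) chart set \<Rightarrow> ('q \<Rightarrow> ('q, 'e) tvec set) \<Rightarrow> ('q, 'e) tpoint set" where
  "constraint_manifold A D = {p \<in> points (tangent_bundle A). snd p \<in> D (fst p)}"

definition canonical_field ::
    "('q, 'e::euclidean_space) chart set \<Rightarrow> (nat \<Rightarrow> 'q \<Rightarrow> ('q, 'e) tvec)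
       \<Rightarrow> ('q, 'e) tpoint \<Rightarrow> ('q, 'e) tvec" where
  "canonical_field A X p =
     lin_comb {..<DIM('e)} (\<lambda>\<alpha>. quasi_velocity X \<alpha> p) (\<lambda>\<alpha>. basic A (X \<alpha>) p)"


section \<open>Second-order fields and the dynamical covariant derivative\<close>

definition sode_with ::
    "('q, 'e::euclidean_space) chart set \<Rightarrow> (nat \<Rightarrow> 'q \<Rightarrow> ('q, 'e) tvec)
       \<Rightarrow> (nat \<Rightarrow> ('q, 'e) tpoint \<Rightarrow> real)
       \<Rightarrow> (('q, 'e) tpoint \<Rightarrow> (('q, 'e) tpoint, 'e \<times> 'e) tvec) \<Rightarrow> bool" where
  "sode_with A X F \<Gamma> \<longleftrightarrow>
     vector_field (tangent_bundle A) \<Gamma> \<and>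
     (\<forall>\<alpha><DIM('e). smooth_fun (tangent_bundle A) (F \<alpha>)) \<and>
     (\<forall>p\<in>points (tangent_bundle A). \<forall>d.
        \<Gamma> p d = (\<Sum>\<alpha><DIM('e). quasi_velocity X \<alpha> p *\<^sub>R complete_lift A (X \<alpha>) p d
                            + F \<alpha> p *\<^sub>R vertical_lift A (basic A (X \<alpha>)) p d))"

definition sode ::
    "('q, 'e::euclidean_space) chart set \<Rightarrow> (nat \<Rightarrow> 'q \<Rightarrow> ('q, 'e) tvec)
       \<Rightarrow> (('q, 'e) tpoint \<Rightarrow> (('q, 'e) tpoint, 'e \<times> 'e) tvec) \<Rightarrow> bool" where
  "sode A X \<Gamma> \<longleftrightarrow> (\<exists>F. sode_with A X F \<Gamma>)"

text \<open>The values of \<open>F\<close> on \<open>TQ\<close> are determined by \<open>\<Gamma>\<close>.\<close>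

definition forces ::
    "('q, 'e::euclidean_space) chart set \<Rightarrow> (nat \<Rightarrow> 'q \<Rightarrow> ('q, 'e) tvec)
       \<Rightarrow> (('q, 'e) tpoint \<Rightarrow> (('q, 'e) tpoint, 'e \<times> 'e) tvec)
       \<Rightarrow> nat \<Rightarrow> ('q, 'e) tpoint \<Rightarrow> real" where
  "forces A X \<Gamma> = (SOME F. sode_with A X F \<Gamma>)"

definition base_integral_curve ::
    "('q, 'e::euclidean_space) chart set \<Rightarrow> ('q, 'e) tpoint set
       \<Rightarrow> (('q, 'e) tpoint \<Rightarrow> (('q, 'e) tpoint, 'e \<times> 'e) tvec)
       \<Rightarrow> real set \<Rightarrow> (real \<Rightarrow> 'q) \<Rightarrow> bool" where
  "base_integral_curve A S \<Gamma> I c \<longleftrightarrow>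
     smooth_curve A I c \<and>
     integral_curve (tangent_bundle A) S \<Gamma> I (\<lambda>t. (c t, velocity A c t))"

text \<open>\<open>connection_coeff A X \<Gamma> \<beta> \<alpha>\<close> is \<open>\<Gamma>\<^sup>\<beta>\<^sub>\<alpha>\<close>.\<close>

definition connection_coeff ::
    "('q, 'e::euclidean_space) chart set \<Rightarrow> (nat \<Rightarrow> 'q \<Rightarrow> ('q, 'e) tvec)
       \<Rightarrow> (('q, 'e) tpoint \<Rightarrow> (('q, 'e) tpoint, 'e \<times> 'e) tvec)
       \<Rightarrow> nat \<Rightarrow> nat \<Rightarrow> ('q, 'e) tpoint \<Rightarrow> real" where
  "connection_coeff A X \<Gamma> \<beta> \<alpha> p =
     - (1 / 2) * (vf_apply (tangent_bundle A) (vertical_lift A (basic A (X \<alpha>))) (forces A X \<Gamma> \<beta>) p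
        + (\<Sum>\<gamma><DIM('e). quasi_velocity X \<gamma> p * structure_fun A X \<beta> \<alpha> \<gamma> (fst p)))"

text \<open>The operator is extended by zero outside \<open>\<X>(\<tau>)\<close> to make it unique as a function.\<close>

definition dyn_cov_deriv ::
    "('q, 'e::euclidean_space) chart set \<Rightarrow> (nat \<Rightarrow> 'q \<Rightarrow> ('q, 'e) tvec)
       \<Rightarrow> (('q, 'e) tpoint \<Rightarrow> (('q, 'e) tpoint, 'e \<times> 'e) tvec)
       \<Rightarrow> (('q, 'e) tpoint \<Rightarrow> ('q, 'e) tvec) \<Rightarrow> ('q, 'e) tpoint \<Rightarrow> ('q, 'e) tvec" where
  "dyn_cov_deriv A X \<Gamma> = (THE N.
     (\<forall>Y\<in>along_tau A. N Y \<in> along_tau A) \<and>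
     (\<forall>Y. Y \<notin> along_tau A \<longrightarrow> N Y = (\<lambda>_ _. 0)) \<and>
     (\<forall>Y\<in>along_tau A. \<forall>Z\<in>along_tau A.
        N (\<lambda>p c. Y p c + Z p c) = (\<lambda>p c. N Y p c + N Z p c)) \<and>
     (\<forall>f. \<forall>Y\<in>along_tau A. smooth_fun (tangent_bundle A) f \<longrightarrow>
        N (\<lambda>p c. f p *\<^sub>R Y p c) =
          (\<lambda>p c. f p *\<^sub>R N Y p c + vf_apply (tangent_bundle A) \<Gamma> f p *\<^sub>R Y p c)) \<and>
     (\<forall>\<alpha><DIM('e). N (basic A (X \<alpha>)) =
        (\<lambda>p. lin_comb {..<DIM('e)} (\<lambda>\<beta>. connection_coeff A X \<Gamma> \<beta> \<alpha> p) (\<lambda>\<beta>. basic A (X \<beta>) p))))"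


section \<open>Lagrangian and nonholonomic vector fields\<close>

definition hess_coeff ::
    "('q, 'e::euclidean_space) chart set \<Rightarrow> (nat \<Rightarrow> 'q \<Rightarrow> ('q, 'e) tvec)
       \<Rightarrow> (('q, 'e) tpoint \<Rightarrow> real) \<Rightarrow> nat \<Rightarrow> nat \<Rightarrow> ('q, 'e) tpoint \<Rightarrow> real" where
  "hess_coeff A X L \<alpha> \<beta> =
     vf_apply (tangent_bundle A) (vertical_lift A (basic A (X \<alpha>)))
       (vf_apply (tangent_bundle A) (vertical_lift A (basic A (X \<beta>))) L)"

definition regular ::
    "('q, 'e::euclidean_space) chart set \<Rightarrow> (nat \<Rightarrow> 'q \<Rightarrow> ('q, 'e) tvec)
       \<Rightarrow> (('q, 'e) tpoint \<Rightarrow> real) \<Rightarrow> bool" where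
  "regular A X L \<longleftrightarrow>
     (\<forall>p\<in>points (tangent_bundle A).
        Determinant.det (mat DIM('e) DIM('e) (\<lambda>(\<alpha>, \<beta>). hess_coeff A X L \<alpha> \<beta> p)) \<noteq> 0)"

definition regular_wrt_distribution ::
    "('q, 'e::euclidean_space) chart set \<Rightarrow> nat \<Rightarrow> (nat \<Rightarrow> 'q \<Rightarrow> ('q, 'e) tvec)
       \<Rightarrow> (('q, 'e) tpoint \<Rightarrow> real) \<Rightarrow> bool" where
  "regular_wrt_distribution A m X L \<longleftrightarrow>
     (\<forall>p\<in>points (tangent_bundle A).
        Determinant.det (mat m m (\<lambda>(a, b). hess_coeff A X L a b p)) \<noteq> 0)"

definition lagrangian_field ::
    "('q, 'e::euclidean_space) chart set \<Rightarrow> (nat \<Rightarrow> 'q \<Rightarrow> ('q, 'e) tvec)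
       \<Rightarrow> (('q, 'e) tpoint \<Rightarrow> real)
       \<Rightarrow> ('q, 'e) tpoint \<Rightarrow> (('q, 'e) tpoint, 'e \<times> 'e) tvec" where
  "lagrangian_field A X L = (THE \<Gamma>.
     sode A X \<Gamma> \<and>
     (\<forall>Y. vector_field A Y \<longrightarrow> (\<forall>p\<in>points (tangent_bundle A).
        vf_apply (tangent_bundle A) \<Gamma>
          (vf_apply (tangent_bundle A) (vertical_lift A (basic A Y)) L) p
        - vf_apply (tangent_bundle A) (complete_lift A Y) L p = 0)))"

text \<open>Smooth functions on a submanifold \<open>S\<close>: those with local smooth extensions.\<close>

definition smooth_fun_on ::
    "('p, 'e::euclidean_space) chart set \<Rightarrow> 'p set \<Rightarrow> ('p \<Rightarrow> real) \<Rightarrow> bool" where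
  "smooth_fun_on A S f \<longleftrightarrow>
     (\<forall>p\<in>S. \<exists>W h. openin (atlas_topology A) W \<and> p \<in> W \<and> smooth_fun A h \<and> (\<forall>x\<in>W \<inter> S. f x = h x))"

text \<open>
  Vector fields on \<open>\<C>\<close> are represented as functions vanishing off \<open>\<C>\<close>; since \<open>\<C>\<close> is the level set
  \<open>{v\<^sup>i = 0}\<close>, its tangent spaces are the common kernels of the \<open>dv\<^sup>i\<close>.
\<close>

definition nonholonomic_field ::
    "('q, 'e::euclidean_space) chart set \<Rightarrow> nat \<Rightarrow> ('q \<Rightarrow> ('q, 'e) tvec set)
       \<Rightarrow> (nat \<Rightarrow> 'q \<Rightarrow> ('q, 'e) tvec) \<Rightarrow> (('q, 'e) tpoint \<Rightarrow> real)
       \<Rightarrow> ('q, 'e) tpoint \<Rightarrow> (('q, 'e) tpoint, 'e \<times> 'e) tvec" where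
  "nonholonomic_field A m D X L = (THE \<Gamma>.
     (\<forall>p\<in>constraint_manifold A D. \<Gamma> p \<in> tangent_space (tangent_bundle A) p \<and>
        (\<forall>i\<in>{m..<DIM('e)}. vf_apply (tangent_bundle A) \<Gamma> (quasi_velocity X i) p = 0)) \<and>
     (\<forall>p. p \<notin> constraint_manifold A D \<longrightarrow> \<Gamma> p = (\<lambda>_. 0)) \<and>
     (\<exists>f. (\<forall>a<m. smooth_fun_on (tangent_bundle A) (constraint_manifold A D) (f a)) \<and>
        (\<forall>p\<in>constraint_manifold A D. \<forall>d.
           \<Gamma> p d = (\<Sum>a<m. quasi_velocity X a p *\<^sub>R complete_lift A (X a) p d
                          + f a p *\<^sub>R vertical_lift A (basic A (X a)) p d))) \<and>
     (\<forall>Y. vector_field A Y \<and> (\<forall>q\<in>points A. Y q \<in> D q) \<longrightarrow>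
        (\<forall>p\<in>constraint_manifold A D.
           vf_apply (tangent_bundle A) \<Gamma>
             (vf_apply (tangent_bundle A) (vertical_lift A (basic A Y)) L) p
           - vf_apply (tangent_bundle A) (complete_lift A Y) L p = 0)))"

definition sode_extension ::
    "('q, 'e::euclidean_space) chart set \<Rightarrow> nat \<Rightarrow> ('q \<Rightarrow> ('q, 'e) tvec set)
       \<Rightarrow> (nat \<Rightarrow> 'q \<Rightarrow> ('q, 'e) tvec) \<Rightarrow> (('q, 'e) tpoint \<Rightarrow> real)
       \<Rightarrow> (('q, 'e) tpoint \<Rightarrow> (('q, 'e) tpoint, 'e \<times> 'e) tvec) \<Rightarrow> bool" where
  "sode_extension A m D X L \<Gamma> \<longleftrightarrow>
     sode A X \<Gamma> \<and>
     (\<forall>I c. open I \<and> is_interval I \<and>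
        base_integral_curve A (constraint_manifold A D) (nonholonomic_field A m D X L) I c \<longrightarrow>
        base_integral_curve A (points (tangent_bundle A)) \<Gamma> I c)"


section \<open>The projection defined by the Hessian\<close>

text \<open>\<open>g(Y, Z) = \<eta>\<^sup>\<alpha> \<zeta>\<^sup>\<beta> X\<^sub>\<alpha>\<^sup>V(X\<^sub>\<beta>\<^sup>V(L))\<close> for \<open>Y = \<eta>\<^sup>\<alpha> X\<^sub>\<alpha>\<close> and \<open>Z = \<zeta>\<^sup>\<beta> X\<^sub>\<beta>\<close>.\<close>

definition hessian ::
    "('q, 'e::euclidean_space) chart set \<Rightarrow> (nat \<Rightarrow> 'q \<Rightarrow> ('q, 'e) tvec)
       \<Rightarrow> (('q, 'e) tpoint \<Rightarrow> real) \<Rightarrow> (('q, 'e) tpoint \<Rightarrow> ('q, 'e) tvec)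
       \<Rightarrow> (('q, 'e) tpoint \<Rightarrow> ('q, 'e) tvec) \<Rightarrow> ('q, 'e) tpoint \<Rightarrow> real" where
  "hessian A X L Y Z p =
     (\<Sum>\<alpha><DIM('e). \<Sum>\<beta><DIM('e).
        quasi_velocity X \<alpha> (fst p, Y p) * quasi_velocity X \<beta> (fst p, Z p) * hess_coeff A X L \<alpha> \<beta> p)"

definition along_tau_in ::
    "('q, 'e::euclidean_space) chart set \<Rightarrow> ('q \<Rightarrow> ('q, 'e) tvec set)
       \<Rightarrow> (('q, 'e) tpoint \<Rightarrow> ('q, 'e) tvec) set" where
  "along_tau_in A D = {Y \<in> along_tau A. \<forall>p\<in>points (tangent_bundle A). Y p \<in> D (fst p)}"

definition along_tau_orth ::
    "('q, 'e::euclidean_space) chart set \<Rightarrow> ('q \<Rightarrow> ('q, 'e) tvec set)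
       \<Rightarrow> (nat \<Rightarrow> 'q \<Rightarrow> ('q, 'e) tvec) \<Rightarrow> (('q, 'e) tpoint \<Rightarrow> real)
       \<Rightarrow> (('q, 'e) tpoint \<Rightarrow> ('q, 'e) tvec) set" where
  "along_tau_orth A D X L = {Y \<in> along_tau A.
     \<forall>Z\<in>along_tau_in A D. \<forall>p\<in>points (tangent_bundle A). hessian A X L Y Z p = 0}"

definition orth_projection ::
    "('q, 'e::euclidean_space) chart set \<Rightarrow> ('q \<Rightarrow> ('q, 'e) tvec set)
       \<Rightarrow> (nat \<Rightarrow> 'q \<Rightarrow> ('q, 'e) tvec) \<Rightarrow> (('q, 'e) tpoint \<Rightarrow> real)
       \<Rightarrow> (('q, 'e) tpoint \<Rightarrow> ('q, 'e) tvec) \<Rightarrow> ('q, 'e) tpoint \<Rightarrow> ('q, 'e) tvec" where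
  "orth_projection A D X L Y = (THE Z.
     Z \<in> along_tau_orth A D X L \<and> (\<lambda>p c. Y p c - Z p c) \<in> along_tau_in A D)"

end

theory Submission
  imports Defs
begin

text \<open>
Write \<open>\<Gamma>\<close> for the Lagrangian field, \<open>F\<^sup>\<alpha>\<close> for its forces, \<open>\<xi>\<^sup>\<alpha>\<close> for the frame components of \<open>Q(T)\<close> and
\<open>g\<^sub>\<alpha>\<^sub>\<beta>\<close> for the Hessian in the frame. Two facts determine \<open>Q(T)\<close>: its transverse components are
\<open>\<xi>\<^sup>i = v\<^sup>i\<close>, because \<open>T - Q(T)\<close> lies in the distribution, and \<open>\<xi>\<^sup>\<alpha> g\<^sub>\<alpha>\<^sub>b = 0\<close> everywhere on \<open>TQ\<close>. On the
constraint manifold \<open>v\<^sup>i = 0\<close>, so \<open>\<xi>\<^sup>a g\<^sub>a\<^sub>b = 0\<close> there and the regularity with respect to the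
distribution gives \<open>\<xi> = 0\<close>. Hence the connection coefficients drop out at points of the constraint
manifold, and \<open>\<nabla>(Q(T))\<close> has components \<open>\<psi>\<^sup>\<alpha> = \<Gamma>(\<xi>\<^sup>\<alpha>)\<close>.

Differentiating the two facts along \<open>\<Gamma>\<close> at such a point gives two relations. As \<open>\<Gamma>(v\<^sup>i) = F\<^sup>i\<close> for
every second-order field (\<open>quasi_velocity_second_order\<close>), \<open>\<psi>\<^sup>i = F\<^sup>i\<close>: the field
\<open>\<Gamma> - (\<nabla>(Q(T)))\<^sup>V\<close> has no transverse force and is tangent to the constraint manifold. As \<open>\<xi>\<close> vanishes
there, \<open>\<psi>\<^sup>\<alpha> g\<^sub>\<alpha>\<^sub>b = 0\<close>: the vertical vector \<open>\<psi>\<^sup>\<alpha> X\<^sub>\<alpha>\<^sup>V\<close> annihilates \<open>X\<^sub>b\<^sup>V(L)\<close>, so that the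
Euler-Lagrange equations in the directions \<open>X\<^sub>b\<close>, which hold for \<open>\<Gamma>\<close>, survive the subtraction. These two
properties characterise the nonholonomic field (\<open>nonholonomic_field_eqI\<close>), which therefore agrees with
the new field on the constraint manifold, and its integral curves, which stay in the constraint
manifold, are integral curves of the new field.

The remaining work makes the objects available. The Lagrangian field, the projection, the dynamical
covariant derivative and the nonholonomic field are given by unique descriptions, so for each
of them existence within the smooth category and uniqueness must be proved
(\<open>lagrangian_field_exists_unique\<close>, \<open>orth_projection_exists_unique\<close>, \<open>dyn_cov_deriv_eq\<close>). Linear
systems are solved by Cramer's rule, which keeps solutions smooth. Complete lifts and Lie brackets are
well defined because second derivatives of coordinate changes are symmetric.
\<close>

(* The dot is reserved for the inner product of a Euclidean space. *)
no_notation Matrix.scalar_prod (infix "\<bullet>" 70)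

section \<open>Calculus of smooth maps\<close>

lemma frechet_derivative_cong_open:
  assumes "open S" and "x \<in> S" and "\<And>y. y \<in> S \<Longrightarrow> f y = g y"
  shows "frechet_derivative f (at x) = frechet_derivative g (at x)"
proof -
  have "(f has_derivative f') (at x) \<longleftrightarrow> (g has_derivative f') (at x)" for f'
    using assms has_derivative_transform_within_open[of f f' x UNIV S g]
      has_derivative_transform_within_open[of g f' x UNIV S f] by auto
  then show ?thesis
    by (simp add: frechet_derivative_def)
qed

lemma frechet_derivative_eqI:
  "(f has_derivative f') (at x) \<Longrightarrow> frechet_derivative f (at x) v = f' v"
  using frechet_derivative_at by metis

lemma differentiable_cong_open:
  assumes "open S" and "x \<in> S" and "\<And>y. y \<in> S \<Longrightarrow> f y = g y"
  shows "f differentiable (at x) \<longleftrightarrow> g differentiable (at x)"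
  using assms has_derivative_transform_within_open[of f _ x UNIV S g]
      has_derivative_transform_within_open[of g _ x UNIV S f]
  by (auto simp: differentiable_def)

lemma times_differentiable_on_cong:
  assumes "open S" and "\<And>y. y \<in> S \<Longrightarrow> f y = g y"
  shows "times_differentiable_on k S f \<longleftrightarrow> times_differentiable_on k S g"
  using assms(2)
proof (induction k arbitrary: f g)
  case 0
  then show ?case using continuous_on_cong[of S S f g] by simp
next
  case (Suc k)
  have 1: "frechet_derivative f (at x) v = frechet_derivative g (at x) v" if "x \<in> S" for x v
    using frechet_derivative_cong_open[OF assms(1) that Suc.prems] by simp
  have "f differentiable (at x) \<longleftrightarrow> g differentiable (at x)" if "x \<in> S" for x
    using differentiable_cong_open[OF assms(1) that Suc.prems] by simp
  then show ?case using Suc.IH[OF 1] by auto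
qed

lemma times_differentiable_on_subset:
  "times_differentiable_on k S f \<Longrightarrow> T \<subseteq> S \<Longrightarrow> times_differentiable_on k T f"
  by (induction k arbitrary: f) (auto intro: continuous_on_subset)

text \<open>
The classes decrease. This is what makes the inductions for products and compositions work: the
derivative of a product involves the undifferentiated factors, of which only the lower order is needed.
\<close>

lemma times_differentiable_on_Suc_imp:
  "times_differentiable_on (Suc k) S f \<Longrightarrow> times_differentiable_on k S f"
proof (induction k arbitrary: f)
  case 0
  then show ?case
    by (auto intro!: continuous_at_imp_continuous_on differentiable_imp_continuous_within)
qed auto

text \<open>
The definition of differentiability class refers to \<^const>\<open>frechet_derivative\<close>; with this rule the
closure properties below can be proved from any expression for the derivative, by induction on the
order.
\<close>

lemma times_differentiable_on_SucI:
  assumes "open S" and D: "\<And>x. x \<in> S \<Longrightarrow> (f has_derivative f' x) (at x)"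
    and "\<And>v. times_differentiable_on k S (\<lambda>x. f' x v)"
  shows "times_differentiable_on (Suc k) S f"
proof -
  have "times_differentiable_on k S (\<lambda>x. frechet_derivative f (at x) v)" for v
    by (rule iffD1[OF times_differentiable_on_cong[OF assms(1)] assms(3)])
      (simp add: frechet_derivative_eqI[OF D])
  then show ?thesis
    using D by (auto simp: differentiable_def)
qed

lemma times_differentiable_on_const: "times_differentiable_on k S (\<lambda>x. c)"
  by (induction k arbitrary: c) (auto simp: frechet_derivative_const)

lemma times_differentiable_on_bounded_linear:
  assumes "bounded_linear h" and "open S" and "times_differentiable_on k S f"
  shows "times_differentiable_on k S (\<lambda>x. h (f x))"
  using assms(3)
proof (induction k arbitrary: f)
  case 0
  then show ?case
    using bounded_linear.continuous_on[OF assms(1)] by auto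
next
  case (Suc k)
  have D: "((\<lambda>x. h (f x)) has_derivative (\<lambda>v. h (frechet_derivative f (at x) v))) (at x)"
    if "x \<in> S" for x
    using Suc.prems that frechet_derivative_works[of f "at x"]
    by (auto intro: bounded_linear.has_derivative[OF assms(1)])
  show ?case
    using Suc by (intro times_differentiable_on_SucI[OF assms(2) D] Suc.IH) auto
qed

lemma times_differentiable_on_add:
  assumes "open S" and "times_differentiable_on k S f" and "times_differentiable_on k S g"
  shows "times_differentiable_on k S (\<lambda>x. f x + g x)"
  using assms(2,3)
proof (induction k arbitrary: f g)
  case 0
  then show ?case by (auto intro: continuous_intros)
next
  case (Suc k)
  have D: "((\<lambda>x. f x + g x) has_derivative
      (\<lambda>v. frechet_derivative f (at x) v + frechet_derivative g (at x) v)) (at x)"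
    if "x \<in> S" for x
    using Suc.prems that frechet_derivative_works[of f "at x"] frechet_derivative_works[of g "at x"]
    by (auto intro: has_derivative_add)
  show ?case
    using Suc by (intro times_differentiable_on_SucI[OF assms(1) D] Suc.IH) auto
qed

lemma times_differentiable_on_bilinear:
  assumes "bounded_bilinear pr" and "open S"
    and "times_differentiable_on k S f" and "times_differentiable_on k S g"
  shows "times_differentiable_on k S (\<lambda>x. pr (f x) (g x))"
  using assms(3,4)
proof (induction k arbitrary: f g)
  case 0
  then show ?case by (auto intro: bounded_bilinear.continuous_on[OF assms(1)])
next
  case (Suc k)
  have D: "((\<lambda>x. pr (f x) (g x)) has_derivative
      (\<lambda>v. pr (f x) (frechet_derivative g (at x) v) + pr (frechet_derivative f (at x) v) (g x))) (at x)"
    if "x \<in> S" for x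
    using Suc.prems that frechet_derivative_works[of f "at x"] frechet_derivative_works[of g "at x"]
    by (auto intro: bounded_bilinear.FDERIV[OF assms(1)])
  have "times_differentiable_on k S f" "times_differentiable_on k S g"
    using Suc.prems times_differentiable_on_Suc_imp by blast+
  then have "times_differentiable_on k S (\<lambda>x. pr (f x) (frechet_derivative g (at x) v)
      + pr (frechet_derivative f (at x) v) (g x))" for v
    using Suc by (intro times_differentiable_on_add assms Suc.IH) auto
  then show ?case
    by (intro times_differentiable_on_SucI[OF assms(2) D])
qed

lemma times_differentiable_on_sum:
  assumes "open S" and "\<And>i. i \<in> I \<Longrightarrow> times_differentiable_on k S (f i)"
  shows "times_differentiable_on k S (\<lambda>x. \<Sum>i\<in>I. f i x)"
  using assms(2)
  by (induction I rule: infinite_finite_induct)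
    (auto intro!: times_differentiable_on_const times_differentiable_on_add[OF assms(1)])

text \<open>
Reduces a derivative in a direction that varies with the point to finitely many derivatives in fixed
directions, which are the only ones that the definition of smoothness mentions.
\<close>

lemma linear_Basis_expansion:
  fixes h :: "'a::euclidean_space \<Rightarrow> 'b::real_vector"
  assumes "linear h"
  shows "h v = (\<Sum>b\<in>Basis. (v \<bullet> b) *\<^sub>R h b)"
proof -
  have "h v = h (\<Sum>b\<in>Basis. (v \<bullet> b) *\<^sub>R b)"
    by (simp add: euclidean_representation)
  also have "\<dots> = (\<Sum>b\<in>Basis. (v \<bullet> b) *\<^sub>R h b)"
    using assms by (simp add: linear_sum linear_scale)
  finally show ?thesis .
qed

lemma times_differentiable_on_compose:
  fixes f :: "'a::euclidean_space \<Rightarrow> 'b::real_normed_vector"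
    and g :: "'c::euclidean_space \<Rightarrow> 'a"
  assumes "open S" and "open T" and "times_differentiable_on k T f"
    and "times_differentiable_on k S g" and "g ` S \<subseteq> T"
  shows "times_differentiable_on k S (\<lambda>x. f (g x))"
  using assms(3,4)
proof (induction k arbitrary: f)
  case 0
  then show ?case using assms(5) by (auto intro: continuous_on_compose2)
next
  case (Suc k)
  have D: "((\<lambda>x. f (g x)) has_derivative
      (\<lambda>v. frechet_derivative f (at (g x)) (frechet_derivative g (at x) v))) (at x)"
    if "x \<in> S" for x
  proof -
    have "(f has_derivative frechet_derivative f (at (g x))) (at (g x))"
      using that assms(5) Suc.prems frechet_derivative_works[of f "at (g x)"] by auto
    moreover have "(g has_derivative frechet_derivative g (at x)) (at x)"
      using that Suc.prems frechet_derivative_works[of g "at x"] by auto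
    ultimately show ?thesis
      using has_derivative_compose[of g _ x UNIV f] by simp
  qed
  have E: "(\<Sum>b\<in>Basis. (frechet_derivative g (at x) v \<bullet> b) *\<^sub>R frechet_derivative f (at (g x)) b) =
      frechet_derivative f (at (g x)) (frechet_derivative g (at x) v)"
    if "x \<in> S" for x v
    using that assms(5) Suc.prems
    by (intro linear_Basis_expansion[symmetric] linear_frechet_derivative) auto
  have g: "times_differentiable_on k S g"
    using Suc.prems times_differentiable_on_Suc_imp by blast
  have "times_differentiable_on k S (\<lambda>x. \<Sum>b\<in>Basis.
      (frechet_derivative g (at x) v \<bullet> b) *\<^sub>R frechet_derivative f (at (g x)) b)" for v
    using Suc.prems g
    by (intro times_differentiable_on_sum assms Suc.IH
        times_differentiable_on_bilinear[OF bounded_bilinear_scaleR]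
        times_differentiable_on_bounded_linear[OF bounded_linear_inner_left]) auto
  then have "times_differentiable_on k S (\<lambda>x. frechet_derivative f (at (g x)) (frechet_derivative g (at x) v))" for v
    by (rule iffD1[OF times_differentiable_on_cong[OF assms(1)], rotated]) (rule E)
  then show ?case
    by (intro times_differentiable_on_SucI[OF assms(1) D])
qed

text \<open>
The derivative of the reciprocal is a polynomial in the reciprocal, so every order follows from the
one before.
\<close>

lemma times_differentiable_on_inverse:
  "times_differentiable_on k {x. x \<noteq> 0} (inverse :: real \<Rightarrow> real)"
proof (induction k)
  case 0
  then show ?case by (auto intro!: continuous_intros)
next
  case (Suc k)
  have o: "open {x::real. x \<noteq> 0}"
    by (simp add: open_Collect_neq)
  have D: "((inverse :: real \<Rightarrow> real) has_derivative (\<lambda>h. - (inverse x * h * inverse x))) (at x)"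
    if "x \<in> {x. x \<noteq> 0}" for x
    using that has_derivative_inverse' by simp
  have "times_differentiable_on k {x::real. x \<noteq> 0} (\<lambda>x. - (inverse x * v * inverse x))" for v
    using Suc by (intro times_differentiable_on_bounded_linear[OF bounded_linear_minus[OF bounded_linear_ident]]
        times_differentiable_on_bilinear[OF bounded_bilinear_mult] o times_differentiable_on_const)
  then show ?case
    by (intro times_differentiable_on_SucI[OF o D])
qed

lemma times_differentiable_on_id: "times_differentiable_on k S (\<lambda>x. x)"
proof (cases k)
  case (Suc j)
  then show ?thesis by (simp add: frechet_derivative_ident times_differentiable_on_const)
qed auto

lemma smooth_on_cong:
  "open S \<Longrightarrow> (\<And>y. y \<in> S \<Longrightarrow> f y = g y) \<Longrightarrow> smooth_on S f \<longleftrightarrow> smooth_on S g"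
  unfolding smooth_on_def using times_differentiable_on_cong by blast

lemma smooth_on_subset: "smooth_on S f \<Longrightarrow> T \<subseteq> S \<Longrightarrow> smooth_on T f"
  unfolding smooth_on_def using times_differentiable_on_subset by blast

lemma smooth_on_const: "smooth_on S (\<lambda>x. c)"
  unfolding smooth_on_def using times_differentiable_on_const by blast

lemma smooth_on_id: "smooth_on S (\<lambda>x. x)"
  unfolding smooth_on_def using times_differentiable_on_id by blast

lemma smooth_on_bounded_linear:
  "bounded_linear h \<Longrightarrow> open S \<Longrightarrow> smooth_on S f \<Longrightarrow> smooth_on S (\<lambda>x. h (f x))"
  unfolding smooth_on_def using times_differentiable_on_bounded_linear by blast

lemma smooth_on_add:
  "open S \<Longrightarrow> smooth_on S f \<Longrightarrow> smooth_on S g \<Longrightarrow> smooth_on S (\<lambda>x. f x + g x)"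
  unfolding smooth_on_def using times_differentiable_on_add by blast

lemma smooth_on_sum:
  "open S \<Longrightarrow> (\<And>i. i \<in> I \<Longrightarrow> smooth_on S (f i)) \<Longrightarrow> smooth_on S (\<lambda>x. \<Sum>i\<in>I. f i x)"
  by (simp add: smooth_on_def times_differentiable_on_sum)

lemma smooth_on_bilinear:
  "bounded_bilinear pr \<Longrightarrow> open S \<Longrightarrow> smooth_on S f \<Longrightarrow> smooth_on S g
     \<Longrightarrow> smooth_on S (\<lambda>x. pr (f x) (g x))"
  unfolding smooth_on_def using times_differentiable_on_bilinear by blast

lemmas smooth_on_scaleR = smooth_on_bilinear[OF bounded_bilinear_scaleR]
lemmas smooth_on_mult = smooth_on_bilinear[OF bounded_bilinear_mult]
lemmas smooth_on_uminus = smooth_on_bounded_linear[OF bounded_linear_minus[OF bounded_linear_ident]]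
lemmas smooth_on_fst = smooth_on_bounded_linear[OF bounded_linear_fst]
lemmas smooth_on_snd = smooth_on_bounded_linear[OF bounded_linear_snd]
lemmas smooth_on_inner_left = smooth_on_bounded_linear[OF bounded_linear_inner_left]

lemma smooth_on_diff:
  "open S \<Longrightarrow> smooth_on S f \<Longrightarrow> smooth_on S g \<Longrightarrow> smooth_on S (\<lambda>x. f x - g x)"
  using smooth_on_add[of S f "\<lambda>x. - g x"] smooth_on_uminus[of S g] by simp

lemma smooth_on_Pair:
  fixes f :: "'a::euclidean_space \<Rightarrow> 'b::real_normed_vector"
    and g :: "'a \<Rightarrow> 'c::real_normed_vector"
  assumes "open S" and "smooth_on S f" and "smooth_on S g"
  shows "smooth_on S (\<lambda>x. (f x, g x))"
proof -
  have 1: "bounded_linear (\<lambda>a::'b. (a, 0::'c))" and 2: "bounded_linear (\<lambda>b::'c. (0::'b, b))"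
    by (intro bounded_linear_Pair bounded_linear_ident bounded_linear_zero)+
  have "smooth_on S (\<lambda>x. (f x, 0) + (0, g x))"
    by (rule smooth_on_add[OF assms(1) smooth_on_bounded_linear[OF 1 assms(1,2)]
          smooth_on_bounded_linear[OF 2 assms(1,3)]])
  then show ?thesis by simp
qed

lemma smooth_on_compose:
  assumes "open S" and "open T" and "smooth_on T f" and "smooth_on S g" and "g ` S \<subseteq> T"
  shows "smooth_on S (\<lambda>x. f (g x))"
  using assms unfolding smooth_on_def by (auto intro: times_differentiable_on_compose)

lemma smooth_on_inverse:
  fixes f :: "'a::euclidean_space \<Rightarrow> real"
  assumes "open S" and "smooth_on S f" and "\<And>x. x \<in> S \<Longrightarrow> f x \<noteq> 0"
  shows "smooth_on S (\<lambda>x. inverse (f x))"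
proof (rule smooth_on_compose[OF assms(1) _ _ assms(2)])
  show "open {x::real. x \<noteq> 0}"
    by (simp add: open_Collect_neq)
  show "smooth_on {x::real. x \<noteq> 0} inverse"
    using times_differentiable_on_inverse by (simp add: smooth_on_def)
qed (use assms(3) in auto)

lemma smooth_on_prod:
  fixes f :: "'i \<Rightarrow> 'a::euclidean_space \<Rightarrow> real"
  assumes "open S" and "\<And>i. i \<in> I \<Longrightarrow> smooth_on S (f i)"
  shows "smooth_on S (\<lambda>x. \<Prod>i\<in>I. f i x)"
  using assms(2)
  by (induction I rule: infinite_finite_induct)
    (auto intro!: smooth_on_const smooth_on_mult[OF assms(1)])

lemma smooth_on_differentiable: "smooth_on S f \<Longrightarrow> x \<in> S \<Longrightarrow> f differentiable (at x)"
  unfolding smooth_on_def by (drule spec[of _ 1]) simp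

lemma smooth_on_has_derivative:
  "smooth_on S f \<Longrightarrow> x \<in> S \<Longrightarrow> (f has_derivative frechet_derivative f (at x)) (at x)"
  using smooth_on_differentiable frechet_derivative_works by blast

lemma smooth_on_continuous_on: "smooth_on S f \<Longrightarrow> continuous_on S f"
  unfolding smooth_on_def by (drule spec[of _ 0]) simp

lemma smooth_on_frechet_derivative:
  "smooth_on S f \<Longrightarrow> smooth_on S (\<lambda>x. frechet_derivative f (at x) v)"
  unfolding smooth_on_def using times_differentiable_on.simps(2) by blast

lemma smooth_on_frechet_derivative_apply:
  assumes "open S" and "smooth_on S f" and "smooth_on S g"
  shows "smooth_on S (\<lambda>x. frechet_derivative f (at x) (g x))"
proof -
  have 1: "smooth_on S (\<lambda>x. \<Sum>b\<in>Basis. (g x \<bullet> b) *\<^sub>R frechet_derivative f (at x) b)"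
    by (intro smooth_on_sum smooth_on_scaleR smooth_on_inner_left smooth_on_frechet_derivative assms)
  have 2: "(\<Sum>b\<in>Basis. (g x \<bullet> b) *\<^sub>R frechet_derivative f (at x) b) =
      frechet_derivative f (at x) (g x)" if "x \<in> S" for x
    using linear_frechet_derivative[OF smooth_on_differentiable[OF assms(2) that]]
    by (rule linear_Basis_expansion[symmetric])
  show ?thesis
    by (rule iffD1[OF smooth_on_cong[OF assms(1) 2] 1])
qed

text \<open>
The mean value theorem is applied to the difference in direction \<open>v\<close>, as a function of the step in
direction \<open>u\<close>, and then to the resulting derivative. The left-hand side is symmetric in \<open>u\<close> and \<open>v\<close>,
the right-hand side is not, which is the reason for Schwarz's theorem.
\<close>

section \<open>Symmetry of second derivatives\<close>

lemma second_difference_mean_value: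
  fixes f :: "'a::euclidean_space \<Rightarrow> real"
  assumes f: "smooth_on (ball x r) f" and h: "0 < h" "h * (norm u + norm v) < r"
  shows "\<exists>\<xi>. dist x \<xi> \<le> h * (norm u + norm v) \<and>
    f (x + h *\<^sub>R u + h *\<^sub>R v) - f (x + h *\<^sub>R u) - f (x + h *\<^sub>R v) + f x =
      h * h * frechet_derivative (\<lambda>y. frechet_derivative f (at y) u) (at \<xi>) v"
proof -
  have near: "dist x (x + s *\<^sub>R u + t *\<^sub>R v) \<le> h * (norm u + norm v)"
    if "0 \<le> s" "s \<le> h" "0 \<le> t" "t \<le> h" for s t
  proof -
    have "norm (s *\<^sub>R u + t *\<^sub>R v) \<le> s * norm u + t * norm v"
      using that norm_triangle_ineq[of "s *\<^sub>R u" "t *\<^sub>R v"] by simp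
    also have "\<dots> \<le> h * norm u + h * norm v"
      using that by (intro add_mono mult_right_mono) auto
    finally show ?thesis
      using norm_minus_cancel[of "s *\<^sub>R u + t *\<^sub>R v"] by (simp add: dist_norm algebra_simps)
  qed
  have "((\<lambda>s. f (x + s *\<^sub>R u + h *\<^sub>R v) - f (x + s *\<^sub>R u)) has_real_derivative
      frechet_derivative f (at (x + s *\<^sub>R u + h *\<^sub>R v)) u - frechet_derivative f (at (x + s *\<^sub>R u)) u)
      (at s)" if s: "0 \<le> s" "s \<le> h" for s
  proof -
    have D: "((\<lambda>s. f (x + s *\<^sub>R u + t *\<^sub>R v)) has_real_derivative
        frechet_derivative f (at (x + s *\<^sub>R u + t *\<^sub>R v)) u) (at s)" if t: "0 \<le> t" "t \<le> h" for t
    proof -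
      have d: "(f has_derivative frechet_derivative f (at (x + s *\<^sub>R u + t *\<^sub>R v)))
          (at (x + s *\<^sub>R u + t *\<^sub>R v))"
        using near[OF s t] h by (intro smooth_on_has_derivative[OF f]) auto
      have "((\<lambda>s. x + s *\<^sub>R u + t *\<^sub>R v) has_derivative (\<lambda>k. k *\<^sub>R u)) (at s)"
        by (auto intro!: derivative_eq_intros)
      from has_derivative_compose[OF this d] show ?thesis
        unfolding has_field_derivative_def
        using linear_scale[OF has_derivative_linear[OF d]] by (auto simp: mult.commute[of _ "frechet_derivative f _ u"] elim!: has_derivative_eq_rhs)
    qed
    show ?thesis
      using DERIV_diff[OF D[of h] D[of 0]] h by simp
  qed
  from MVT2[OF h(1) this]
  obtain s where s: "0 < s" "s < h"
    and 1: "f (x + h *\<^sub>R u + h *\<^sub>R v) - f (x + h *\<^sub>R u) - (f (x + h *\<^sub>R v) - f x) =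
      h * (frechet_derivative f (at (x + s *\<^sub>R u + h *\<^sub>R v)) u - frechet_derivative f (at (x + s *\<^sub>R u)) u)"
    by auto
  let ?g = "\<lambda>y. frechet_derivative f (at y) u"
  have "((\<lambda>t. ?g (x + s *\<^sub>R u + t *\<^sub>R v)) has_real_derivative
      frechet_derivative ?g (at (x + s *\<^sub>R u + t *\<^sub>R v)) v) (at t)" if t: "0 \<le> t" "t \<le> h" for t
  proof -
    have d: "(?g has_derivative frechet_derivative ?g (at (x + s *\<^sub>R u + t *\<^sub>R v)))
        (at (x + s *\<^sub>R u + t *\<^sub>R v))"
      using near[OF _ _ t, of s] s h
      by (intro smooth_on_has_derivative[OF smooth_on_frechet_derivative[OF f]]) auto
    have "((\<lambda>t. x + s *\<^sub>R u + t *\<^sub>R v) has_derivative (\<lambda>k. k *\<^sub>R v)) (at t)"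
      by (auto intro!: derivative_eq_intros)
    from has_derivative_compose[OF this d] show ?thesis
      unfolding has_field_derivative_def
      using linear_scale[OF has_derivative_linear[OF d]]
      by (auto simp: mult.commute[of _ "frechet_derivative ?g _ v"] elim!: has_derivative_eq_rhs)
  qed
  from MVT2[OF h(1) this]
  obtain t where t: "0 < t" "t < h"
    and 2: "?g (x + s *\<^sub>R u + h *\<^sub>R v) - ?g (x + s *\<^sub>R u) =
      h * frechet_derivative ?g (at (x + s *\<^sub>R u + t *\<^sub>R v)) v"
    by auto
  show ?thesis
    using near[of s t] s t 1 2 by (intro exI[of _ "x + s *\<^sub>R u + t *\<^sub>R v"]) (simp add: algebra_simps)
qed

text \<open>
Arbitrarily close to \<open>x\<close> there are points at which the two mixed derivatives take the same value,
namely the second difference quotient; by continuity they agree at \<open>x\<close>.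
\<close>

lemma second_derivative_symmetric_real:
  fixes f :: "'a::euclidean_space \<Rightarrow> real"
  assumes "open S" and f: "smooth_on S f" and "x \<in> S"
  shows "frechet_derivative (\<lambda>y. frechet_derivative f (at y) u) (at x) v =
    frechet_derivative (\<lambda>y. frechet_derivative f (at y) v) (at x) u"
    (is "?a x = ?b x")
proof (rule ccontr)
  assume "?a x \<noteq> ?b x"
  define e where "e = \<bar>?a x - ?b x\<bar> / 2"
  have e: "e > 0"
    using \<open>?a x \<noteq> ?b x\<close> by (simp add: e_def)
  have ca: "isCont ?a x" and cb: "isCont ?b x"
    using smooth_on_continuous_on[OF smooth_on_frechet_derivative[OF smooth_on_frechet_derivative[OF f]]]
      assms continuous_on_eq_continuous_at by blast+
  obtain r0 where r0: "r0 > 0" "ball x r0 \<subseteq> S"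
    using assms openE by blast
  obtain r1 where r1: "r1 > 0" "\<And>y. dist y x < r1 \<Longrightarrow> dist (?a y) (?a x) < e"
    using ca e unfolding continuous_at_eps_delta by metis
  obtain r2 where r2: "r2 > 0" "\<And>y. dist y x < r2 \<Longrightarrow> dist (?b y) (?b x) < e"
    using cb e unfolding continuous_at_eps_delta by metis
  define r where "r = min r0 (min r1 r2)"
  have r: "r > 0" "ball x r \<subseteq> S"
    using r0 r1 r2 by (auto simp: r_def)
  \<comment> \<open>A step so small that the whole parallelogram stays in the ball of radius \<open>r\<close>.\<close>
  define h where "h = r / (2 * (norm u + norm v + 1))"
  have pos: "norm u + norm v + 1 > 0"
    using norm_ge_zero[of u] norm_ge_zero[of v] by linarith
  have h: "h > 0"
    using r pos by (simp add: h_def)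
  have "h * (norm u + norm v) < h * (2 * (norm u + norm v + 1))"
    using h by (intro mult_strict_left_mono) (simp_all add: add_nonneg_pos)
  also have "\<dots> = r"
    using pos by (simp add: h_def)
  finally have hr: "h * (norm u + norm v) < r" .
  have fr: "smooth_on (ball x r) f"
    using f r smooth_on_subset by blast
  obtain \<xi> where \<xi>: "dist x \<xi> \<le> h * (norm u + norm v)"
      "f (x + h *\<^sub>R u + h *\<^sub>R v) - f (x + h *\<^sub>R u) - f (x + h *\<^sub>R v) + f x = h * h * ?a \<xi>"
    using second_difference_mean_value[OF fr h hr] by blast
  obtain \<zeta> where \<zeta>: "dist x \<zeta> \<le> h * (norm v + norm u)"
      "f (x + h *\<^sub>R v + h *\<^sub>R u) - f (x + h *\<^sub>R v) - f (x + h *\<^sub>R u) + f x = h * h * ?b \<zeta>"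
    using second_difference_mean_value[OF fr h, of v u] hr by (auto simp: add.commute)
  have "h * h * ?a \<xi> = h * h * ?b \<zeta>"
  proof -
    have e: "x + h *\<^sub>R v + h *\<^sub>R u = x + h *\<^sub>R u + h *\<^sub>R v"
      by simp
    show ?thesis
      using \<xi>(2) \<zeta>(2)[unfolded e] by linarith
  qed
  then have "?a \<xi> = ?b \<zeta>"
    using h by simp
  moreover have "dist (?a \<xi>) (?a x) < e"
    using \<xi>(1) hr by (intro r1(2)) (auto simp: r_def dist_commute)
  moreover have "dist (?b \<zeta>) (?b x) < e"
    using \<zeta>(1) hr by (intro r2(2)) (auto simp: r_def dist_commute add.commute)
  ultimately show False
    by (auto simp: e_def dist_real_def abs_if split: if_splits)
qed

lemma second_derivative_symmetric:
  fixes f :: "'a::euclidean_space \<Rightarrow> 'b::euclidean_space"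
  assumes "open S" and f: "smooth_on S f" and "x \<in> S"
  shows "frechet_derivative (\<lambda>y. frechet_derivative f (at y) u) (at x) v =
    frechet_derivative (\<lambda>y. frechet_derivative f (at y) v) (at x) u"
proof (rule euclidean_eqI)
  fix b :: 'b
  let ?f = "\<lambda>y. f y \<bullet> b"
  have fb: "smooth_on S ?f"
    by (intro smooth_on_inner_left assms)
  have inner: "frechet_derivative (\<lambda>y. g y \<bullet> b) (at y) w = frechet_derivative g (at y) w \<bullet> b"
    if "smooth_on S g" "y \<in> S" for g :: "'a \<Rightarrow> 'b" and y w
    using smooth_on_has_derivative[OF that]
    by (intro frechet_derivative_eqI has_derivative_inner_left)
  have "frechet_derivative (\<lambda>y. frechet_derivative f (at y) u) (at x) v \<bullet> b =
      frechet_derivative (\<lambda>y. frechet_derivative ?f (at y) u) (at x) v" for u v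
    using frechet_derivative_cong_open[OF assms(1,3),
        of "\<lambda>y. frechet_derivative ?f (at y) u" "\<lambda>y. frechet_derivative f (at y) u \<bullet> b"]
      inner[OF f] inner[OF smooth_on_frechet_derivative[OF f] assms(3)] by simp
  then show "frechet_derivative (\<lambda>y. frechet_derivative f (at y) u) (at x) v \<bullet> b =
      frechet_derivative (\<lambda>y. frechet_derivative f (at y) v) (at x) u \<bullet> b"
    using second_derivative_symmetric_real[OF assms(1) fb assms(3)] by simp
qed

section \<open>Smooth inverses of matrices\<close>

text \<open>
Cramer's rule. The entries are rational functions of the entries of \<open>G\<close>, whence their smoothness.
Matrices are functions on pairs of indices, like the Hessian in a frame.
\<close>

definition matrix_inverse :: "nat \<Rightarrow> (nat \<Rightarrow> nat \<Rightarrow> real) \<Rightarrow> nat \<Rightarrow> nat \<Rightarrow> real" where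
  "matrix_inverse n G i j =
     inverse (Determinant.det (mat n n (\<lambda>(i, j). G i j))) * adj_mat (mat n n (\<lambda>(i, j). G i j)) $$ (i, j)"

lemma matrix_inverse_mult:
  assumes "Determinant.det (mat n n (\<lambda>(i, j). G i j)) \<noteq> 0" and "i < n" and "j < n"
  shows "(\<Sum>k<n. G i k * matrix_inverse n G k j) = (if i = j then 1 else 0)"
    and "(\<Sum>k<n. matrix_inverse n G i k * G k j) = (if i = j then 1 else 0)"
proof -
  let ?G = "mat n n (\<lambda>(i, j). G i j)"
  have G: "?G \<in> carrier_mat n n"
    by simp
  have adj: "adj_mat ?G \<in> carrier_mat n n"
    using adj_mat(1)[OF G] .
  have "(?G * adj_mat ?G) $$ (i, j) = (\<Sum>k<n. G i k * adj_mat ?G $$ (k, j))"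
    using adj assms by (auto simp: times_mat_def scalar_prod_def atLeast0LessThan)
  then have "(\<Sum>k<n. G i k * adj_mat ?G $$ (k, j)) = Determinant.det ?G * (if i = j then 1 else 0)"
    using adj_mat(2)[OF G] assms by simp
  moreover have "(\<Sum>k<n. G i k * matrix_inverse n G k j) =
      inverse (Determinant.det ?G) * (\<Sum>k<n. G i k * adj_mat ?G $$ (k, j))"
    by (simp add: matrix_inverse_def sum_distrib_left mult_ac)
  ultimately show "(\<Sum>k<n. G i k * matrix_inverse n G k j) = (if i = j then 1 else 0)"
    using assms(1) by simp
  have "(adj_mat ?G * ?G) $$ (i, j) = (\<Sum>k<n. adj_mat ?G $$ (i, k) * G k j)"
    using adj assms by (auto simp: times_mat_def scalar_prod_def atLeast0LessThan)
  then have "(\<Sum>k<n. adj_mat ?G $$ (i, k) * G k j) = Determinant.det ?G * (if i = j then 1 else 0)"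
    using adj_mat(3)[OF G] assms by simp
  moreover have "(\<Sum>k<n. matrix_inverse n G i k * G k j) =
      inverse (Determinant.det ?G) * (\<Sum>k<n. adj_mat ?G $$ (i, k) * G k j)"
    by (simp add: matrix_inverse_def sum_distrib_left mult_ac)
  ultimately show "(\<Sum>k<n. matrix_inverse n G i k * G k j) = (if i = j then 1 else 0)"
    using assms(1) by simp
qed

lemma matrix_inverse_solves:
  assumes "Determinant.det (mat n n (\<lambda>(i, j). G i j)) \<noteq> 0" and "k < n"
  shows "(\<Sum>i<n. (\<Sum>j<n. r j * matrix_inverse n G j i) * G i k) = r k"
proof -
  have "(\<Sum>i<n. (\<Sum>j<n. r j * matrix_inverse n G j i) * G i k) =
      (\<Sum>i<n. \<Sum>j<n. r j * (matrix_inverse n G j i * G i k))"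
    by (simp add: sum_distrib_right mult.assoc)
  also have "\<dots> = (\<Sum>j<n. \<Sum>i<n. r j * (matrix_inverse n G j i * G i k))"
    by (rule sum.swap)
  also have "\<dots> = (\<Sum>j<n. r j * (if j = k then 1 else 0))"
    using matrix_inverse_mult(2)[OF assms(1) _ assms(2)] by (intro sum.cong) (simp_all flip: sum_distrib_left)
  also have "\<dots> = r k"
    using assms(2) by (simp add: if_distrib[of "\<lambda>x. _ * x"] cong: if_cong)
  finally show ?thesis .
qed

lemma nonsingular_left_cancel:
  fixes G :: "nat \<Rightarrow> nat \<Rightarrow> real"
  assumes det: "Determinant.det (mat n n (\<lambda>(i, j). G i j)) \<noteq> 0"
    and eq: "\<And>j. j < n \<Longrightarrow> (\<Sum>i<n. x i * G i j) = (\<Sum>i<n. y i * G i j)" and k: "k < n"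
  shows "x k = y k"
proof -
  have "u k = (\<Sum>j<n. (\<Sum>i<n. u i * G i j) * matrix_inverse n G j k)" for u :: "nat \<Rightarrow> real"
  proof -
    have "(\<Sum>j<n. (\<Sum>i<n. u i * G i j) * matrix_inverse n G j k) =
        (\<Sum>j<n. \<Sum>i<n. u i * (G i j * matrix_inverse n G j k))"
      by (simp add: sum_distrib_right mult.assoc)
    also have "\<dots> = (\<Sum>i<n. \<Sum>j<n. u i * (G i j * matrix_inverse n G j k))"
      by (rule sum.swap)
    also have "\<dots> = (\<Sum>i<n. u i * (if i = k then 1 else 0))"
      using matrix_inverse_mult(1)[OF det _ k] by (intro sum.cong) (simp_all flip: sum_distrib_left)
    also have "\<dots> = u k"
      using k by (simp add: if_distrib[of "\<lambda>x. _ * x"] cong: if_cong)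
    finally show ?thesis by simp
  qed
  from this[of x] this[of y] show ?thesis
    using eq by simp
qed

text \<open>
A singular matrix has a nonzero vector in its kernel.
\<close>

lemma det_nonzeroI:
  fixes G :: "nat \<Rightarrow> nat \<Rightarrow> real"
  assumes "\<And>w. (\<And>i. i < n \<Longrightarrow> (\<Sum>j<n. G i j * w j) = 0) \<Longrightarrow> (\<And>j. j < n \<Longrightarrow> w j = 0)"
  shows "Determinant.det (mat n n (\<lambda>(i, j). G i j)) \<noteq> 0"
proof
  assume "Determinant.det (mat n n (\<lambda>(i, j). G i j)) = 0"
  then obtain v where v: "v \<in> carrier_vec n" "v \<noteq> 0\<^sub>v n" "mat n n (\<lambda>(i, j). G i j) *\<^sub>v v = 0\<^sub>v n"
    using det_0_iff_vec_prod_zero_field[of "mat n n (\<lambda>(i, j). G i j)" n] by auto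
  have "(\<Sum>j<n. G i j * vec_index v j) = 0" if i: "i < n" for i
  proof -
    have "(mat n n (\<lambda>(i, j). G i j) *\<^sub>v v) $ i = 0"
      using v(3) i by simp
    then show ?thesis
      using v(1) i by (simp add: scalar_prod_def atLeast0LessThan)
  qed
  then have "vec_index v j = 0" if "j < n" for j
    using assms that by blast
  then have "v = 0\<^sub>v n"
    using v(1) by (intro eq_vecI) auto
  then show False using v(2) by simp
qed

lemma smooth_on_det:
  fixes M :: "'a::euclidean_space \<Rightarrow> real mat"
  assumes "open S" and "\<And>x. M x \<in> carrier_mat n n"
    and "\<And>i j. i < n \<Longrightarrow> j < n \<Longrightarrow> smooth_on S (\<lambda>x. M x $$ (i, j))"
  shows "smooth_on S (\<lambda>x. Determinant.det (M x))"
proof -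
  have "smooth_on S (\<lambda>x. \<Sum>p | p permutes {0..<n}. signof p * (\<Prod>i = 0..<n. M x $$ (i, p i)))"
    using assms by (intro smooth_on_sum smooth_on_mult smooth_on_const smooth_on_prod)
      (auto intro!: assms simp: permutes_in_image)
  moreover have "dim_row (M x) = n" "dim_col (M x) = n" for x
    using assms(2)[of x] by auto
  ultimately show ?thesis
    by (simp add: Determinant.det_def)
qed

lemma smooth_on_matrix_inverse:
  fixes G :: "'a::euclidean_space \<Rightarrow> nat \<Rightarrow> nat \<Rightarrow> real"
  assumes "open S" and G: "\<And>i j. i < n \<Longrightarrow> j < n \<Longrightarrow> smooth_on S (\<lambda>x. G x i j)"
    and "\<And>x. x \<in> S \<Longrightarrow> Determinant.det (mat n n (\<lambda>(i, j). G x i j)) \<noteq> 0"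
    and ij: "i < n" "j < n"
  shows "smooth_on S (\<lambda>x. matrix_inverse n (G x) i j)"
proof -
  let ?G = "\<lambda>x. mat n n (\<lambda>(i, j). G x i j)"
  have "smooth_on S (\<lambda>x. Determinant.det (?G x))"
    by (rule smooth_on_det[OF assms(1)]) (use G in auto)
  then have 1: "smooth_on S (\<lambda>x. inverse (Determinant.det (?G x)))"
    by (intro smooth_on_inverse assms) auto
  have "smooth_on S (\<lambda>x. mat_delete (?G x) j i $$ (k, l))" if "k < n - 1" "l < n - 1" for k l
    using that ij by (auto simp: mat_delete_def intro!: G)
  then have "smooth_on S (\<lambda>x. Determinant.det (mat_delete (?G x) j i))"
    by (intro smooth_on_det[OF assms(1), of _ "n - 1"]) auto
  then have 2: "smooth_on S (\<lambda>x. adj_mat (?G x) $$ (i, j))"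
    using ij by (simp add: adj_mat_def cofactor_def smooth_on_mult smooth_on_const assms(1))
  show ?thesis
    unfolding matrix_inverse_def by (intro smooth_on_mult assms 1 2)
qed

section \<open>The derivative as a function of point and direction\<close>

lemma has_derivative_comp_fst:
  assumes "(f has_derivative f') (at (fst z))"
  shows "((\<lambda>z. f (fst z)) has_derivative (\<lambda>w. f' (fst w))) (at z)"
  using has_derivative_compose[OF has_derivative_fst[OF has_derivative_ident] assms] .

text \<open>
For a coordinate change \<open>f\<close> the map \<open>(x, y) \<mapsto> Df(x) y\<close> is the fibre part of the induced change of natural
coordinates on the tangent bundle. It is linear in \<open>y\<close>, so its derivative consists of a second
derivative of \<open>f\<close> and a first one.
\<close>

lemma has_derivative_frechet_derivative_apply:
  fixes f :: "'a::euclidean_space \<Rightarrow> 'b::real_normed_vector"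
  assumes "open S" and f: "smooth_on S f" and z: "fst z \<in> S"
  shows "((\<lambda>z. frechet_derivative f (at (fst z)) (snd z)) has_derivative
    (\<lambda>w. frechet_derivative (\<lambda>x. frechet_derivative f (at x) (snd z)) (at (fst z)) (fst w)
      + frechet_derivative f (at (fst z)) (snd w))) (at z)"
proof -
  let ?F = "\<lambda>b x. frechet_derivative f (at x) b"
  have lin: "?F y x = (\<Sum>b\<in>Basis. (y \<bullet> b) *\<^sub>R ?F b x)" if "x \<in> S" for x y
    using linear_Basis_expansion[OF linear_frechet_derivative[OF smooth_on_differentiable[OF f that]]] .
  have F: "(?F b has_derivative frechet_derivative (?F b) (at (fst z))) (at (fst z))" for b
    by (rule smooth_on_has_derivative[OF smooth_on_frechet_derivative[OF f] z])
  have "((\<lambda>x. \<Sum>b\<in>Basis. (snd z \<bullet> b) *\<^sub>R ?F b x) has_derivative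
      (\<lambda>a. \<Sum>b\<in>Basis. (snd z \<bullet> b) *\<^sub>R frechet_derivative (?F b) (at (fst z)) a)) (at (fst z))"
    by (intro has_derivative_sum has_derivative_scaleR_right F)
  then have "(?F (snd z) has_derivative
      (\<lambda>a. \<Sum>b\<in>Basis. (snd z \<bullet> b) *\<^sub>R frechet_derivative (?F b) (at (fst z)) a)) (at (fst z))"
    by (rule has_derivative_transform_within_open[OF _ assms(1) z lin[symmetric]])
  note Fz = frechet_derivative_eqI[OF this]
  have "((\<lambda>z. \<Sum>b\<in>Basis. (snd z \<bullet> b) *\<^sub>R ?F b (fst z)) has_derivative
      (\<lambda>w. \<Sum>b\<in>Basis. (snd z \<bullet> b) *\<^sub>R frechet_derivative (?F b) (at (fst z)) (fst w)
        + (snd w \<bullet> b) *\<^sub>R ?F b (fst z))) (at z)"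
    by (intro has_derivative_sum has_derivative_scaleR has_derivative_inner_left
        has_derivative_snd has_derivative_ident has_derivative_comp_fst[OF F])
  then have "((\<lambda>z. \<Sum>b\<in>Basis. (snd z \<bullet> b) *\<^sub>R ?F b (fst z)) has_derivative
    (\<lambda>w. frechet_derivative (?F (snd z)) (at (fst z)) (fst w) + ?F (snd w) (fst z))) (at z)"
    by (simp only: sum.distrib Fz lin[OF z, symmetric])
  then show ?thesis
    by (rule has_derivative_transform_within_open[of _ _ _ _ "S \<times> UNIV"])
      (auto simp: open_Times assms mem_Times_iff lin[symmetric])
qed

lemma smooth_on_frechet_derivative_pair:
  fixes f :: "'a::euclidean_space \<Rightarrow> 'b::real_normed_vector"
  assumes "open S" and f: "smooth_on S f"
  shows "smooth_on (S \<times> UNIV) (\<lambda>z. frechet_derivative f (at (fst z)) (snd z))"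
proof -
  let ?T = "S \<times> (UNIV :: 'a set)"
  have o: "open ?T"
    by (simp add: open_Times assms)
  have 1: "smooth_on ?T (\<lambda>z. frechet_derivative f (at (fst z)) b)" for b
    by (rule smooth_on_compose[OF o assms(1) smooth_on_frechet_derivative[OF f] smooth_on_fst[OF o smooth_on_id]])
      auto
  have 2: "smooth_on ?T (\<lambda>z. \<Sum>b\<in>Basis. (snd z \<bullet> b) *\<^sub>R frechet_derivative f (at (fst z)) b)"
    by (intro smooth_on_sum smooth_on_scaleR smooth_on_inner_left smooth_on_snd smooth_on_id o 1)
  have 3: "(\<Sum>b\<in>Basis. (snd z \<bullet> b) *\<^sub>R frechet_derivative f (at (fst z)) b) =
      frechet_derivative f (at (fst z)) (snd z)" if "z \<in> ?T" for z
    using that linear_Basis_expansion[OF linear_frechet_derivative[OF smooth_on_differentiable[OF f]]]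
    by (auto simp: mem_Times_iff)
  show ?thesis
    by (rule iffD1[OF smooth_on_cong[OF o 3] 2])
qed

lemma has_derivative_frechet_derivative_field:
  fixes f :: "'a::euclidean_space \<Rightarrow> 'b::real_normed_vector"
  assumes "open S" and f: "smooth_on S f" and x: "x \<in> S" and g: "(g has_derivative g') (at x)"
  shows "((\<lambda>x. frechet_derivative f (at x) (g x)) has_derivative
    (\<lambda>a. frechet_derivative (\<lambda>x'. frechet_derivative f (at x') (g x)) (at x) a
      + frechet_derivative f (at x) (g' a))) (at x)"
proof -
  have "((\<lambda>x. (x, g x)) has_derivative (\<lambda>a. (a, g' a))) (at x)"
    by (intro has_derivative_Pair has_derivative_ident g)
  from has_derivative_compose[OF this has_derivative_frechet_derivative_apply[OF assms(1,2)]]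
  show ?thesis using x by simp
qed

section \<open>Smooth atlases\<close>

text \<open>
The local part of a smooth manifold structure. It is inherited by the tangent bundle, so that
everything proved about functions, tangent vectors and vector fields here holds on the manifold and on
its tangent bundle alike.
\<close>

locale smooth_atlas =
  fixes A :: "('p, 'e::euclidean_space) chart set"
  assumes inj_chart: "c \<in> A \<Longrightarrow> inj_on (snd c) (fst c)"
    and open_chart: "c \<in> A \<Longrightarrow> open (snd c ` fst c)"
    and open_overlap: "c \<in> A \<Longrightarrow> d \<in> A \<Longrightarrow> open (snd c ` (fst c \<inter> fst d))"
    and smooth_transition:
      "c \<in> A \<Longrightarrow> d \<in> A \<Longrightarrow> smooth_on (snd c ` (fst c \<inter> fst d)) (snd d \<circ> chart_inv c)"

lemma smooth_manifold_imp_smooth_atlas: "smooth_manifold A \<Longrightarrow> smooth_atlas A"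
  unfolding smooth_manifold_def smooth_atlas_def by blast

lemma smooth_fun_cong:
  assumes "smooth_atlas A" and "\<And>p. p \<in> points A \<Longrightarrow> f p = g p"
  shows "smooth_fun A f \<longleftrightarrow> smooth_fun A g"
proof -
  interpret smooth_atlas A by fact
  have "smooth_on (snd c ` fst c) (f \<circ> chart_inv c) \<longleftrightarrow> smooth_on (snd c ` fst c) (g \<circ> chart_inv c)"
    if c: "c \<in> A" for c
    using assms(2) c inv_into_into[of _ "snd c" "fst c"]
    by (intro smooth_on_cong open_chart) (auto simp: chart_inv_def points_def)
  then show ?thesis by (simp add: smooth_fun_def)
qed

context smooth_atlas
begin

abbreviation transition :: "('p, 'e) chart \<Rightarrow> ('p, 'e) chart \<Rightarrow> 'e \<Rightarrow> 'e" where
  "transition c d \<equiv> snd d \<circ> chart_inv c"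

abbreviation overlap :: "('p, 'e) chart \<Rightarrow> ('p, 'e) chart \<Rightarrow> 'e set" where
  "overlap c d \<equiv> snd c ` (fst c \<inter> fst d)"

lemma chart_inv_chart [simp]: "c \<in> A \<Longrightarrow> p \<in> fst c \<Longrightarrow> chart_inv c (snd c p) = p"
  by (simp add: chart_inv_def inj_chart)

lemma chart_inv_in: "c \<in> A \<Longrightarrow> x \<in> snd c ` fst c \<Longrightarrow> chart_inv c x \<in> fst c"
  by (auto simp: inj_chart)

lemma chart_chart_inv: "c \<in> A \<Longrightarrow> x \<in> snd c ` fst c \<Longrightarrow> snd c (chart_inv c x) = x"
  by (auto simp: inj_chart)

lemma in_overlap: "p \<in> fst c \<Longrightarrow> p \<in> fst d \<Longrightarrow> snd c p \<in> overlap c d"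
  by auto

lemma in_points: "c \<in> A \<Longrightarrow> p \<in> fst c \<Longrightarrow> p \<in> points A"
  by (auto simp: points_def)

lemma point_in_chart: "p \<in> points A \<Longrightarrow> \<exists>c. c \<in> A \<and> p \<in> fst c"
  by (auto simp: points_def)

lemma transition_has_derivative:
  assumes "c \<in> A" and "d \<in> A" and "p \<in> fst c" and "p \<in> fst d"
  shows "(transition c d has_derivative frechet_derivative (transition c d) (at (snd c p))) (at (snd c p))"
  using assms by (intro smooth_on_has_derivative[OF smooth_transition]) auto

lemma linear_transition_derivative:
  assumes "c \<in> A" and "d \<in> A" and "p \<in> fst c" and "p \<in> fst d"
  shows "linear (frechet_derivative (transition c d) (at (snd c p)))"
  using has_derivative_linear[OF transition_has_derivative[OF assms]] .

lemma smooth_fun_has_derivative: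
  assumes "smooth_fun A f" and "c \<in> A" and "p \<in> fst c"
  shows "((f \<circ> chart_inv c) has_derivative frechet_derivative (f \<circ> chart_inv c) (at (snd c p))) (at (snd c p))"
  using assms by (intro smooth_on_has_derivative[of "snd c ` fst c"]) (auto simp: smooth_fun_def)

text \<open>
The chain rule for two coordinate representations of one function. Applied to a third chart it gives
the cocycle condition for Jacobians, applied to a component of a vector field or to a function it
compares derivatives in different charts.
\<close>

lemma frechet_derivative_chart_change:
  fixes f :: "'p \<Rightarrow> 'b::real_normed_vector"
  assumes c: "c \<in> A" and d: "d \<in> A" and p: "p \<in> fst c" "p \<in> fst d"
    and f: "((f \<circ> chart_inv d) has_derivative f') (at (snd d p))"
  shows "frechet_derivative (f \<circ> chart_inv c) (at (snd c p)) a =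
    f' (frechet_derivative (transition c d) (at (snd c p)) a)"
proof -
  have "((\<lambda>x. (f \<circ> chart_inv d) (transition c d x)) has_derivative
      (\<lambda>a. f' (frechet_derivative (transition c d) (at (snd c p)) a))) (at (snd c p))"
    using f has_derivative_compose[OF transition_has_derivative[OF c d p], of "f \<circ> chart_inv d" f']
    by (simp add: c p)
  then have "((f \<circ> chart_inv c) has_derivative
      (\<lambda>a. f' (frechet_derivative (transition c d) (at (snd c p)) a))) (at (snd c p))"
    by (rule has_derivative_transform_within_open[of _ _ _ _ "overlap c d"])
      (auto simp: c d p open_overlap)
  then show ?thesis
    by (rule frechet_derivative_eqI)
qed

lemma transition_cocycle:
  assumes "c \<in> A" "d \<in> A" "e \<in> A" "p \<in> fst c" "p \<in> fst d" "p \<in> fst e"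
  shows "frechet_derivative (transition d e) (at (snd d p)) (frechet_derivative (transition c d) (at (snd c p)) a)
    = frechet_derivative (transition c e) (at (snd c p)) a"
  using frechet_derivative_chart_change[of c d p "snd e"] transition_has_derivative[of d e p] assms
  by simp

lemma transition_refl:
  assumes "c \<in> A" "p \<in> fst c"
  shows "frechet_derivative (transition c c) (at (snd c p)) a = a"
proof -
  have "((\<lambda>x. x) has_derivative (\<lambda>a. a)) (at (snd c p))"
    by (rule has_derivative_ident)
  then have "(transition c c has_derivative (\<lambda>a. a)) (at (snd c p))"
    by (rule has_derivative_transform_within_open[of _ _ _ _ "snd c ` fst c"])
      (auto simp: assms open_chart)
  then show ?thesis
    by (rule frechet_derivative_eqI)
qed

subsection \<open>Tangent spaces\<close>

lemma tangent_outside: "v \<in> tangent_space A p \<Longrightarrow> \<not> (c \<in> A \<and> p \<in> fst c) \<Longrightarrow> v c = 0"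
  unfolding tangent_space_def by blast

lemma tangent_change:
  "v \<in> tangent_space A p \<Longrightarrow> c \<in> A \<Longrightarrow> d \<in> A \<Longrightarrow> p \<in> fst c \<Longrightarrow> p \<in> fst d
    \<Longrightarrow> v d = frechet_derivative (transition c d) (at (snd c p)) (v c)"
  unfolding tangent_space_def by blast

lemma tangent_vector_eqI:
  assumes "v \<in> tangent_space A p" "w \<in> tangent_space A p" "c \<in> A" "p \<in> fst c" "v c = w c"
  shows "v = w"
proof
  show "v d = w d" for d
    using assms tangent_change[of v p c d] tangent_change[of w p c d]
      tangent_outside[of v p d] tangent_outside[of w p d] by metis
qed

lemma tangent_space_zero: "(\<lambda>_. 0) \<in> tangent_space A p"
proof -
  have "frechet_derivative (transition c d) (at (snd c p)) 0 = 0" if "c \<in> A" "d \<in> A" "p \<in> fst c \<inter> fst d" for c d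
    using linear_0[OF linear_transition_derivative[of c d p]] that by simp
  then show ?thesis unfolding tangent_space_def by auto
qed

lemma tangent_space_add:
  assumes "v \<in> tangent_space A p" "w \<in> tangent_space A p"
  shows "(\<lambda>c. v c + w c) \<in> tangent_space A p"
  unfolding tangent_space_def
proof (intro CollectI conjI allI ballI impI)
  fix c d assume "c \<in> A" "d \<in> A" "p \<in> fst c \<inter> fst d"
  then show "v d + w d = frechet_derivative (transition c d) (at (snd c p)) (v c + w c)"
    using tangent_change[OF assms(1), of c d] tangent_change[OF assms(2), of c d]
      linear_add[OF linear_transition_derivative[of c d p]] by simp
qed (use tangent_outside[OF assms(1)] tangent_outside[OF assms(2)] in simp)

lemma tangent_space_scaleR:
  assumes "v \<in> tangent_space A p"
  shows "(\<lambda>c. r *\<^sub>R v c) \<in> tangent_space A p"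
  unfolding tangent_space_def
proof (intro CollectI conjI allI ballI impI)
  fix c d assume "c \<in> A" "d \<in> A" "p \<in> fst c \<inter> fst d"
  then show "r *\<^sub>R v d = frechet_derivative (transition c d) (at (snd c p)) (r *\<^sub>R v c)"
    using tangent_change[OF assms(1), of c d]
      linear_scale[OF linear_transition_derivative[of c d p]] by simp
qed (use tangent_outside[OF assms] in simp)

lemma tangent_space_sum:
  assumes "\<And>i. i \<in> I \<Longrightarrow> v i \<in> tangent_space A p"
  shows "(\<lambda>c. \<Sum>i\<in>I. v i c) \<in> tangent_space A p"
  using assms
  by (induction I rule: infinite_finite_induct) (auto intro!: tangent_space_zero tangent_space_add)

lemma tangent_space_lin_comb:
  "(\<And>i. i \<in> N \<Longrightarrow> Y i \<in> tangent_space A p) \<Longrightarrow> lin_comb N w Y \<in> tangent_space A p"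
  unfolding lin_comb_def by (intro tangent_space_sum tangent_space_scaleR)

text \<open>
The tangent vector at \<open>p\<close> with prescribed coordinates in one chart. Its existence shows that the fibres
of the tangent bundle are mapped onto the whole model space by natural coordinates.
\<close>

definition tangent_vector :: "'p \<Rightarrow> ('p, 'e) chart \<Rightarrow> 'e \<Rightarrow> ('p, 'e) tvec" where
  "tangent_vector p c y = (\<lambda>d. if d \<in> A \<and> p \<in> fst d
     then frechet_derivative (transition c d) (at (snd c p)) y else 0)"

lemma tangent_vector_in: "c \<in> A \<Longrightarrow> p \<in> fst c \<Longrightarrow> tangent_vector p c y \<in> tangent_space A p"
  unfolding tangent_space_def tangent_vector_def by (auto simp del: o_apply simp: transition_cocycle)

lemma tangent_vector_at [simp]: "c \<in> A \<Longrightarrow> p \<in> fst c \<Longrightarrow> tangent_vector p c y c = y"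
  using transition_refl by (simp add: tangent_vector_def)

subsection \<open>Smooth functions and directional derivatives\<close>

lemma smooth_fun_const: "smooth_fun A (\<lambda>p. k)"
  by (simp add: smooth_fun_def o_def smooth_on_const)

lemma smooth_fun_add: "smooth_fun A f \<Longrightarrow> smooth_fun A g \<Longrightarrow> smooth_fun A (\<lambda>p. f p + g p)"
  by (auto simp: smooth_fun_def o_def intro!: smooth_on_add open_chart)

lemma smooth_fun_diff: "smooth_fun A f \<Longrightarrow> smooth_fun A g \<Longrightarrow> smooth_fun A (\<lambda>p. f p - g p)"
  by (auto simp: smooth_fun_def o_def intro!: smooth_on_diff open_chart)

lemma smooth_fun_mult:
  fixes f g :: "'p \<Rightarrow> real"
  shows "smooth_fun A f \<Longrightarrow> smooth_fun A g \<Longrightarrow> smooth_fun A (\<lambda>p. f p * g p)"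
  by (auto simp: smooth_fun_def o_def intro!: smooth_on_mult open_chart)

lemma smooth_fun_sum:
  "(\<And>i. i \<in> I \<Longrightarrow> smooth_fun A (f i)) \<Longrightarrow> smooth_fun A (\<lambda>p. \<Sum>i\<in>I. f i p)"
  by (auto simp: smooth_fun_def o_def intro!: smooth_on_sum open_chart)

lemma smooth_fun_matrix_inverse:
  assumes "\<And>i j. i < n \<Longrightarrow> j < n \<Longrightarrow> smooth_fun A (\<lambda>p. G p i j)"
    and "\<And>p. p \<in> points A \<Longrightarrow> Determinant.det (mat n n (\<lambda>(i, j). G p i j)) \<noteq> 0"
    and "i < n" "j < n"
  shows "smooth_fun A (\<lambda>p. matrix_inverse n (G p) i j)"
  unfolding smooth_fun_def o_def
proof
  fix c assume c: "c \<in> A"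
  show "smooth_on (snd c ` fst c) (\<lambda>x. matrix_inverse n (G (chart_inv c x)) i j)"
    using assms c in_points chart_inv_in
    by (intro smooth_on_matrix_inverse open_chart c) (auto simp: smooth_fun_def o_def)
qed

text \<open>
The directional derivative is defined in an arbitrarily chosen chart at the point. For a tangent
vector the Jacobian in its transformation law cancels the one from the chain rule.
\<close>

lemma dir_deriv_chart:
  assumes "v \<in> tangent_space A p" and "smooth_fun A f" and "c \<in> A" and "p \<in> fst c"
  shows "dir_deriv A p v f = frechet_derivative (f \<circ> chart_inv c) (at (snd c p)) (v c)"
proof -
  define d where "d = (SOME c. c \<in> A \<and> p \<in> fst c)"
  have "d \<in> A \<and> p \<in> fst d"
    unfolding d_def by (rule someI[of _ c]) (use assms in auto)
  then have d: "d \<in> A" "p \<in> fst d" by auto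
  have "dir_deriv A p v f = frechet_derivative (f \<circ> chart_inv d) (at (snd d p)) (v d)"
    by (simp add: dir_deriv_def Let_def d_def)
  also have "\<dots> = frechet_derivative (f \<circ> chart_inv c) (at (snd c p))
      (frechet_derivative (transition d c) (at (snd d p)) (v d))"
    using assms d by (intro frechet_derivative_chart_change smooth_fun_has_derivative) auto
  also have "frechet_derivative (transition d c) (at (snd d p)) (v d) = v c"
    using tangent_change[OF assms(1) d(1) assms(3) d(2) assms(4)] by simp
  finally show ?thesis .
qed

lemma dir_deriv_eqI:
  assumes "p \<in> points A"
    and "\<And>c. c \<in> A \<Longrightarrow> p \<in> fst c \<Longrightarrow> frechet_derivative (f \<circ> chart_inv c) (at (snd c p)) (v c) = r"
  shows "dir_deriv A p v f = r"
  using assms(2) someI_ex[OF point_in_chart[OF assms(1)]] by (auto simp: dir_deriv_def Let_def)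

text \<open>
One chart computes all directional derivatives at a point, so linearity and the Leibniz rule
carry over from the derivative in that chart.
\<close>

lemma obtain_dir_deriv_chart:
  assumes "p \<in> points A"
  obtains c where "c \<in> A" "p \<in> fst c"
    "\<And>v f. dir_deriv A p v f = frechet_derivative (f \<circ> chart_inv c) (at (snd c p)) (v c)"
  using someI_ex[OF point_in_chart[OF assms]] that[of "SOME c. c \<in> A \<and> p \<in> fst c"]
  by (auto simp: dir_deriv_def Let_def)

lemma dir_deriv_sum:
  assumes "p \<in> points A" "smooth_fun A f"
  shows "dir_deriv A p (\<lambda>d. \<Sum>i\<in>I. v i d) f = (\<Sum>i\<in>I. dir_deriv A p (v i) f)"
proof -
  obtain c where c: "c \<in> A" "p \<in> fst c"
    "\<And>v f. dir_deriv A p v f = frechet_derivative (f \<circ> chart_inv c) (at (snd c p)) (v c)"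
    using obtain_dir_deriv_chart[OF assms(1)] by blast
  show ?thesis
    unfolding c(3) by (rule linear_sum[OF has_derivative_linear[OF smooth_fun_has_derivative[OF assms(2) c(1,2)]]])
qed

lemma dir_deriv_add:
  assumes "p \<in> points A" "smooth_fun A f"
  shows "dir_deriv A p (\<lambda>d. v d + w d) f = dir_deriv A p v f + dir_deriv A p w f"
proof -
  obtain c where c: "c \<in> A" "p \<in> fst c"
    "\<And>v f. dir_deriv A p v f = frechet_derivative (f \<circ> chart_inv c) (at (snd c p)) (v c)"
    using obtain_dir_deriv_chart[OF assms(1)] by blast
  show ?thesis
    unfolding c(3) by (rule linear_add[OF has_derivative_linear[OF smooth_fun_has_derivative[OF assms(2) c(1,2)]]])
qed

lemma dir_deriv_scaleR:
  assumes "p \<in> points A" "smooth_fun A f"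
  shows "dir_deriv A p (\<lambda>d. r *\<^sub>R v d) f = r * dir_deriv A p v f"
proof -
  obtain c where c: "c \<in> A" "p \<in> fst c"
    "\<And>v f. dir_deriv A p v f = frechet_derivative (f \<circ> chart_inv c) (at (snd c p)) (v c)"
    using obtain_dir_deriv_chart[OF assms(1)] by blast
  then show ?thesis
    using linear_scale[OF has_derivative_linear[OF smooth_fun_has_derivative[OF assms(2)]]] by simp
qed

lemma dir_deriv_fun_cong:
  assumes "p \<in> points A" and "\<And>p. p \<in> points A \<Longrightarrow> f p = g p"
  shows "dir_deriv A p v f = dir_deriv A p v g"
proof -
  obtain c where c: "c \<in> A" "p \<in> fst c"
    "\<And>v f. dir_deriv A p v f = frechet_derivative (f \<circ> chart_inv c) (at (snd c p)) (v c)"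
    using obtain_dir_deriv_chart[OF assms(1)] by blast
  have "frechet_derivative (f \<circ> chart_inv c) (at (snd c p)) =
      frechet_derivative (g \<circ> chart_inv c) (at (snd c p))"
    by (rule frechet_derivative_cong_open[OF open_chart[OF c(1)]])
      (use c(1,2) in \<open>auto simp: assms(2) in_points[OF c(1)]\<close>)
  then show ?thesis by (simp add: c)
qed

lemma dir_deriv_fun_mult:
  fixes f g :: "'p \<Rightarrow> real"
  assumes "p \<in> points A" "smooth_fun A f" "smooth_fun A g"
  shows "dir_deriv A p v (\<lambda>p. f p * g p) = f p * dir_deriv A p v g + dir_deriv A p v f * g p"
proof -
  obtain c where c: "c \<in> A" "p \<in> fst c"
    "\<And>v f. dir_deriv A p v f = frechet_derivative (f \<circ> chart_inv c) (at (snd c p)) (v c)"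
    using obtain_dir_deriv_chart[OF assms(1)] by blast
  have "((\<lambda>x. (f \<circ> chart_inv c) x * (g \<circ> chart_inv c) x) has_derivative
      (\<lambda>a. (f \<circ> chart_inv c) (snd c p) * frechet_derivative (g \<circ> chart_inv c) (at (snd c p)) a
        + frechet_derivative (f \<circ> chart_inv c) (at (snd c p)) a * (g \<circ> chart_inv c) (snd c p))) (at (snd c p))"
    using smooth_fun_has_derivative[OF assms(2) c(1,2)] smooth_fun_has_derivative[OF assms(3) c(1,2)]
    by (rule has_derivative_mult)
  then show ?thesis
    using frechet_derivative_eqI by (fastforce simp: c o_def)
qed

lemma dir_deriv_fun_sum:
  fixes f :: "'i \<Rightarrow> 'p \<Rightarrow> real"
  assumes "p \<in> points A" "\<And>i. i \<in> I \<Longrightarrow> smooth_fun A (f i)"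
  shows "dir_deriv A p v (\<lambda>p. \<Sum>i\<in>I. f i p) = (\<Sum>i\<in>I. dir_deriv A p v (f i))"
proof -
  obtain c where c: "c \<in> A" "p \<in> fst c"
    "\<And>v f. dir_deriv A p v f = frechet_derivative (f \<circ> chart_inv c) (at (snd c p)) (v c)"
    using obtain_dir_deriv_chart[OF assms(1)] by blast
  have "((\<lambda>x. \<Sum>i\<in>I. (f i \<circ> chart_inv c) x) has_derivative
      (\<lambda>a. \<Sum>i\<in>I. frechet_derivative (f i \<circ> chart_inv c) (at (snd c p)) a)) (at (snd c p))"
    by (intro has_derivative_sum smooth_fun_has_derivative assms c)
  then show ?thesis
    using frechet_derivative_eqI by (fastforce simp: c o_def)
qed

lemma dir_deriv_fun_const: "p \<in> points A \<Longrightarrow> dir_deriv A p v (\<lambda>p. k) = 0"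
  by (rule dir_deriv_eqI) (auto simp: o_def)

subsection \<open>Vector fields\<close>

lemma vector_field_tangent: "vector_field A Z \<Longrightarrow> p \<in> points A \<Longrightarrow> Z p \<in> tangent_space A p"
  by (simp add: vector_field_def)

lemma vector_field_outside: "vector_field A Z \<Longrightarrow> p \<notin> points A \<Longrightarrow> Z p = (\<lambda>_. 0)"
  by (simp add: vector_field_def)

lemma vector_field_smooth:
  "vector_field A Z \<Longrightarrow> c \<in> A \<Longrightarrow> smooth_on (snd c ` fst c) (\<lambda>x. Z (chart_inv c x) c)"
  by (simp add: vector_field_def)

lemma vector_fieldI:
  assumes "\<And>p. p \<in> points A \<Longrightarrow> Z p \<in> tangent_space A p"
    and "\<And>p. p \<notin> points A \<Longrightarrow> Z p = (\<lambda>_. 0)"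
    and "\<And>c. c \<in> A \<Longrightarrow> smooth_on (snd c ` fst c) (\<lambda>x. Z (chart_inv c x) c)"
  shows "vector_field A Z"
  using assms unfolding vector_field_def by blast

lemma vector_field_sum:
  assumes "\<And>i. i \<in> I \<Longrightarrow> vector_field A (Z i)"
  shows "vector_field A (\<lambda>p c. \<Sum>i\<in>I. Z i p c)"
proof (rule vector_fieldI)
  show "(\<lambda>c. \<Sum>i\<in>I. Z i p c) \<in> tangent_space A p" if "p \<in> points A" for p
    by (intro tangent_space_sum vector_field_tangent assms that)
  show "(\<lambda>c. \<Sum>i\<in>I. Z i p c) = (\<lambda>_. 0)" if "p \<notin> points A" for p
    by (simp add: vector_field_outside[OF assms that])
  show "smooth_on (snd c ` fst c) (\<lambda>x. \<Sum>i\<in>I. Z i (chart_inv c x) c)" if "c \<in> A" for c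
    by (intro smooth_on_sum open_chart vector_field_smooth assms that)
qed

lemma vector_field_add:
  assumes "vector_field A Y" "vector_field A Z"
  shows "vector_field A (\<lambda>p c. Y p c + Z p c)"
proof (rule vector_fieldI)
  show "(\<lambda>c. Y p c + Z p c) \<in> tangent_space A p" if "p \<in> points A" for p
    by (intro tangent_space_add vector_field_tangent assms that)
  show "(\<lambda>c. Y p c + Z p c) = (\<lambda>_. 0)" if "p \<notin> points A" for p
    by (simp add: vector_field_outside[OF assms(1) that] vector_field_outside[OF assms(2) that])
  show "smooth_on (snd c ` fst c) (\<lambda>x. Y (chart_inv c x) c + Z (chart_inv c x) c)" if "c \<in> A" for c
    by (intro smooth_on_add open_chart vector_field_smooth assms that)
qed

lemma vector_field_scaleR:
  assumes "smooth_fun A f" "vector_field A Z"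
  shows "vector_field A (\<lambda>p c. f p *\<^sub>R Z p c)"
proof (rule vector_fieldI)
  show "(\<lambda>c. f p *\<^sub>R Z p c) \<in> tangent_space A p" if "p \<in> points A" for p
    by (intro tangent_space_scaleR vector_field_tangent assms that)
  show "(\<lambda>c. f p *\<^sub>R Z p c) = (\<lambda>_. 0)" if "p \<notin> points A" for p
    by (simp add: vector_field_outside[OF assms(2) that])
  fix c assume c: "c \<in> A"
  have "smooth_on (snd c ` fst c) (\<lambda>x. f (chart_inv c x))"
    using assms(1) c by (auto simp: smooth_fun_def o_def)
  then show "smooth_on (snd c ` fst c) (\<lambda>x. f (chart_inv c x) *\<^sub>R Z (chart_inv c x) c)"
    by (intro smooth_on_scaleR open_chart vector_field_smooth assms c)
qed

lemma vector_field_diff: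
  assumes "vector_field A Y" "vector_field A Z"
  shows "vector_field A (\<lambda>p c. Y p c - Z p c)"
  using vector_field_add[OF assms(1) vector_field_scaleR[OF smooth_fun_const assms(2)], of "-1"] by simp

text \<open>
By independence of the chart, the derivative is given by one smooth formula on the whole domain of
any chart.
\<close>

lemma vf_apply_smooth:
  assumes Z: "vector_field A Z" and f: "smooth_fun A f"
  shows "smooth_fun A (vf_apply A Z f)"
  unfolding smooth_fun_def
proof
  fix c assume c: "c \<in> A"
  have 1: "smooth_on (snd c ` fst c)
      (\<lambda>x. frechet_derivative (f \<circ> chart_inv c) (at x) (Z (chart_inv c x) c))"
    using f c by (intro smooth_on_frechet_derivative_apply open_chart vector_field_smooth Z)
      (auto simp: smooth_fun_def)
  have 2: "frechet_derivative (f \<circ> chart_inv c) (at x) (Z (chart_inv c x) c) = (vf_apply A Z f \<circ> chart_inv c) x"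
    if "x \<in> snd c ` fst c" for x
    using that dir_deriv_chart[OF vector_field_tangent[OF Z] f c] in_points[OF c]
    by (auto simp: vf_apply_def c)
  show "smooth_on (snd c ` fst c) (vf_apply A Z f \<circ> chart_inv c)"
    by (rule iffD1[OF smooth_on_cong[OF open_chart[OF c] 2] 1])
qed

text \<open>
The derivative of the components of a vector field does not transform as a tensor: differentiating the
transformation law produces a second derivative of the coordinate change. In a Lie bracket these terms
cancel; in a complete lift they are what the tangent bundle of the tangent bundle requires. Both times
the symmetry of the second derivative is used.
\<close>

lemma vector_field_chart_change_derivative:
  assumes Z: "vector_field A Z" and c: "c \<in> A" and d: "d \<in> A" and p: "p \<in> fst c" "p \<in> fst d"
  shows "frechet_derivative (\<lambda>x. Z (chart_inv d x) d) (at (snd d p))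
      (frechet_derivative (transition c d) (at (snd c p)) a) =
    frechet_derivative (\<lambda>x. frechet_derivative (transition c d) (at x) (Z p c)) (at (snd c p)) a
    + frechet_derivative (transition c d) (at (snd c p))
        (frechet_derivative (\<lambda>x. Z (chart_inv c x) c) (at (snd c p)) a)"
proof -
  let ?g = "\<lambda>x. Z (chart_inv c x) c"
  have Zd: "(((\<lambda>p. Z p d) \<circ> chart_inv d) has_derivative
      frechet_derivative ((\<lambda>p. Z p d) \<circ> chart_inv d) (at (snd d p))) (at (snd d p))"
    using smooth_on_has_derivative[OF vector_field_smooth[OF Z d]] p by (simp add: o_def)
  have g: "(?g has_derivative frechet_derivative ?g (at (snd c p))) (at (snd c p))"
    using smooth_on_has_derivative[OF vector_field_smooth[OF Z c]] p by simp
  have "frechet_derivative (\<lambda>x. Z (chart_inv d x) d) (at (snd d p))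
      (frechet_derivative (transition c d) (at (snd c p)) a) =
      frechet_derivative (\<lambda>x. Z (chart_inv c x) d) (at (snd c p)) a"
    using frechet_derivative_chart_change[OF c d p Zd, of a] by (simp add: o_def)
  also have "\<dots> = frechet_derivative (\<lambda>x. frechet_derivative (transition c d) (at x) (?g x)) (at (snd c p)) a"
  proof -
    have e: "Z (chart_inv c x) d = frechet_derivative (transition c d) (at x) (?g x)" if x: "x \<in> overlap c d" for x
    proof -
      obtain q where q: "q \<in> fst c" "q \<in> fst d" "x = snd c q"
        using x by blast
      then show ?thesis
        using tangent_change[OF vector_field_tangent[OF Z in_points[OF c q(1)]] c d q(1,2)] c by simp
    qed
    show ?thesis
      by (rule fun_cong[OF frechet_derivative_cong_open[OF open_overlap[OF c d] in_overlap[OF p] e]])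
  qed
  also have "\<dots> = frechet_derivative (\<lambda>x. frechet_derivative (transition c d) (at x) (?g (snd c p))) (at (snd c p)) a
    + frechet_derivative (transition c d) (at (snd c p)) (frechet_derivative ?g (at (snd c p)) a)"
    by (rule frechet_derivative_eqI[OF has_derivative_frechet_derivative_field
          [OF open_overlap[OF c d] smooth_transition[OF c d] in_overlap[OF p] g]])
  finally show ?thesis using c p by simp
qed

lemma transition_second_derivative_symmetric:
  assumes c: "c \<in> A" and d: "d \<in> A" and p: "p \<in> fst c" "p \<in> fst d"
  shows "frechet_derivative (\<lambda>x. frechet_derivative (transition c d) (at x) a) (at (snd c p)) b =
    frechet_derivative (\<lambda>x. frechet_derivative (transition c d) (at x) b) (at (snd c p)) a"
  by (rule second_derivative_symmetric[OF open_overlap[OF c d] smooth_transition[OF c d] in_overlap[OF p]])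

lemma vector_field_lie_bracket:
  assumes Y: "vector_field A Y" and Z: "vector_field A Z"
  shows "vector_field A (lie_bracket A Y Z)"
  unfolding vector_field_def
proof (intro conjI allI ballI impI)
  fix p assume p: "p \<in> points A"
  show "lie_bracket A Y Z p \<in> tangent_space A p"
    unfolding tangent_space_def
  proof (intro CollectI conjI allI ballI impI)
    fix c d assume c: "c \<in> A" and d: "d \<in> A" and "p \<in> fst c \<inter> fst d"
    then have p: "p \<in> fst c" "p \<in> fst d" by auto
    have Yd: "Y p d = frechet_derivative (transition c d) (at (snd c p)) (Y p c)"
      by (rule tangent_change[OF vector_field_tangent[OF Y in_points[OF c p(1)]] c d p])
    have Zd: "Z p d = frechet_derivative (transition c d) (at (snd c p)) (Z p c)"
      by (rule tangent_change[OF vector_field_tangent[OF Z in_points[OF c p(1)]] c d p])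
    show "lie_bracket A Y Z p d =
        frechet_derivative (transition c d) (at (snd c p)) (lie_bracket A Y Z p c)"
      using c d p transition_second_derivative_symmetric[OF c d p, of "Y p c" "Z p c"]
        vector_field_chart_change_derivative[OF Y c d p, of "Z p c"]
        vector_field_chart_change_derivative[OF Z c d p, of "Y p c"]
        linear_diff[OF linear_transition_derivative[OF c d p]]
      by (simp add: lie_bracket_def Yd Zd del: o_apply)
  qed (auto simp: lie_bracket_def)
next
  fix p assume "p \<notin> points A"
  then have "\<not> (c \<in> A \<and> p \<in> fst c)" for c
    using in_points by blast
  then show "lie_bracket A Y Z p = (\<lambda>_. 0)"
    by (simp only: lie_bracket_def if_False)
next
  fix c assume c: "c \<in> A"
  have 1: "smooth_on (snd c ` fst c) (\<lambda>x.
      frechet_derivative (\<lambda>x. Z (chart_inv c x) c) (at x) (Y (chart_inv c x) c)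
      - frechet_derivative (\<lambda>x. Y (chart_inv c x) c) (at x) (Z (chart_inv c x) c))"
    by (intro smooth_on_diff smooth_on_frechet_derivative_apply open_chart vector_field_smooth Y Z c)
  show "smooth_on (snd c ` fst c) (\<lambda>x. lie_bracket A Y Z (chart_inv c x) c)"
    by (rule iffD1[OF smooth_on_cong[OF open_chart[OF c]] 1]) (auto simp: lie_bracket_def c)
qed

subsection \<open>The tangent bundle\<close>

lemma tangent_chart_simps:
  "p \<in> fst (tangent_chart A c) \<longleftrightarrow> fst p \<in> fst c \<and> snd p \<in> tangent_space A (fst p)"
  "snd (tangent_chart A c) p = (snd c (fst p), snd p c)"
  by (auto simp: tangent_chart_def split: prod.splits)

lemma tangent_chart_inj: "tangent_chart A c = tangent_chart A d \<Longrightarrow> c = d"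
proof (rule ccontr)
  assume "tangent_chart A c = tangent_chart A d" and "c \<noteq> d"
  then have "v c = v d" for v :: "('p, 'e) tvec"
    using tangent_chart_simps(2)[of c "(undefined, v)"] tangent_chart_simps(2)[of d "(undefined, v)"] by simp
  from this[of "\<lambda>e. if e = c then (SOME b. b \<in> Basis) else 0"]
  show False
    using \<open>c \<noteq> d\<close> nonzero_Basis[OF SOME_Basis, where 'a='e] by simp
qed

lemma inv_tangent_chart [simp]: "c \<in> A \<Longrightarrow> inv_into A (tangent_chart A) (tangent_chart A c) = c"
  by (intro inv_into_f_f inj_onI tangent_chart_inj)

lemma in_tangent_bundle [simp]: "tangent_chart A c \<in> tangent_bundle A \<longleftrightarrow> c \<in> A"
  unfolding tangent_bundle_def using tangent_chart_inj by blast

lemma points_tangent_bundle: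
  "p \<in> points (tangent_bundle A) \<longleftrightarrow> fst p \<in> points A \<and> snd p \<in> tangent_space A (fst p)"
  by (auto simp: points_def tangent_bundle_def tangent_chart_simps)

lemma tangent_chart_overlap:
  assumes "c \<in> A" "d \<in> A"
  shows "snd (tangent_chart A c) ` (fst (tangent_chart A c) \<inter> fst (tangent_chart A d)) = overlap c d \<times> UNIV"
proof
  show "overlap c d \<times> UNIV \<subseteq> snd (tangent_chart A c) ` (fst (tangent_chart A c) \<inter> fst (tangent_chart A d))"
  proof
    fix z assume "z \<in> overlap c d \<times> (UNIV :: 'e set)"
    then obtain q y where q: "q \<in> fst c" "q \<in> fst d" "z = (snd c q, y)" by auto
    then have "z = snd (tangent_chart A c) (q, tangent_vector q c y)"
      using assms by (simp add: tangent_chart_simps)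
    moreover have "(q, tangent_vector q c y) \<in> fst (tangent_chart A c) \<inter> fst (tangent_chart A d)"
      using q assms tangent_vector_in by (simp add: tangent_chart_simps)
    ultimately show "z \<in> snd (tangent_chart A c) ` (fst (tangent_chart A c) \<inter> fst (tangent_chart A d))"
      by blast
  qed
qed (auto simp: tangent_chart_simps)

lemma tangent_chart_image:
  "c \<in> A \<Longrightarrow> snd (tangent_chart A c) ` fst (tangent_chart A c) = (snd c ` fst c) \<times> UNIV"
  using tangent_chart_overlap[of c c] by simp

lemma inj_tangent_chart: "c \<in> A \<Longrightarrow> inj_on (snd (tangent_chart A c)) (fst (tangent_chart A c))"
proof (rule inj_onI)
  fix p r assume c: "c \<in> A" and p: "p \<in> fst (tangent_chart A c)" and r: "r \<in> fst (tangent_chart A c)"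
    and e: "snd (tangent_chart A c) p = snd (tangent_chart A c) r"
  have "fst p = fst r"
    using e p r inj_onD[OF inj_chart[OF c]] by (auto simp: tangent_chart_simps)
  moreover have "snd p = snd r"
    using e p r \<open>fst p = fst r\<close> c
    by (intro tangent_vector_eqI[of _ "fst p" _ c]) (auto simp: tangent_chart_simps)
  ultimately show "p = r" by (simp add: prod_eq_iff)
qed

lemma chart_inv_tangent_chart:
  assumes c: "c \<in> A" and x: "x \<in> snd c ` fst c"
  shows "chart_inv (tangent_chart A c) (x, y) = (chart_inv c x, tangent_vector (chart_inv c x) c y)"
proof -
  let ?p = "(chart_inv c x, tangent_vector (chart_inv c x) c y)"
  have "?p \<in> fst (tangent_chart A c)"
    using c x tangent_vector_in chart_inv_in by (simp add: tangent_chart_simps)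
  moreover have "snd (tangent_chart A c) ?p = (x, y)"
    using c x chart_inv_in chart_chart_inv by (simp add: tangent_chart_simps)
  ultimately show ?thesis
    using inj_tangent_chart[OF c] inv_into_f_f unfolding chart_inv_def by metis
qed

lemma tangent_transition:
  assumes "c \<in> A" "d \<in> A" and z: "z \<in> overlap c d \<times> UNIV"
  shows "(snd (tangent_chart A d) \<circ> chart_inv (tangent_chart A c)) z =
    (transition c d (fst z), frechet_derivative (transition c d) (at (fst z)) (snd z))"
proof -
  obtain q y where q: "q \<in> fst c" "q \<in> fst d" and z: "z = (snd c q, y)"
    using z by auto
  have "chart_inv (tangent_chart A c) z = (q, tangent_vector q c y)"
    using chart_inv_tangent_chart[of c "snd c q" y] assms(1) q(1) by (simp add: z)
  then show ?thesis
    using assms q by (simp add: z tangent_chart_simps tangent_vector_def)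
qed

lemma smooth_atlas_tangent_bundle: "smooth_atlas (tangent_bundle A)"
proof
  fix t assume "t \<in> tangent_bundle A"
  then obtain c where c: "c \<in> A" "t = tangent_chart A c" by (auto simp: tangent_bundle_def)
  show "inj_on (snd t) (fst t)" "open (snd t ` fst t)"
    using c inj_tangent_chart tangent_chart_image open_chart by (auto simp: open_Times)
  fix s assume "s \<in> tangent_bundle A"
  then obtain d where d: "d \<in> A" "s = tangent_chart A d" by (auto simp: tangent_bundle_def)
  let ?U = "overlap c d \<times> (UNIV :: 'e set)"
  have o: "open (overlap c d)" "open ?U"
    using open_overlap[OF c(1) d(1)] by (simp_all add: open_Times)
  show "open (snd t ` (fst t \<inter> fst s))"
    using tangent_chart_overlap[OF c(1) d(1)] o c d by simp
  have 1: "smooth_on ?U (\<lambda>z. transition c d (fst z))"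
    by (rule smooth_on_compose[OF o(2,1) smooth_transition[OF c(1) d(1)] smooth_on_fst[OF o(2) smooth_on_id]])
      auto
  have 2: "smooth_on ?U (\<lambda>z. (transition c d (fst z), frechet_derivative (transition c d) (at (fst z)) (snd z)))"
    by (rule smooth_on_Pair[OF o(2) 1 smooth_on_frechet_derivative_pair[OF o(1) smooth_transition[OF c(1) d(1)]]])
  show "smooth_on (snd t ` (fst t \<inter> fst s)) (snd s \<circ> chart_inv t)"
    unfolding c(2) d(2) tangent_chart_overlap[OF c(1) d(1)]
    by (rule iffD2[OF smooth_on_cong[OF o(2) tangent_transition[OF c(1) d(1)]] 2])
qed

lemma tangent_transition_derivative:
  assumes c: "c \<in> A" and d: "d \<in> A" and q: "q \<in> fst c" "q \<in> fst d"
  shows "frechet_derivative (snd (tangent_chart A d) \<circ> chart_inv (tangent_chart A c)) (at (snd c q, y)) w =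
    (frechet_derivative (transition c d) (at (snd c q)) (fst w),
     frechet_derivative (\<lambda>x. frechet_derivative (transition c d) (at x) y) (at (snd c q)) (fst w)
       + frechet_derivative (transition c d) (at (snd c q)) (snd w))"
proof -
  have o: "open (overlap c d \<times> (UNIV :: 'e set))"
    using open_overlap[OF c d] by (simp add: open_Times)
  have z: "(snd c q, y) \<in> overlap c d \<times> (UNIV :: 'e set)"
    using q by auto
  have 1: "((\<lambda>z::'e \<times> 'e. transition c d (fst z)) has_derivative
      (\<lambda>w. frechet_derivative (transition c d) (at (snd c q)) (fst w))) (at (snd c q, y))"
    by (rule has_derivative_comp_fst[where z = "(snd c q, y)" and f = "transition c d",
          unfolded fst_conv, OF transition_has_derivative[OF c d q]])
  have "((\<lambda>z. (transition c d (fst z), frechet_derivative (transition c d) (at (fst z)) (snd z)))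
      has_derivative (\<lambda>w. (frechet_derivative (transition c d) (at (snd c q)) (fst w),
     frechet_derivative (\<lambda>x. frechet_derivative (transition c d) (at x) y) (at (snd c q)) (fst w)
       + frechet_derivative (transition c d) (at (snd c q)) (snd w)))) (at (snd c q, y))"
    using has_derivative_Pair[OF 1 has_derivative_frechet_derivative_apply
          [OF open_overlap[OF c d] smooth_transition[OF c d], of "(snd c q, y)"]] in_overlap[OF q] by simp
  then have "((snd (tangent_chart A d) \<circ> chart_inv (tangent_chart A c))
      has_derivative (\<lambda>w. (frechet_derivative (transition c d) (at (snd c q)) (fst w),
     frechet_derivative (\<lambda>x. frechet_derivative (transition c d) (at x) y) (at (snd c q)) (fst w)
       + frechet_derivative (transition c d) (at (snd c q)) (snd w)))) (at (snd c q, y))"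
    by (rule has_derivative_transform_within_open[OF _ o z tangent_transition[OF c d, symmetric]])
  then show ?thesis
    by (rule frechet_derivative_eqI)
qed

text \<open>
The transformation law of tangent vectors to the tangent bundle, written out with the first and second
derivatives of a coordinate change on the base.
\<close>

lemma tangent_bundle_vectorI:
  assumes "\<And>t. \<not> (t \<in> tangent_bundle A \<and> p \<in> fst t) \<Longrightarrow> w t = 0"
    and "\<And>c d. c \<in> A \<Longrightarrow> d \<in> A \<Longrightarrow> fst p \<in> fst c \<Longrightarrow> fst p \<in> fst d \<Longrightarrow> snd p \<in> tangent_space A (fst p) \<Longrightarrow>
      w (tangent_chart A d) =
        (frechet_derivative (transition c d) (at (snd c (fst p))) (fst (w (tangent_chart A c))),
         frechet_derivative (\<lambda>x. frechet_derivative (transition c d) (at x) (snd p c)) (at (snd c (fst p)))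
             (fst (w (tangent_chart A c)))
           + frechet_derivative (transition c d) (at (snd c (fst p))) (snd (w (tangent_chart A c))))"
  shows "w \<in> tangent_space (tangent_bundle A) p"
  unfolding tangent_space_def
proof (intro CollectI conjI allI ballI impI)
  fix t s assume t: "t \<in> tangent_bundle A" and s: "s \<in> tangent_bundle A" and p: "p \<in> fst t \<inter> fst s"
  obtain c d where c: "c \<in> A" "t = tangent_chart A c" and d: "d \<in> A" "s = tangent_chart A d"
    using t s by (auto simp: tangent_bundle_def)
  show "w s = frechet_derivative (snd s \<circ> chart_inv t) (at (snd t p)) (w t)"
    using c d p assms(2)[OF c(1) d(1)] tangent_transition_derivative[OF c(1) d(1)]
    by (auto simp: tangent_chart_simps simp del: o_apply)
qed (use assms(1) in auto)

lemma complete_lift_chart: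
  assumes "c \<in> A" "p \<in> fst (tangent_chart A c)"
  shows "complete_lift A Y p (tangent_chart A c) =
    (Y (fst p) c, frechet_derivative (\<lambda>x. Y (chart_inv c x) c) (at (snd c (fst p))) (snd p c))"
  using assms by (simp add: complete_lift_def Let_def)

lemma vertical_lift_chart:
  assumes "c \<in> A" "p \<in> fst (tangent_chart A c)"
  shows "vertical_lift A Z p (tangent_chart A c) = (0, Z p c)"
  using assms by (simp add: vertical_lift_def)

lemma vector_field_complete_lift:
  assumes Y: "vector_field A Y"
  shows "vector_field (tangent_bundle A) (complete_lift A Y)"
  unfolding vector_field_def
proof (intro conjI allI ballI impI)
  fix p assume "p \<in> points (tangent_bundle A)"
  show "complete_lift A Y p \<in> tangent_space (tangent_bundle A) p"
  proof (rule tangent_bundle_vectorI)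
    fix c d assume c: "c \<in> A" and d: "d \<in> A" and q: "fst p \<in> fst c" "fst p \<in> fst d"
      and v: "snd p \<in> tangent_space A (fst p)"
    have Yd: "Y (fst p) d = frechet_derivative (transition c d) (at (snd c (fst p))) (Y (fst p) c)"
      by (rule tangent_change[OF vector_field_tangent[OF Y in_points[OF c q(1)]] c d q])
    have vd: "snd p d = frechet_derivative (transition c d) (at (snd c (fst p))) (snd p c)"
      by (rule tangent_change[OF v c d q])
    have t: "p \<in> fst (tangent_chart A c)" "p \<in> fst (tangent_chart A d)"
      using q v by (simp_all add: tangent_chart_simps)
    show "complete_lift A Y p (tangent_chart A d) =
        (frechet_derivative (transition c d) (at (snd c (fst p))) (fst (complete_lift A Y p (tangent_chart A c))),
         frechet_derivative (\<lambda>x. frechet_derivative (transition c d) (at x) (snd p c)) (at (snd c (fst p)))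
             (fst (complete_lift A Y p (tangent_chart A c)))
           + frechet_derivative (transition c d) (at (snd c (fst p))) (snd (complete_lift A Y p (tangent_chart A c))))"
      unfolding complete_lift_chart[OF c t(1)] complete_lift_chart[OF d t(2)] fst_conv snd_conv
        Yd vd vector_field_chart_change_derivative[OF Y c d q]
        transition_second_derivative_symmetric[OF c d q, of "snd p c" "Y (fst p) c"] ..
  qed (auto simp: complete_lift_def)
next
  fix p assume "p \<notin> points (tangent_bundle A)"
  then show "complete_lift A Y p = (\<lambda>_. 0)"
    by (intro ext) (auto simp: complete_lift_def points_def)
next
  fix t assume "t \<in> tangent_bundle A"
  then obtain c where c: "c \<in> A" and t: "t = tangent_chart A c" by (auto simp: tangent_bundle_def)
  let ?U = "snd c ` fst c \<times> (UNIV :: 'e set)"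
  have o: "open (snd c ` fst c)" "open ?U"
    using open_chart[OF c] by (simp_all add: open_Times)
  have 1: "smooth_on ?U (\<lambda>z. Y (chart_inv c (fst z)) c)"
    by (rule smooth_on_compose[OF o(2,1) vector_field_smooth[OF Y c] smooth_on_fst[OF o(2) smooth_on_id]]) auto
  have 2: "smooth_on ?U (\<lambda>z. (Y (chart_inv c (fst z)) c,
      frechet_derivative (\<lambda>x. Y (chart_inv c x) c) (at (fst z)) (snd z)))"
    by (rule smooth_on_Pair[OF o(2) 1 smooth_on_frechet_derivative_pair[OF o(1) vector_field_smooth[OF Y c]]])
  have 3: "complete_lift A Y (chart_inv t z) t = (Y (chart_inv c (fst z)) c,
      frechet_derivative (\<lambda>x. Y (chart_inv c x) c) (at (fst z)) (snd z))" if "z \<in> ?U" for z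
  proof -
    have x: "fst z \<in> snd c ` fst c" using that by auto
    show ?thesis
      using chart_inv_tangent_chart[OF c x, of "snd z"] c x chart_inv_in[OF c x] chart_chart_inv[OF c x]
      by (simp add: t complete_lift_chart tangent_chart_simps tangent_vector_in)
  qed
  show "smooth_on (snd t ` fst t) (\<lambda>x. complete_lift A Y (chart_inv t x) t)"
    unfolding t tangent_chart_image[OF c] unfolding t[symmetric]
    by (rule iffD2[OF smooth_on_cong[OF o(2) 3] 2])
qed

lemma along_tau_tangent:
  "Z \<in> along_tau A \<Longrightarrow> p \<in> points (tangent_bundle A) \<Longrightarrow> Z p \<in> tangent_space A (fst p)"
  unfolding along_tau_def by blast

lemma along_tau_outside: "Z \<in> along_tau A \<Longrightarrow> p \<notin> points (tangent_bundle A) \<Longrightarrow> Z p = (\<lambda>_. 0)"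
  unfolding along_tau_def by blast

lemma along_tau_smooth:
  "Z \<in> along_tau A \<Longrightarrow> c \<in> A \<Longrightarrow>
    smooth_on (snd c ` fst c \<times> UNIV) (\<lambda>x. Z (chart_inv (tangent_chart A c) x) c)"
  by (simp add: along_tau_def Let_def tangent_chart_image[symmetric])

lemma along_tauI:
  assumes "\<And>p. p \<in> points (tangent_bundle A) \<Longrightarrow> Z p \<in> tangent_space A (fst p)"
    and "\<And>p. p \<notin> points (tangent_bundle A) \<Longrightarrow> Z p = (\<lambda>_. 0)"
    and "\<And>c. c \<in> A \<Longrightarrow> smooth_on (snd c ` fst c \<times> UNIV) (\<lambda>x. Z (chart_inv (tangent_chart A c) x) c)"
  shows "Z \<in> along_tau A"
  using assms by (simp add: along_tau_def Let_def tangent_chart_image)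

lemma vector_field_vertical_lift:
  assumes Z: "Z \<in> along_tau A"
  shows "vector_field (tangent_bundle A) (vertical_lift A Z)"
  unfolding vector_field_def
proof (intro conjI allI ballI impI)
  fix p assume p: "p \<in> points (tangent_bundle A)"
  show "vertical_lift A Z p \<in> tangent_space (tangent_bundle A) p"
  proof (rule tangent_bundle_vectorI)
    fix c d assume c: "c \<in> A" and d: "d \<in> A" and q: "fst p \<in> fst c" "fst p \<in> fst d"
      and v: "snd p \<in> tangent_space A (fst p)"
    have Zd: "Z p d = frechet_derivative (transition c d) (at (snd c (fst p))) (Z p c)"
      by (rule tangent_change[OF along_tau_tangent[OF Z p] c d q])
    have "smooth_on (overlap c d) (\<lambda>x. frechet_derivative (transition c d) (at x) (snd p c))"
      by (rule smooth_on_frechet_derivative[OF smooth_transition[OF c d]])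
    from linear_0[OF has_derivative_linear[OF smooth_on_has_derivative[OF this in_overlap[OF q]]]]
    have 0: "frechet_derivative (\<lambda>x. frechet_derivative (transition c d) (at x) (snd p c)) (at (snd c (fst p))) 0 = 0" .
    have t: "p \<in> fst (tangent_chart A c)" "p \<in> fst (tangent_chart A d)"
      using q v by (simp_all add: tangent_chart_simps)
    show "vertical_lift A Z p (tangent_chart A d) =
        (frechet_derivative (transition c d) (at (snd c (fst p))) (fst (vertical_lift A Z p (tangent_chart A c))),
         frechet_derivative (\<lambda>x. frechet_derivative (transition c d) (at x) (snd p c)) (at (snd c (fst p)))
             (fst (vertical_lift A Z p (tangent_chart A c)))
           + frechet_derivative (transition c d) (at (snd c (fst p))) (snd (vertical_lift A Z p (tangent_chart A c))))"
      unfolding vertical_lift_chart[OF c t(1)] vertical_lift_chart[OF d t(2)] fst_conv snd_conv Zd 0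
        linear_0[OF linear_transition_derivative[OF c d q]] by simp
  qed (auto simp: vertical_lift_def)
next
  fix p assume "p \<notin> points (tangent_bundle A)"
  then show "vertical_lift A Z p = (\<lambda>_. 0)"
    by (intro ext) (auto simp: vertical_lift_def points_def)
next
  fix t assume "t \<in> tangent_bundle A"
  then obtain c where c: "c \<in> A" and t: "t = tangent_chart A c" by (auto simp: tangent_bundle_def)
  let ?U = "snd c ` fst c \<times> (UNIV :: 'e set)"
  have o: "open ?U"
    using open_chart[OF c] by (simp_all add: open_Times)
  have 2: "smooth_on ?U (\<lambda>z. (0::'e, Z (chart_inv t z) c))"
    unfolding t by (rule smooth_on_Pair[OF o smooth_on_const along_tau_smooth[OF Z c]])
  have 3: "vertical_lift A Z (chart_inv t z) t = (0, Z (chart_inv t z) c)" if "z \<in> ?U" for z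
  proof -
    have x: "fst z \<in> snd c ` fst c" using that by auto
    then have "chart_inv t z \<in> fst t"
      using chart_inv_tangent_chart[OF c x, of "snd z"] c chart_inv_in[OF c x]
      by (simp add: t tangent_chart_simps tangent_vector_in)
    then show ?thesis using c by (simp add: t vertical_lift_chart)
  qed
  show "smooth_on (snd t ` fst t) (\<lambda>x. vertical_lift A Z (chart_inv t x) t)"
    unfolding t tangent_chart_image[OF c] unfolding t[symmetric]
    by (rule iffD2[OF smooth_on_cong[OF o 3] 2])
qed

lemma basic_along_tau:
  assumes Y: "vector_field A Y"
  shows "basic A Y \<in> along_tau A"
proof (rule along_tauI)
  fix c assume c: "c \<in> A"
  let ?U = "snd c ` fst c \<times> (UNIV :: 'e set)"
  have o: "open (snd c ` fst c)" "open ?U"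
    using open_chart[OF c] by (simp_all add: open_Times)
  have 1: "smooth_on ?U (\<lambda>z. Y (chart_inv c (fst z)) c)"
    by (rule smooth_on_compose[OF o(2,1) vector_field_smooth[OF Y c] smooth_on_fst[OF o(2) smooth_on_id]]) auto
  have 2: "basic A Y (chart_inv (tangent_chart A c) z) c = Y (chart_inv c (fst z)) c" if "z \<in> ?U" for z
  proof -
    have x: "fst z \<in> snd c ` fst c" using that by auto
    then show ?thesis
      using chart_inv_tangent_chart[OF c x, of "snd z"] c chart_inv_in[OF c x] in_points
      by (simp add: basic_def points_tangent_bundle tangent_vector_in)
  qed
  show "smooth_on ?U (\<lambda>x. basic A Y (chart_inv (tangent_chart A c) x) c)"
    by (rule iffD2[OF smooth_on_cong[OF o(2) 2] 1])
qed (auto simp: basic_def points_tangent_bundle vector_field_tangent[OF Y])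

lemma along_tau_sum:
  assumes "\<And>i. i \<in> I \<Longrightarrow> Y i \<in> along_tau A"
  shows "(\<lambda>p c. \<Sum>i\<in>I. Y i p c) \<in> along_tau A"
proof (rule along_tauI)
  show "(\<lambda>c. \<Sum>i\<in>I. Y i p c) \<in> tangent_space A (fst p)" if "p \<in> points (tangent_bundle A)" for p
    by (intro tangent_space_sum along_tau_tangent assms that)
  show "(\<lambda>c. \<Sum>i\<in>I. Y i p c) = (\<lambda>_. 0)" if "p \<notin> points (tangent_bundle A)" for p
    by (simp add: along_tau_outside[OF assms that])
  show "smooth_on (snd c ` fst c \<times> UNIV) (\<lambda>x. \<Sum>i\<in>I. Y i (chart_inv (tangent_chart A c) x) c)"
    if "c \<in> A" for c
    by (intro smooth_on_sum open_Times open_chart open_UNIV along_tau_smooth assms that)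
qed

lemma along_tau_add:
  assumes "Y \<in> along_tau A" "Z \<in> along_tau A"
  shows "(\<lambda>p c. Y p c + Z p c) \<in> along_tau A"
  using along_tau_sum[of "{True, False}" "\<lambda>i. if i then Y else Z"] assms by simp

lemma along_tau_scaleR:
  assumes "smooth_fun (tangent_bundle A) f" "Y \<in> along_tau A"
  shows "(\<lambda>p c. f p *\<^sub>R Y p c) \<in> along_tau A"
proof (rule along_tauI)
  show "(\<lambda>c. f p *\<^sub>R Y p c) \<in> tangent_space A (fst p)" if "p \<in> points (tangent_bundle A)" for p
    by (intro tangent_space_scaleR along_tau_tangent assms that)
  show "(\<lambda>c. f p *\<^sub>R Y p c) = (\<lambda>_. 0)" if "p \<notin> points (tangent_bundle A)" for p
    by (simp add: along_tau_outside[OF assms(2) that])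
  fix c assume c: "c \<in> A"
  have "smooth_on (snd c ` fst c \<times> UNIV) (\<lambda>x. f (chart_inv (tangent_chart A c) x))"
    using assms(1) c by (auto simp: smooth_fun_def tangent_bundle_def tangent_chart_image o_def)
  then show "smooth_on (snd c ` fst c \<times> UNIV)
      (\<lambda>x. f (chart_inv (tangent_chart A c) x) *\<^sub>R Y (chart_inv (tangent_chart A c) x) c)"
    by (intro smooth_on_scaleR open_Times open_chart open_UNIV along_tau_smooth assms c)
qed

lemma along_tau_diff:
  assumes "Y \<in> along_tau A" "Z \<in> along_tau A"
  shows "(\<lambda>p c. Y p c - Z p c) \<in> along_tau A"
  using along_tau_add[OF assms(1) along_tau_scaleR
      [OF smooth_atlas.smooth_fun_const[OF smooth_atlas_tangent_bundle, of "- 1"] assms(2)]] by simp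

lemma chart_inv_tangent_chart_base:
  assumes "c \<in> A" "z \<in> snd c ` fst c \<times> UNIV"
  shows "fst (chart_inv (tangent_chart A c) z) = chart_inv c (fst z)"
  using chart_inv_tangent_chart[of c "fst z" "snd z"] assms by auto

lemma smooth_fun_base:
  assumes h: "smooth_fun A h"
  shows "smooth_fun (tangent_bundle A) (\<lambda>p. h (fst p))"
  unfolding smooth_fun_def
proof
  fix t assume "t \<in> tangent_bundle A"
  then obtain c where c: "c \<in> A" and t: "t = tangent_chart A c" by (auto simp: tangent_bundle_def)
  let ?U = "snd c ` fst c \<times> (UNIV :: 'e set)"
  have o: "open (snd c ` fst c)" "open ?U"
    using open_chart[OF c] by (simp_all add: open_Times)
  have hc: "smooth_on (snd c ` fst c) (h \<circ> chart_inv c)"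
    using h c by (auto simp: smooth_fun_def)
  have 1: "smooth_on ?U (\<lambda>z. (h \<circ> chart_inv c) (fst z))"
    by (rule smooth_on_compose[OF o(2,1) hc smooth_on_fst[OF o(2) smooth_on_id]]) auto
  show "smooth_on (snd t ` fst t) ((\<lambda>p. h (fst p)) \<circ> chart_inv t)"
    unfolding t tangent_chart_image[OF c]
    by (rule iffD2[OF smooth_on_cong[OF o(2)] 1]) (simp add: chart_inv_tangent_chart_base[OF c])
qed

text \<open>
A function pulled back from the base only sees the horizontal part of a vector on the tangent bundle.
For a second-order field this part is the velocity itself.
\<close>

lemma dir_deriv_base:
  assumes p: "p \<in> points (tangent_bundle A)" and h: "smooth_fun A h" and v: "v \<in> tangent_space A (fst p)"
    and w: "\<And>c. c \<in> A \<Longrightarrow> p \<in> fst (tangent_chart A c) \<Longrightarrow> fst (w (tangent_chart A c)) = v c"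
  shows "dir_deriv (tangent_bundle A) p w (\<lambda>p. h (fst p)) = dir_deriv A (fst p) v h"
proof (rule smooth_atlas.dir_deriv_eqI[OF smooth_atlas_tangent_bundle p])
  fix t assume "t \<in> tangent_bundle A" and pt: "p \<in> fst t"
  then obtain c where c: "c \<in> A" and t: "t = tangent_chart A c" by (auto simp: tangent_bundle_def)
  have q: "fst p \<in> fst c" using pt by (simp add: t tangent_chart_simps)
  let ?U = "snd c ` fst c \<times> (UNIV :: 'e set)"
  have o: "open ?U"
    using open_chart[OF c] by (simp_all add: open_Times)
  have "((\<lambda>z. (h \<circ> chart_inv c) (fst z)) has_derivative
      (\<lambda>a. frechet_derivative (h \<circ> chart_inv c) (at (snd c (fst p))) (fst a))) (at (snd t p))"
    using smooth_fun_has_derivative[OF h c q]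
    by (intro has_derivative_comp_fst[where f = "h \<circ> chart_inv c"])
      (simp add: t tangent_chart_simps del: o_apply)
  then have "(((\<lambda>p. h (fst p)) \<circ> chart_inv t) has_derivative
      (\<lambda>a. frechet_derivative (h \<circ> chart_inv c) (at (snd c (fst p))) (fst a))) (at (snd t p))"
    by (rule has_derivative_transform_within_open[of _ _ _ _ ?U])
      (use q o in \<open>auto simp: t tangent_chart_simps chart_inv_tangent_chart_base[OF c]\<close>)
  from frechet_derivative_eqI[OF this]
  show "frechet_derivative ((\<lambda>p. h (fst p)) \<circ> chart_inv t) (at (snd t p)) (w t) = dir_deriv A (fst p) v h"
    using w[OF c] pt dir_deriv_chart[OF v h c q] by (simp add: t)
qed

end

section \<open>Frames\<close>

locale framed_atlas = smooth_atlas A for A :: "('q, 'e::euclidean_space) chart set" +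
  fixes X :: "nat \<Rightarrow> 'q \<Rightarrow> ('q, 'e) tvec"
  assumes frame: "frame A X"

sublocale framed_atlas \<subseteq> TB: smooth_atlas "tangent_bundle A"
  by (rule smooth_atlas_tangent_bundle)

context framed_atlas
begin

abbreviation TQ :: "('q, 'e) tpoint set" where
  "TQ \<equiv> points (tangent_bundle A)"

abbreviation coef :: "nat \<Rightarrow> 'q \<Rightarrow> ('q, 'e) tvec \<Rightarrow> real" where
  "coef \<alpha> q v \<equiv> quasi_velocity X \<alpha> (q, v)"

lemma base_point: "p \<in> TQ \<Longrightarrow> fst p \<in> points A"
  by (simp add: points_tangent_bundle)

lemma fibre_vector: "p \<in> TQ \<Longrightarrow> snd p \<in> tangent_space A (fst p)"
  by (simp add: points_tangent_bundle)

lemma frame_vector_field: "\<alpha> < DIM('e) \<Longrightarrow> vector_field A (X \<alpha>)"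
  using frame by (simp add: frame_def)

lemma frame_tangent: "\<alpha> < DIM('e) \<Longrightarrow> q \<in> points A \<Longrightarrow> X \<alpha> q \<in> tangent_space A q"
  by (rule vector_field_tangent[OF frame_vector_field])

lemma lin_comb_tangent: "q \<in> points A \<Longrightarrow> lin_comb {..<DIM('e)} w (\<lambda>\<alpha>. X \<alpha> q) \<in> tangent_space A q"
  by (intro tangent_space_lin_comb frame_tangent) auto

lemma frame_expansion:
  assumes "q \<in> points A" "v \<in> tangent_space A q"
  shows "v = lin_comb {..<DIM('e)} (\<lambda>\<alpha>. coef \<alpha> q v) (\<lambda>\<alpha>. X \<alpha> q)"
proof -
  let ?P = "\<lambda>w. (\<forall>\<alpha>\<ge>DIM('e). w \<alpha> = 0) \<and> v = lin_comb {..<DIM('e)} w (\<lambda>\<alpha>. X \<alpha> q)"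
  have "\<exists>!w. ?P w"
    using frame assms by (simp add: frame_def)
  then have "?P (THE w. ?P w)"
    by (rule theI')
  then show ?thesis
    by (simp add: quasi_velocity_def)
qed

text \<open>
The coefficients in \<^const>\<open>quasi_velocity\<close> are normalised to vanish for indices beyond the dimension,
hence the cut-off family in the proof.
\<close>

lemma coef_lin_comb:
  assumes q: "q \<in> points A" and \<alpha>: "\<alpha> < DIM('e)"
  shows "coef \<alpha> q (lin_comb {..<DIM('e)} w (\<lambda>\<alpha>. X \<alpha> q)) = w \<alpha>"
proof -
  let ?v = "lin_comb {..<DIM('e)} w (\<lambda>\<alpha>. X \<alpha> q)"
  let ?P = "\<lambda>w. (\<forall>\<alpha>\<ge>DIM('e). w \<alpha> = 0) \<and> ?v = lin_comb {..<DIM('e)} w (\<lambda>\<alpha>. X \<alpha> q)"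
  let ?w = "\<lambda>\<alpha>. if \<alpha> < DIM('e) then w \<alpha> else 0"
  have "\<exists>!w. ?P w"
    using frame q lin_comb_tangent[OF q] by (simp add: frame_def)
  moreover have "?P ?w"
    by (simp add: lin_comb_def)
  ultimately have "(THE w. ?P w) = ?w"
    by (rule the1_equality[where P = ?P and a = ?w])
  then show ?thesis
    using \<alpha> by (simp add: quasi_velocity_def)
qed

lemma coef_eqI:
  assumes "q \<in> points A" "v = lin_comb {..<DIM('e)} w (\<lambda>\<alpha>. X \<alpha> q)" "\<alpha> < DIM('e)"
  shows "coef \<alpha> q v = w \<alpha>"
  using coef_lin_comb assms by simp

lemma coef_zero: "q \<in> points A \<Longrightarrow> \<alpha> < DIM('e) \<Longrightarrow> coef \<alpha> q (\<lambda>_. 0) = 0"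
  by (rule coef_eqI) (auto simp: lin_comb_def)

text \<open>
Vanishing in a single chart suffices, since a tangent vector is determined by its coordinates there.
\<close>

lemma frame_independent:
  assumes c: "c \<in> A" and q: "q \<in> fst c" and 0: "(\<Sum>\<alpha><DIM('e). w \<alpha> *\<^sub>R X \<alpha> q c) = 0" and \<alpha>: "\<alpha> < DIM('e)"
  shows "w \<alpha> = 0"
proof -
  note qA = in_points[OF c q]
  have "lin_comb {..<DIM('e)} w (\<lambda>\<alpha>. X \<alpha> q) = (\<lambda>_. 0)"
    by (rule tangent_vector_eqI[OF lin_comb_tangent[OF qA] tangent_space_zero c q])
      (simp add: lin_comb_def 0)
  then show ?thesis
    using coef_lin_comb[OF qA \<alpha>, of w] coef_zero[OF qA \<alpha>] by simp
qed

lemma coef_add: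
  assumes q: "q \<in> points A" and v: "v \<in> tangent_space A q" and w: "w \<in> tangent_space A q" and \<alpha>: "\<alpha> < DIM('e)"
  shows "coef \<alpha> q (\<lambda>c. v c + w c) = coef \<alpha> q v + coef \<alpha> q w"
proof (rule coef_eqI[OF q _ \<alpha>])
  show "(\<lambda>c. v c + w c) = lin_comb {..<DIM('e)} (\<lambda>\<alpha>. coef \<alpha> q v + coef \<alpha> q w) (\<lambda>\<alpha>. X \<alpha> q)"
    by (subst frame_expansion[OF q v], subst frame_expansion[OF q w])
      (simp add: lin_comb_def scaleR_add_left sum.distrib)
qed

lemma coef_scaleR:
  assumes q: "q \<in> points A" and v: "v \<in> tangent_space A q" and \<alpha>: "\<alpha> < DIM('e)"
  shows "coef \<alpha> q (\<lambda>c. r *\<^sub>R v c) = r * coef \<alpha> q v"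
proof (rule coef_eqI[OF q _ \<alpha>])
  show "(\<lambda>c. r *\<^sub>R v c) = lin_comb {..<DIM('e)} (\<lambda>\<alpha>. r * coef \<alpha> q v) (\<lambda>\<alpha>. X \<alpha> q)"
    by (subst frame_expansion[OF q v]) (simp add: lin_comb_def scaleR_sum_right)
qed

lemma coef_diff:
  assumes q: "q \<in> points A" and v: "v \<in> tangent_space A q" and w: "w \<in> tangent_space A q" and \<alpha>: "\<alpha> < DIM('e)"
  shows "coef \<alpha> q (\<lambda>c. v c - w c) = coef \<alpha> q v - coef \<alpha> q w"
  using coef_add[OF q v tangent_space_scaleR[OF w, of "-1"] \<alpha>] coef_scaleR[OF q w \<alpha>, of "-1"] by simp

subsection \<open>Smoothness of frame coefficients\<close>

text \<open>
The Gram matrix of the frame in a chart. It yields a formula for frame coefficients from the scalar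
products of a vector with the frame, without a numbering of the standard basis.
\<close>

definition gram :: "('q, 'e) chart \<Rightarrow> 'q \<Rightarrow> nat \<Rightarrow> nat \<Rightarrow> real" where
  "gram c q \<alpha> \<beta> = X \<alpha> q c \<bullet> X \<beta> q c"

text \<open>
If \<open>w\<close> is in the kernel, then \<open>w\<^sup>\<beta> X\<^sub>\<beta>\<close> has norm zero.
\<close>

lemma gram_nonsingular:
  assumes c: "c \<in> A" and q: "q \<in> fst c"
  shows "Determinant.det (mat DIM('e) DIM('e) (\<lambda>(\<alpha>, \<beta>). gram c q \<alpha> \<beta>)) \<noteq> 0"
proof (rule det_nonzeroI)
  fix w :: "nat \<Rightarrow> real" and \<beta>
  assume w: "\<And>\<alpha>. \<alpha> < DIM('e) \<Longrightarrow> (\<Sum>\<beta><DIM('e). gram c q \<alpha> \<beta> * w \<beta>) = 0" and \<beta>: "\<beta> < DIM('e)"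
  let ?s = "\<Sum>\<beta><DIM('e). w \<beta> *\<^sub>R X \<beta> q c"
  \<comment> \<open>The squared norm of \<open>?s\<close> is the quadratic form of the Gram matrix.\<close>
  have "?s \<bullet> ?s = (\<Sum>\<alpha><DIM('e). w \<alpha> * (\<Sum>\<beta><DIM('e). gram c q \<alpha> \<beta> * w \<beta>))"
    unfolding inner_sum_left
    by (rule sum.cong) (simp_all add: inner_sum_right gram_def sum_distrib_left mult_ac)
  also have "\<dots> = 0"
    using w by simp
  finally show "w \<beta> = 0"
    using frame_independent[OF c q _ \<beta>] by simp
qed

lemma coef_chart:
  assumes c: "c \<in> A" and q: "q \<in> fst c" and v: "v \<in> tangent_space A q" and \<alpha>: "\<alpha> < DIM('e)"
  shows "coef \<alpha> q v = (\<Sum>\<beta><DIM('e). matrix_inverse DIM('e) (gram c q) \<alpha> \<beta> * (X \<beta> q c \<bullet> v c))"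
proof -
  let ?M = "matrix_inverse DIM('e) (gram c q)"
  have vc: "v c = (\<Sum>\<gamma><DIM('e). coef \<gamma> q v *\<^sub>R X \<gamma> q c)"
    using fun_cong[OF frame_expansion[OF in_points[OF c q] v], of c] by (simp add: lin_comb_def)
  have "(\<Sum>\<beta><DIM('e). ?M \<alpha> \<beta> * (X \<beta> q c \<bullet> v c)) =
      (\<Sum>\<beta><DIM('e). \<Sum>\<gamma><DIM('e). ?M \<alpha> \<beta> * gram c q \<beta> \<gamma> * coef \<gamma> q v)"
    by (subst vc) (simp add: inner_sum_right gram_def sum_distrib_left mult_ac)
  also have "\<dots> = (\<Sum>\<gamma><DIM('e). \<Sum>\<beta><DIM('e). ?M \<alpha> \<beta> * gram c q \<beta> \<gamma> * coef \<gamma> q v)"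
    by (rule sum.swap)
  also have "\<dots> = (\<Sum>\<gamma><DIM('e). (if \<alpha> = \<gamma> then 1 else 0) * coef \<gamma> q v)"
    using matrix_inverse_mult(2)[OF gram_nonsingular[OF c q] \<alpha>]
    by (intro sum.cong) (simp_all flip: sum_distrib_right)
  also have "\<dots> = coef \<alpha> q v"
    using \<alpha> by (simp add: if_distrib[of "\<lambda>x. x * _"] cong: if_cong)
  finally show ?thesis by simp
qed

lemma frame_chart_smooth:
  "c \<in> A \<Longrightarrow> \<alpha> < DIM('e) \<Longrightarrow> smooth_on (snd c ` fst c) (\<lambda>x. X \<alpha> (chart_inv c x) c)"
  by (rule vector_field_smooth[OF frame_vector_field])

lemma gram_inverse_smooth:
  assumes c: "c \<in> A" and "\<alpha> < DIM('e)" "\<beta> < DIM('e)"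
  shows "smooth_on (snd c ` fst c) (\<lambda>x. matrix_inverse DIM('e) (gram c (chart_inv c x)) \<alpha> \<beta>)"
proof (rule smooth_on_matrix_inverse[OF open_chart[OF c] _ _ assms(2,3)])
  show "smooth_on (snd c ` fst c) (\<lambda>x. gram c (chart_inv c x) \<alpha> \<beta>)"
    if "\<alpha> < DIM('e)" "\<beta> < DIM('e)" for \<alpha> \<beta>
    unfolding gram_def
    by (intro smooth_on_bilinear[OF bounded_bilinear_inner] open_chart frame_chart_smooth c that)
qed (rule gram_nonsingular[OF c chart_inv_in[OF c]])

lemma smooth_on_comp_base:
  assumes c: "c \<in> A" and f: "smooth_on (snd c ` fst c) (\<lambda>x. f (chart_inv c x))"
  shows "smooth_on (snd c ` fst c \<times> UNIV) (\<lambda>z. f (fst (chart_inv (tangent_chart A c) z)))"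
proof -
  have o: "open (snd c ` fst c)" "open (snd c ` fst c \<times> (UNIV :: 'e set))"
    using open_chart[OF c] by (simp_all add: open_Times)
  have 1: "smooth_on (snd c ` fst c \<times> (UNIV :: 'e set)) (\<lambda>z. f (chart_inv c (fst z)))"
    by (rule smooth_on_compose[OF o(2,1) f smooth_on_fst[OF o(2) smooth_on_id]]) auto
  show ?thesis
    by (rule iffD2[OF smooth_on_cong[OF o(2)] 1]) (simp add: chart_inv_tangent_chart_base[OF c])
qed

text \<open>
In a chart the coefficients are obtained from smooth data by inverting the Gram matrix.
\<close>

lemma coef_smooth_along:
  assumes Z: "Z \<in> along_tau A" and \<alpha>: "\<alpha> < DIM('e)"
  shows "smooth_fun (tangent_bundle A) (\<lambda>p. coef \<alpha> (fst p) (Z p))"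
  unfolding smooth_fun_def
proof
  fix t assume "t \<in> tangent_bundle A"
  then obtain c where c: "c \<in> A" and t: "t = tangent_chart A c" by (auto simp: tangent_bundle_def)
  have o: "open (snd c ` fst c \<times> (UNIV :: 'e set))"
    using open_chart[OF c] by (simp add: open_Times)
  have 1: "smooth_on (snd c ` fst c \<times> UNIV) (\<lambda>z. \<Sum>\<beta><DIM('e).
      matrix_inverse DIM('e) (gram c (fst (chart_inv t z))) \<alpha> \<beta> * (X \<beta> (fst (chart_inv t z)) c \<bullet> Z (chart_inv t z) c))"
    unfolding t
    using smooth_on_comp_base[OF c gram_inverse_smooth[OF c \<alpha>]] smooth_on_comp_base[OF c frame_chart_smooth[OF c]]
    by (intro smooth_on_sum smooth_on_mult smooth_on_bilinear[OF bounded_bilinear_inner] o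
        along_tau_smooth[OF Z c]) auto
  have 2: "((\<lambda>p. coef \<alpha> (fst p) (Z p)) \<circ> chart_inv t) z = (\<Sum>\<beta><DIM('e).
      matrix_inverse DIM('e) (gram c (fst (chart_inv t z))) \<alpha> \<beta> * (X \<beta> (fst (chart_inv t z)) c \<bullet> Z (chart_inv t z) c))"
    if z: "z \<in> snd c ` fst c \<times> UNIV" for z
  proof -
    have tb: "t \<in> tangent_bundle A" "z \<in> snd t ` fst t"
      using c z by (simp_all add: t tangent_chart_image)
    have p: "chart_inv t z \<in> fst t"
      by (rule TB.chart_inv_in[OF tb])
    then have "fst (chart_inv t z) \<in> fst c"
      by (simp add: t tangent_chart_simps)
    then show ?thesis
      using coef_chart[OF c _ along_tau_tangent[OF Z TB.in_points[OF tb(1) p]] \<alpha>] by simp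
  qed
  show "smooth_on (snd t ` fst t) ((\<lambda>p. coef \<alpha> (fst p) (Z p)) \<circ> chart_inv t)"
    unfolding t tangent_chart_image[OF c] unfolding t[symmetric]
    by (rule iffD2[OF smooth_on_cong[OF o 2] 1])
qed

lemma coef_smooth_base:
  assumes Y: "vector_field A Y" and \<alpha>: "\<alpha> < DIM('e)"
  shows "smooth_fun A (\<lambda>q. coef \<alpha> q (Y q))"
  unfolding smooth_fun_def
proof
  fix c assume c: "c \<in> A"
  have 1: "smooth_on (snd c ` fst c) (\<lambda>x. \<Sum>\<beta><DIM('e).
      matrix_inverse DIM('e) (gram c (chart_inv c x)) \<alpha> \<beta> * (X \<beta> (chart_inv c x) c \<bullet> Y (chart_inv c x) c))"
    using gram_inverse_smooth[OF c \<alpha>]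
    by (intro smooth_on_sum smooth_on_mult smooth_on_bilinear[OF bounded_bilinear_inner] open_chart[OF c]
        vector_field_smooth[OF Y c] frame_chart_smooth[OF c]) auto
  have 2: "((\<lambda>q. coef \<alpha> q (Y q)) \<circ> chart_inv c) x = (\<Sum>\<beta><DIM('e).
      matrix_inverse DIM('e) (gram c (chart_inv c x)) \<alpha> \<beta> * (X \<beta> (chart_inv c x) c \<bullet> Y (chart_inv c x) c))"
    if "x \<in> snd c ` fst c" for x
    using chart_inv_in[OF c that]
      coef_chart[OF c _ vector_field_tangent[OF Y in_points[OF c]] \<alpha>, of "chart_inv c x"] by simp
  show "smooth_on (snd c ` fst c) ((\<lambda>q. coef \<alpha> q (Y q)) \<circ> chart_inv c)"
    by (rule iffD2[OF smooth_on_cong[OF open_chart[OF c] 2] 1])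
qed

text \<open>
The frame components of a velocity reassemble it, so the canonical field does not depend on the frame.
\<close>

lemma canonical_field_eq: "canonical_field A X p = (if p \<in> TQ then snd p else (\<lambda>_. 0))"
proof (cases "p \<in> TQ")
  case True
  then show ?thesis
    using frame_expansion[OF base_point[OF True] fibre_vector[OF True]]
    by (simp add: canonical_field_def basic_def)
qed (simp add: canonical_field_def basic_def lin_comb_def)

lemma canonical_field_along_tau: "canonical_field A X \<in> along_tau A"
proof (rule along_tauI)
  fix c assume c: "c \<in> A"
  have o: "open (snd c ` fst c \<times> (UNIV :: 'e set))"
    using open_chart[OF c] by (simp add: open_Times)
  have 1: "canonical_field A X (chart_inv (tangent_chart A c) z) c = snd z"
    if z: "z \<in> snd c ` fst c \<times> UNIV" for z
  proof -
    obtain x y where xy: "z = (x, y)" "x \<in> snd c ` fst c" using z by auto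
    then show ?thesis
      using chart_inv_tangent_chart[OF c xy(2), of y] tangent_vector_in[OF c chart_inv_in[OF c xy(2)], of y]
        tangent_vector_at[OF c chart_inv_in[OF c xy(2)], of y] in_points[OF c chart_inv_in[OF c xy(2)]]
      by (simp add: canonical_field_eq points_tangent_bundle)
  qed
  show "smooth_on (snd c ` fst c \<times> UNIV) (\<lambda>z. canonical_field A X (chart_inv (tangent_chart A c) z) c)"
    by (rule iffD2[OF smooth_on_cong[OF o 1] smooth_on_snd[OF o smooth_on_id]])
qed (auto simp: canonical_field_eq points_tangent_bundle)

lemma quasi_velocity_smooth:
  assumes "\<alpha> < DIM('e)"
  shows "smooth_fun (tangent_bundle A) (quasi_velocity X \<alpha>)"
  by (rule iffD1[OF smooth_fun_cong[OF smooth_atlas_tangent_bundle]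
        coef_smooth_along[OF canonical_field_along_tau assms]]) (simp add: canonical_field_eq)

subsection \<open>Vector fields along the projection in terms of the frame\<close>

text \<open>
The field \<open>\<xi>\<^sup>\<alpha> X\<^sub>\<alpha>\<close> along the projection; it vanishes off the tangent bundle, as the members of
\<^const>\<open>along_tau\<close> are required to.
\<close>

definition along_frame :: "(nat \<Rightarrow> ('q, 'e) tpoint \<Rightarrow> real) \<Rightarrow> ('q, 'e) tpoint \<Rightarrow> ('q, 'e) tvec" where
  "along_frame \<xi> p = lin_comb {..<DIM('e)} (\<lambda>\<alpha>. \<xi> \<alpha> p) (\<lambda>\<alpha>. basic A (X \<alpha>) p)"

lemma along_frame_apply: "along_frame \<xi> p c = (\<Sum>\<alpha><DIM('e). \<xi> \<alpha> p *\<^sub>R basic A (X \<alpha>) p c)"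
  by (simp add: along_frame_def lin_comb_def)

lemma along_frame_at: "p \<in> TQ \<Longrightarrow> along_frame \<xi> p = lin_comb {..<DIM('e)} (\<lambda>\<alpha>. \<xi> \<alpha> p) (\<lambda>\<alpha>. X \<alpha> (fst p))"
  by (simp add: along_frame_def basic_def)

lemma along_frame_in:
  assumes "\<And>\<alpha>. \<alpha> < DIM('e) \<Longrightarrow> smooth_fun (tangent_bundle A) (\<xi> \<alpha>)"
  shows "along_frame \<xi> \<in> along_tau A"
  unfolding along_frame_def lin_comb_def using assms
  by (intro along_tau_sum along_tau_scaleR basic_along_tau frame_vector_field) auto

lemma coef_along_frame: "p \<in> TQ \<Longrightarrow> \<alpha> < DIM('e) \<Longrightarrow> coef \<alpha> (fst p) (along_frame \<xi> p) = \<xi> \<alpha> p"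
  by (simp add: along_frame_at coef_lin_comb base_point)

lemma along_tau_expansion:
  assumes "Z \<in> along_tau A"
  shows "Z = along_frame (\<lambda>\<alpha> p. coef \<alpha> (fst p) (Z p))"
proof
  show "Z p = along_frame (\<lambda>\<alpha> p. coef \<alpha> (fst p) (Z p)) p" for p
  proof (cases "p \<in> TQ")
    case True
    show ?thesis
      using frame_expansion[OF base_point[OF True] along_tau_tangent[OF assms True]]
      by (simp add: along_frame_at[OF True])
  next
    case False
    then show ?thesis
      using along_tau_outside[OF assms False] by (simp add: along_frame_def lin_comb_def basic_def)
  qed
qed

lemma coef_basic:
  assumes "p \<in> TQ" "\<alpha> < DIM('e)" "\<beta> < DIM('e)"
  shows "coef \<beta> (fst p) (basic A (X \<alpha>) p) = (if \<beta> = \<alpha> then 1 else 0)"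
proof (rule coef_eqI[OF base_point[OF assms(1)] _ assms(3)])
  show "basic A (X \<alpha>) p = lin_comb {..<DIM('e)} (\<lambda>\<beta>. if \<beta> = \<alpha> then 1 else 0) (\<lambda>\<alpha>. X \<alpha> (fst p))"
    using assms(1,2)
    by (simp add: fun_eq_iff lin_comb_def basic_def if_distrib[of "\<lambda>r. r *\<^sub>R _"] cong: if_cong)
qed

abbreviation XC :: "nat \<Rightarrow> ('q, 'e) tpoint \<Rightarrow> (('q, 'e) tpoint, 'e \<times> 'e) tvec" where
  "XC \<alpha> \<equiv> complete_lift A (X \<alpha>)"

abbreviation XV :: "nat \<Rightarrow> ('q, 'e) tpoint \<Rightarrow> (('q, 'e) tpoint, 'e \<times> 'e) tvec" where
  "XV \<alpha> \<equiv> vertical_lift A (basic A (X \<alpha>))"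

lemma XC_vector_field: "\<alpha> < DIM('e) \<Longrightarrow> vector_field (tangent_bundle A) (XC \<alpha>)"
  by (intro vector_field_complete_lift frame_vector_field)

lemma XV_vector_field: "\<alpha> < DIM('e) \<Longrightarrow> vector_field (tangent_bundle A) (XV \<alpha>)"
  by (intro vector_field_vertical_lift basic_along_tau frame_vector_field)

lemma vertical_lift_along_frame:
  "vertical_lift A (along_frame \<xi>) p d = (\<Sum>\<alpha><DIM('e). \<xi> \<alpha> p *\<^sub>R XV \<alpha> p d)"
proof (cases "d \<in> tangent_bundle A \<and> p \<in> fst d")
  case True
  then show ?thesis
    by (intro prod_eqI) (simp_all add: vertical_lift_def along_frame_apply fst_sum snd_sum Let_def)
next
  case False
  then have "vertical_lift A Z p d = 0" for Z
    by (auto simp: vertical_lift_def)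
  then show ?thesis by simp
qed

lemma vertical_lift_along_tau:
  assumes "Z \<in> along_tau A"
  shows "vertical_lift A Z p d = (\<Sum>\<alpha><DIM('e). coef \<alpha> (fst p) (Z p) *\<^sub>R XV \<alpha> p d)"
  by (rule trans[OF arg_cong[where f = "\<lambda>Z. vertical_lift A Z p d", OF along_tau_expansion[OF assms]]
        vertical_lift_along_frame])

subsection \<open>Second-order vectors\<close>

text \<open>
The value at \<open>p\<close> of a second-order field whose forces at \<open>p\<close> are the numbers \<open>F\<^sup>\<alpha>\<close>. Working with a single
vector lets the same lemmas serve fields on the tangent bundle and on the constraint manifold.
\<close>

definition second_order :: "(nat \<Rightarrow> real) \<Rightarrow> ('q, 'e) tpoint \<Rightarrow> (('q, 'e) tpoint, 'e \<times> 'e) tvec" where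
  "second_order F p = (\<lambda>d. \<Sum>\<alpha><DIM('e). quasi_velocity X \<alpha> p *\<^sub>R XC \<alpha> p d + F \<alpha> *\<^sub>R XV \<alpha> p d)"

lemma second_order_vector_field:
  assumes "\<And>\<alpha>. \<alpha> < DIM('e) \<Longrightarrow> smooth_fun (tangent_bundle A) (F \<alpha>)"
  shows "vector_field (tangent_bundle A) (\<lambda>p. second_order (\<lambda>\<alpha>. F \<alpha> p) p)"
  unfolding second_order_def using assms
  by (intro TB.vector_field_sum TB.vector_field_add TB.vector_field_scaleR quasi_velocity_smooth
      XC_vector_field XV_vector_field) auto

lemma second_order_tangent:
  assumes p: "p \<in> TQ"
  shows "second_order F p \<in> tangent_space (tangent_bundle A) p"
  unfolding second_order_def
  by (intro TB.tangent_space_sum TB.tangent_space_add TB.tangent_space_scaleR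
      TB.vector_field_tangent[OF XC_vector_field p] TB.vector_field_tangent[OF XV_vector_field p]) auto

lemma dir_deriv_second_order:
  assumes p: "p \<in> TQ" and f: "smooth_fun (tangent_bundle A) f"
  shows "dir_deriv (tangent_bundle A) p (second_order F p) f =
    (\<Sum>\<alpha><DIM('e). quasi_velocity X \<alpha> p * dir_deriv (tangent_bundle A) p (XC \<alpha> p) f
      + F \<alpha> * dir_deriv (tangent_bundle A) p (XV \<alpha> p) f)"
  unfolding second_order_def
  by (simp only: TB.dir_deriv_sum[OF p f] TB.dir_deriv_add[OF p f] TB.dir_deriv_scaleR[OF p f])

lemma fibre_vector_chart:
  assumes "c \<in> A" "p \<in> fst (tangent_chart A c)"
  shows "snd p c = (\<Sum>\<alpha><DIM('e). quasi_velocity X \<alpha> p *\<^sub>R X \<alpha> (fst p) c)"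
  using fun_cong[OF frame_expansion[of "fst p" "snd p"], of c] assms in_points[of c "fst p"]
  by (simp add: tangent_chart_simps lin_comb_def)

lemma second_order_chart:
  assumes c: "c \<in> A" and p: "p \<in> fst (tangent_chart A c)"
  shows "second_order F p (tangent_chart A c) =
    (snd p c, \<Sum>\<alpha><DIM('e). quasi_velocity X \<alpha> p *\<^sub>R
        frechet_derivative (\<lambda>x. X \<alpha> (chart_inv c x) c) (at (snd c (fst p))) (snd p c)
      + F \<alpha> *\<^sub>R X \<alpha> (fst p) c)"
proof -
  have "p \<in> TQ"
    using TB.in_points[of "tangent_chart A c"] c p by simp
  then show ?thesis
    unfolding second_order_def complete_lift_chart[OF c p] vertical_lift_chart[OF c p]
    using fibre_vector_chart[OF c p]
    by (intro prod_eqI) (simp_all add: fst_sum snd_sum basic_def)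
qed

text \<open>
In natural coordinates \<open>y = v\<^sup>\<beta>(x, y) X\<^sub>\<beta>(x)\<close>. The derivative of this identity along the given vector has
\<open>v\<^sup>\<alpha> DX\<^sub>\<alpha>(x) y + F\<^sup>\<alpha> X\<^sub>\<alpha>(x)\<close> on the left; on the right the term \<open>v\<^sup>\<alpha> DX\<^sub>\<alpha>(x) y\<close> appears as well, because the
base component of the vector is \<open>y\<close>. What remains compares the derivatives of \<open>v\<^sup>\<beta>\<close> with \<open>F\<^sup>\<beta>\<close>.
\<close>

lemma quasi_velocity_second_order:
  assumes p: "p \<in> TQ" and \<beta>: "\<beta> < DIM('e)"
  shows "dir_deriv (tangent_bundle A) p (second_order F p) (quasi_velocity X \<beta>) = F \<beta>"
proof -
  obtain c where c: "c \<in> A" and q: "fst p \<in> fst c"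
    using point_in_chart[OF base_point[OF p]] by blast
  let ?t = "tangent_chart A c"
  have pt: "p \<in> fst ?t"
    using q fibre_vector[OF p] by (simp add: tangent_chart_simps)
  have tb: "?t \<in> tangent_bundle A"
    using c by simp
  have o: "open (snd c ` fst c \<times> (UNIV :: 'e set))"
    using open_chart[OF c] by (simp add: open_Times)
  let ?z = "snd ?t p"
  let ?w = "second_order F p ?t"
  let ?X = "\<lambda>\<alpha> x. X \<alpha> (chart_inv c x) c"
  let ?u = "\<lambda>\<alpha>. quasi_velocity X \<alpha> \<circ> chart_inv ?t"
  let ?D = "\<lambda>\<alpha>. dir_deriv (tangent_bundle A) p (second_order F p) (quasi_velocity X \<alpha>)"
  have z: "fst ?z = snd c (fst p)" "snd ?z = snd p c"
    by (simp_all add: tangent_chart_simps)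
  have zU: "?z \<in> snd c ` fst c \<times> UNIV"
    using q by (auto simp: tangent_chart_simps)
  have u: "(?u \<alpha> has_derivative frechet_derivative (?u \<alpha>) (at ?z)) (at ?z)" if "\<alpha> < DIM('e)" for \<alpha>
    by (rule TB.smooth_fun_has_derivative[OF quasi_velocity_smooth[OF that] tb pt])
  have X: "(?X \<alpha> has_derivative frechet_derivative (?X \<alpha>) (at (fst ?z))) (at (fst ?z))" if "\<alpha> < DIM('e)" for \<alpha>
    unfolding z by (rule smooth_on_has_derivative[OF frame_chart_smooth[OF c that]]) (use q in auto)
  have "((\<lambda>z. \<Sum>\<alpha><DIM('e). ?u \<alpha> z *\<^sub>R ?X \<alpha> (fst z)) has_derivative
      (\<lambda>w. \<Sum>\<alpha><DIM('e). ?u \<alpha> ?z *\<^sub>R frechet_derivative (?X \<alpha>) (at (fst ?z)) (fst w)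
        + frechet_derivative (?u \<alpha>) (at ?z) w *\<^sub>R ?X \<alpha> (fst ?z))) (at ?z)"
    by (intro has_derivative_sum has_derivative_scaleR u has_derivative_comp_fst[OF X]) auto
  \<comment> \<open>The differentiated function is the fibre coordinate, whose derivative is known.\<close>
  moreover have "(\<Sum>\<alpha><DIM('e). ?u \<alpha> z *\<^sub>R ?X \<alpha> (fst z)) = snd z" if z: "z \<in> snd c ` fst c \<times> UNIV" for z
  proof -
    have zt: "z \<in> snd ?t ` fst ?t"
      using z by (simp add: tangent_chart_image[OF c])
    have "snd ?t (chart_inv ?t z) = z"
      by (rule TB.chart_chart_inv[OF tb zt])
    then have "snd (chart_inv ?t z) c = snd z"
      by (metis snd_conv tangent_chart_simps(2))
    then show ?thesis
      using fibre_vector_chart[OF c TB.chart_inv_in[OF tb zt]] chart_inv_tangent_chart_base[OF c z] by simp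
  qed
  ultimately have "(snd has_derivative
      (\<lambda>w. \<Sum>\<alpha><DIM('e). ?u \<alpha> ?z *\<^sub>R frechet_derivative (?X \<alpha>) (at (fst ?z)) (fst w)
        + frechet_derivative (?u \<alpha>) (at ?z) w *\<^sub>R ?X \<alpha> (fst ?z))) (at ?z)"
    by (rule has_derivative_transform_within_open[OF _ o zU])
  from has_derivative_unique[OF this has_derivative_snd[OF has_derivative_ident]]
  have "(\<Sum>\<alpha><DIM('e). ?u \<alpha> ?z *\<^sub>R frechet_derivative (?X \<alpha>) (at (fst ?z)) (fst ?w)
        + frechet_derivative (?u \<alpha>) (at ?z) ?w *\<^sub>R ?X \<alpha> (fst ?z)) = snd ?w"
    by (rule fun_cong)
  moreover have "frechet_derivative (?u \<alpha>) (at ?z) ?w = ?D \<alpha>" if "\<alpha> < DIM('e)" for \<alpha>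
    by (rule TB.dir_deriv_chart[OF second_order_tangent[OF p] quasi_velocity_smooth[OF that] tb pt, symmetric])
  moreover have "?u \<alpha> ?z = quasi_velocity X \<alpha> p" for \<alpha>
    using TB.chart_inv_chart[OF tb pt] by simp
  ultimately have "(\<Sum>\<alpha><DIM('e). quasi_velocity X \<alpha> p *\<^sub>R frechet_derivative (?X \<alpha>) (at (snd c (fst p))) (snd p c)
        + ?D \<alpha> *\<^sub>R X \<alpha> (fst p) c) =
      (\<Sum>\<alpha><DIM('e). quasi_velocity X \<alpha> p *\<^sub>R frechet_derivative (?X \<alpha>) (at (snd c (fst p))) (snd p c)
        + F \<alpha> *\<^sub>R X \<alpha> (fst p) c)"
    using c q by (simp add: second_order_chart[OF c pt] z)
  then have "(\<Sum>\<alpha><DIM('e). (?D \<alpha> - F \<alpha>) *\<^sub>R X \<alpha> (fst p) c) = 0"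
    by (simp add: sum.distrib scaleR_diff_left sum_subtractf)
  from frame_independent[OF c q this \<beta>] show ?thesis
    by simp
qed

subsection \<open>Lifts of arbitrary vector fields\<close>

lemma vertical_lift_expansion:
  assumes Y: "vector_field A Y"
  shows "vertical_lift A (basic A Y) p d = (\<Sum>\<alpha><DIM('e). coef \<alpha> (fst p) (Y (fst p)) *\<^sub>R XV \<alpha> p d)"
proof (cases "p \<in> TQ")
  case True
  then show ?thesis
    using vertical_lift_along_tau[OF basic_along_tau[OF Y], of p d] by (simp add: basic_def)
next
  case False
  then have "vertical_lift A Z p d = 0" for Z
    by (auto simp: vertical_lift_def points_def)
  then show ?thesis by simp
qed

text \<open>
For \<open>Y = \<eta>\<^sup>\<alpha> X\<^sub>\<alpha>\<close> the product rule gives \<open>Y\<^sup>C = \<eta>\<^sup>\<alpha> X\<^sub>\<alpha>\<^sup>C + (d\<eta>\<^sup>\<alpha>/dt) X\<^sub>\<alpha>\<^sup>V\<close>, where the time derivative is the one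
along the velocity.
\<close>

lemma complete_lift_expansion:
  assumes Y: "vector_field A Y" and p: "p \<in> TQ"
  shows "complete_lift A Y p d = (\<Sum>\<alpha><DIM('e). coef \<alpha> (fst p) (Y (fst p)) *\<^sub>R XC \<alpha> p d
    + dir_deriv A (fst p) (snd p) (\<lambda>q. coef \<alpha> q (Y q)) *\<^sub>R XV \<alpha> p d)"
proof (cases "d \<in> tangent_bundle A \<and> p \<in> fst d")
  case True
  then obtain c where c: "c \<in> A" and d: "d = tangent_chart A c" by (auto simp: tangent_bundle_def)
  have pt: "p \<in> fst (tangent_chart A c)"
    using True d by simp
  then have q: "fst p \<in> fst c"
    by (simp add: tangent_chart_simps)
  let ?x = "snd c (fst p)"
  let ?X = "\<lambda>\<alpha> x. X \<alpha> (chart_inv c x) c"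
  let ?h = "\<lambda>\<alpha> q. coef \<alpha> q (Y q)"
  have h: "(?h \<alpha> \<circ> chart_inv c has_derivative frechet_derivative (?h \<alpha> \<circ> chart_inv c) (at ?x)) (at ?x)"
    if "\<alpha> < DIM('e)" for \<alpha>
    by (rule smooth_fun_has_derivative[OF coef_smooth_base[OF Y that] c q])
  have X: "(?X \<alpha> has_derivative frechet_derivative (?X \<alpha>) (at ?x)) (at ?x)" if "\<alpha> < DIM('e)" for \<alpha>
    by (rule smooth_on_has_derivative[OF frame_chart_smooth[OF c that]]) (use q in auto)
  have "((\<lambda>x. \<Sum>\<alpha><DIM('e). (?h \<alpha> \<circ> chart_inv c) x *\<^sub>R ?X \<alpha> x) has_derivative
      (\<lambda>a. \<Sum>\<alpha><DIM('e). (?h \<alpha> \<circ> chart_inv c) ?x *\<^sub>R frechet_derivative (?X \<alpha>) (at ?x) a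
        + frechet_derivative (?h \<alpha> \<circ> chart_inv c) (at ?x) a *\<^sub>R ?X \<alpha> ?x)) (at ?x)"
    by (intro has_derivative_sum has_derivative_scaleR h X) auto
  moreover have "(\<Sum>\<alpha><DIM('e). (?h \<alpha> \<circ> chart_inv c) x *\<^sub>R ?X \<alpha> x) = Y (chart_inv c x) c"
    if "x \<in> snd c ` fst c" for x
    using fun_cong[OF frame_expansion[OF _ vector_field_tangent[OF Y]], of "chart_inv c x" c]
      in_points[OF c chart_inv_in[OF c that]] by (simp add: lin_comb_def)
  ultimately have "((\<lambda>x. Y (chart_inv c x) c) has_derivative
      (\<lambda>a. \<Sum>\<alpha><DIM('e). (?h \<alpha> \<circ> chart_inv c) ?x *\<^sub>R frechet_derivative (?X \<alpha>) (at ?x) a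
        + frechet_derivative (?h \<alpha> \<circ> chart_inv c) (at ?x) a *\<^sub>R ?X \<alpha> ?x)) (at ?x)"
    by (rule has_derivative_transform_within_open[OF _ open_chart[OF c] imageI[OF q]])
  note 1 = frechet_derivative_eqI[OF this, of "snd p c"]
  have 2: "frechet_derivative (?h \<alpha> \<circ> chart_inv c) (at ?x) (snd p c) = dir_deriv A (fst p) (snd p) (?h \<alpha>)"
    if "\<alpha> < DIM('e)" for \<alpha>
    by (rule dir_deriv_chart[OF fibre_vector[OF p] coef_smooth_base[OF Y that] c q, symmetric])
  have 3: "Y (fst p) c = (\<Sum>\<alpha><DIM('e). ?h \<alpha> (fst p) *\<^sub>R X \<alpha> (fst p) c)"
    using fun_cong[OF frame_expansion[OF base_point[OF p] vector_field_tangent[OF Y base_point[OF p]]], of c]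
    by (simp add: lin_comb_def)
  show ?thesis
    unfolding d complete_lift_chart[OF c pt] vertical_lift_chart[OF c pt] 1
    using c q p by (intro prod_eqI) (simp_all add: fst_sum snd_sum basic_def 2 3)
next
  case False
  then have "complete_lift A Z p d = 0" "vertical_lift A U p d = 0" for Z U
    by (auto simp: complete_lift_def vertical_lift_def)
  then show ?thesis by simp
qed

subsection \<open>The dynamical covariant derivative\<close>

text \<open>
The structure functions are smooth because the Lie bracket of two frame fields is again a vector field.
\<close>

lemma connection_coeff_smooth:
  assumes \<Gamma>: "sode A X \<Gamma>" and \<alpha>: "\<alpha> < DIM('e)" and \<beta>: "\<beta> < DIM('e)"
  shows "smooth_fun (tangent_bundle A) (connection_coeff A X \<Gamma> \<beta> \<alpha>)"
proof -
  have "sode_with A X (forces A X \<Gamma>) \<Gamma>"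
    using \<Gamma> someI_ex[of "\<lambda>F. sode_with A X F \<Gamma>"] by (simp add: sode_def forces_def)
  then have F: "smooth_fun (tangent_bundle A) (forces A X \<Gamma> \<beta>)"
    using \<beta> by (simp add: sode_with_def)
  have R: "smooth_fun (tangent_bundle A) (\<lambda>p. structure_fun A X \<beta> \<alpha> \<gamma> (fst p))" if "\<gamma> < DIM('e)" for \<gamma>
    unfolding structure_fun_def
    by (intro smooth_fun_base coef_smooth_base[OF _ \<beta>] vector_field_lie_bracket frame_vector_field \<alpha> that)
  have "smooth_fun (tangent_bundle A) (\<lambda>p. - (1 / 2) *
      (vf_apply (tangent_bundle A) (XV \<alpha>) (forces A X \<Gamma> \<beta>) p
        + (\<Sum>\<gamma><DIM('e). quasi_velocity X \<gamma> p * structure_fun A X \<beta> \<alpha> \<gamma> (fst p))))"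
    using R by (intro TB.smooth_fun_mult TB.smooth_fun_const TB.smooth_fun_add TB.smooth_fun_sum
        TB.vf_apply_smooth XV_vector_field \<alpha> F quasi_velocity_smooth) auto
  then show ?thesis
    by (simp add: connection_coeff_def[abs_def])
qed

text \<open>
The frame components that the Leibniz rule forces on the dynamical covariant derivative of
\<open>Y = \<eta>\<^sup>\<alpha> X\<^sub>\<alpha>\<close>, namely \<open>\<Gamma>(\<eta>\<^sup>\<beta>) + \<eta>\<^sup>\<alpha> \<Gamma>\<^sup>\<beta>\<^sub>\<alpha>\<close>.
\<close>

definition covariant_coeff where
  "covariant_coeff \<Gamma> Y \<beta> p = vf_apply (tangent_bundle A) \<Gamma> (\<lambda>p. coef \<beta> (fst p) (Y p)) p
     + (\<Sum>\<alpha><DIM('e). coef \<alpha> (fst p) (Y p) * connection_coeff A X \<Gamma> \<beta> \<alpha> p)"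

lemma covariant_coeff_smooth:
  assumes "sode A X \<Gamma>" "Y \<in> along_tau A" "\<beta> < DIM('e)"
  shows "smooth_fun (tangent_bundle A) (covariant_coeff \<Gamma> Y \<beta>)"
proof -
  have "vector_field (tangent_bundle A) \<Gamma>"
    using assms(1) by (auto simp: sode_def sode_with_def)
  then show ?thesis
    unfolding covariant_coeff_def[abs_def] using assms
    by (intro TB.smooth_fun_add TB.smooth_fun_sum TB.smooth_fun_mult TB.vf_apply_smooth coef_smooth_along
        connection_coeff_smooth) auto
qed

lemma along_frame_eqI:
  assumes "\<And>p \<alpha>. p \<in> TQ \<Longrightarrow> \<alpha> < DIM('e) \<Longrightarrow> \<xi> \<alpha> p = \<zeta> \<alpha> p"
  shows "along_frame \<xi> = along_frame \<zeta>"
  using assms by (auto simp: fun_eq_iff along_frame_apply basic_def intro!: sum.cong)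

lemma covariant_coeff_add:
  assumes Y: "Y \<in> along_tau A" and Z: "Z \<in> along_tau A" and p: "p \<in> TQ" and \<beta>: "\<beta> < DIM('e)"
  shows "covariant_coeff \<Gamma> (\<lambda>p c. Y p c + Z p c) \<beta> p = covariant_coeff \<Gamma> Y \<beta> p + covariant_coeff \<Gamma> Z \<beta> p"
proof -
  have add: "coef \<alpha> (fst p) (\<lambda>c. Y p c + Z p c) = coef \<alpha> (fst p) (Y p) + coef \<alpha> (fst p) (Z p)"
    if "p \<in> TQ" "\<alpha> < DIM('e)" for p \<alpha>
    by (rule coef_add[OF base_point[OF that(1)] along_tau_tangent[OF Y that(1)] along_tau_tangent[OF Z that(1)] that(2)])
  have "vf_apply (tangent_bundle A) \<Gamma> (\<lambda>p. coef \<beta> (fst p) (\<lambda>c. Y p c + Z p c)) p =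
      vf_apply (tangent_bundle A) \<Gamma> (\<lambda>p. \<Sum>i\<in>{True, False}. coef \<beta> (fst p) (if i then Y p else Z p)) p"
    unfolding vf_apply_def by (rule TB.dir_deriv_fun_cong[OF p]) (simp add: add \<beta>)
  also have "\<dots> = (\<Sum>i\<in>{True, False}. vf_apply (tangent_bundle A) \<Gamma> (\<lambda>p. coef \<beta> (fst p) (if i then Y p else Z p)) p)"
    unfolding vf_apply_def
  proof (rule TB.dir_deriv_fun_sum[OF p])
    show "smooth_fun (tangent_bundle A) (\<lambda>p. coef \<beta> (fst p) (if i then Y p else Z p))" for i
      using coef_smooth_along[OF Y \<beta>] coef_smooth_along[OF Z \<beta>] by (cases i) simp_all
  qed
  finally show ?thesis
    by (simp add: covariant_coeff_def add[OF p] sum.distrib distrib_right)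
qed

lemma covariant_coeff_scaleR:
  assumes f: "smooth_fun (tangent_bundle A) f" and Y: "Y \<in> along_tau A" and p: "p \<in> TQ" and \<beta>: "\<beta> < DIM('e)"
  shows "covariant_coeff \<Gamma> (\<lambda>p c. f p *\<^sub>R Y p c) \<beta> p =
    f p * covariant_coeff \<Gamma> Y \<beta> p + vf_apply (tangent_bundle A) \<Gamma> f p * coef \<beta> (fst p) (Y p)"
proof -
  have scale: "coef \<alpha> (fst p) (\<lambda>c. f p *\<^sub>R Y p c) = f p * coef \<alpha> (fst p) (Y p)"
    if "p \<in> TQ" "\<alpha> < DIM('e)" for p \<alpha>
    by (rule coef_scaleR[OF base_point[OF that(1)] along_tau_tangent[OF Y that(1)] that(2)])
  have "vf_apply (tangent_bundle A) \<Gamma> (\<lambda>p. coef \<beta> (fst p) (\<lambda>c. f p *\<^sub>R Y p c)) p =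
      vf_apply (tangent_bundle A) \<Gamma> (\<lambda>p. f p * coef \<beta> (fst p) (Y p)) p"
    unfolding vf_apply_def by (rule TB.dir_deriv_fun_cong[OF p]) (simp add: scale \<beta>)
  also have "\<dots> = f p * vf_apply (tangent_bundle A) \<Gamma> (\<lambda>p. coef \<beta> (fst p) (Y p)) p
      + vf_apply (tangent_bundle A) \<Gamma> f p * coef \<beta> (fst p) (Y p)"
    unfolding vf_apply_def by (rule TB.dir_deriv_fun_mult[OF p f coef_smooth_along[OF Y \<beta>]])
  finally show ?thesis
    by (simp add: covariant_coeff_def scale[OF p] sum_distrib_left distrib_left mult_ac)
qed

lemma covariant_coeff_basic:
  assumes p: "p \<in> TQ" and \<alpha>: "\<alpha> < DIM('e)" and \<beta>: "\<beta> < DIM('e)"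
  shows "covariant_coeff \<Gamma> (basic A (X \<alpha>)) \<beta> p = connection_coeff A X \<Gamma> \<beta> \<alpha> p"
proof -
  have "vf_apply (tangent_bundle A) \<Gamma> (\<lambda>p. coef \<beta> (fst p) (basic A (X \<alpha>) p)) p =
      vf_apply (tangent_bundle A) \<Gamma> (\<lambda>p. if \<beta> = \<alpha> then 1 else 0) p"
    unfolding vf_apply_def by (rule TB.dir_deriv_fun_cong[OF p]) (simp add: coef_basic \<alpha> \<beta>)
  also have "\<dots> = 0"
    unfolding vf_apply_def by (rule TB.dir_deriv_fun_const[OF p])
  finally show ?thesis
    using \<alpha> by (simp add: covariant_coeff_def coef_basic[OF p] if_distrib[of "\<lambda>r. r * _"] cong: if_cong)
qed

text \<open>
The operator given by the right-hand side has all defining properties. It is the only one: additivity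
reduces an operator with these properties to the summands of the expansion in the frame, the Leibniz
rule reduces those to the frame fields, and on the frame fields it is prescribed.
\<close>

lemma dyn_cov_deriv_eq:
  assumes \<Gamma>: "sode A X \<Gamma>" and "Y \<in> along_tau A"
  shows "dyn_cov_deriv A X \<Gamma> Y = along_frame (covariant_coeff \<Gamma> Y)"
proof -
  let ?B = "tangent_bundle A"
  define N where "N Y = (if Y \<in> along_tau A then along_frame (covariant_coeff \<Gamma> Y) else (\<lambda>_ _. 0))" for Y
  define P where "P N \<longleftrightarrow> (\<forall>Y\<in>along_tau A. N Y \<in> along_tau A) \<and>
     (\<forall>Y. Y \<notin> along_tau A \<longrightarrow> N Y = (\<lambda>_ _. 0)) \<and>
     (\<forall>Y\<in>along_tau A. \<forall>Z\<in>along_tau A.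
        N (\<lambda>p c. Y p c + Z p c) = (\<lambda>p c. N Y p c + N Z p c)) \<and>
     (\<forall>f. \<forall>Y\<in>along_tau A. smooth_fun (tangent_bundle A) f \<longrightarrow>
        N (\<lambda>p c. f p *\<^sub>R Y p c) =
          (\<lambda>p c. f p *\<^sub>R N Y p c + vf_apply (tangent_bundle A) \<Gamma> f p *\<^sub>R Y p c)) \<and>
     (\<forall>\<alpha><DIM('e). N (basic A (X \<alpha>)) = along_frame (\<lambda>\<beta>. connection_coeff A X \<Gamma> \<beta> \<alpha>))"
    for N :: "(('q, 'e) tpoint \<Rightarrow> ('q, 'e) tvec) \<Rightarrow> ('q, 'e) tpoint \<Rightarrow> ('q, 'e) tvec"
  have P_add: "R (\<lambda>p c. Y p c + Z p c) = (\<lambda>p c. R Y p c + R Z p c)"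
    if "P R" "Y \<in> along_tau A" "Z \<in> along_tau A" for R Y Z
    by (rule that(1)[unfolded P_def, THEN conjunct2, THEN conjunct2, THEN conjunct1,
          THEN bspec, OF that(2), THEN bspec, OF that(3)])
  have P_scaleR: "R (\<lambda>p c. f p *\<^sub>R Y p c) = (\<lambda>p c. f p *\<^sub>R R Y p c + vf_apply ?B \<Gamma> f p *\<^sub>R Y p c)"
    if "P R" "smooth_fun ?B f" "Y \<in> along_tau A" for R f Y
    by (rule that(1)[unfolded P_def, THEN conjunct2, THEN conjunct2, THEN conjunct2, THEN conjunct1,
          THEN spec, THEN bspec, OF that(3), THEN mp, OF that(2)])
  have P_basic: "R (basic A (X \<alpha>)) = along_frame (\<lambda>\<beta>. connection_coeff A X \<Gamma> \<beta> \<alpha>)"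
    if "P R" "\<alpha> < DIM('e)" for R \<alpha>
    by (rule that(1)[unfolded P_def, THEN conjunct2, THEN conjunct2, THEN conjunct2, THEN conjunct2,
          THEN spec, THEN mp, OF that(2)])
  have "P N"
    unfolding P_def
  proof (intro conjI ballI allI impI)
    fix Y assume Y: "Y \<in> along_tau A"
    show "N Y \<in> along_tau A"
      using Y by (simp add: N_def along_frame_in covariant_coeff_smooth[OF \<Gamma>])
    show "N (\<lambda>p c. Y p c + Z p c) = (\<lambda>p c. N Y p c + N Z p c)" if Z: "Z \<in> along_tau A" for Z
    proof -
      have "N (\<lambda>p c. Y p c + Z p c) = along_frame (covariant_coeff \<Gamma> (\<lambda>p c. Y p c + Z p c))"
        using along_tau_add[OF Y Z] by (simp add: N_def)
      also have "\<dots> = along_frame (\<lambda>\<beta> p. covariant_coeff \<Gamma> Y \<beta> p + covariant_coeff \<Gamma> Z \<beta> p)"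
        by (rule along_frame_eqI) (rule covariant_coeff_add[OF Y Z])
      finally show ?thesis
        using Y Z by (simp add: fun_eq_iff along_frame_apply N_def scaleR_add_left sum.distrib)
    qed
    show "N (\<lambda>p c. f p *\<^sub>R Y p c) = (\<lambda>p c. f p *\<^sub>R N Y p c + vf_apply ?B \<Gamma> f p *\<^sub>R Y p c)"
      if f: "smooth_fun ?B f" for f
    proof -
      have "N (\<lambda>p c. f p *\<^sub>R Y p c) = along_frame (covariant_coeff \<Gamma> (\<lambda>p c. f p *\<^sub>R Y p c))"
        using along_tau_scaleR[OF f Y] by (simp add: N_def)
      also have "\<dots> = along_frame (\<lambda>\<beta> p. f p * covariant_coeff \<Gamma> Y \<beta> p + vf_apply ?B \<Gamma> f p * coef \<beta> (fst p) (Y p))"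
        by (rule along_frame_eqI) (rule covariant_coeff_scaleR[OF f Y])
      also have "\<dots> = (\<lambda>p c. f p *\<^sub>R along_frame (covariant_coeff \<Gamma> Y) p c
          + vf_apply ?B \<Gamma> f p *\<^sub>R along_frame (\<lambda>\<beta> p. coef \<beta> (fst p) (Y p)) p c)"
        by (simp add: fun_eq_iff along_frame_apply scaleR_add_left sum.distrib scaleR_sum_right)
      finally show ?thesis
        using Y by (simp add: N_def flip: along_tau_expansion[OF Y])
    qed
  next
    fix \<alpha> assume \<alpha>: "\<alpha> < DIM('e)"
    have "N (basic A (X \<alpha>)) = along_frame (covariant_coeff \<Gamma> (basic A (X \<alpha>)))"
      using basic_along_tau[OF frame_vector_field[OF \<alpha>]] by (simp add: N_def)
    also have "\<dots> = along_frame (\<lambda>\<beta>. connection_coeff A X \<Gamma> \<beta> \<alpha>)"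
      by (rule along_frame_eqI) (rule covariant_coeff_basic[OF _ \<alpha>])
    finally show "N (basic A (X \<alpha>)) = along_frame (\<lambda>\<beta>. connection_coeff A X \<Gamma> \<beta> \<alpha>)" .
  qed (simp add: N_def)
  moreover have "M = N" if M: "P M" for M
  proof
    fix Y
    show "M Y = N Y"
    proof (cases "Y \<in> along_tau A")
      case False
      then show ?thesis using M \<open>P N\<close> by (simp add: P_def)
    next
      case Y: True
      \<comment> \<open>Additivity is only available for members of \<^const>\<open>along_tau\<close>, hence the induction over partial sums.\<close>
      have summand: "(\<lambda>p c. coef \<alpha> (fst p) (Y p) *\<^sub>R basic A (X \<alpha>) p c) \<in> along_tau A" if "\<alpha> < DIM('e)" for \<alpha>
        by (rule along_tau_scaleR[OF coef_smooth_along[OF Y that] basic_along_tau[OF frame_vector_field[OF that]]])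
      have "M (\<lambda>p c. \<Sum>\<alpha><k. coef \<alpha> (fst p) (Y p) *\<^sub>R basic A (X \<alpha>) p c) =
          N (\<lambda>p c. \<Sum>\<alpha><k. coef \<alpha> (fst p) (Y p) *\<^sub>R basic A (X \<alpha>) p c)" if "k \<le> DIM('e)" for k
        using that
      proof (induction k)
        case 0
        have z: "(\<lambda>p c. 0) \<in> along_tau A"
          using along_tau_sum[of "{}"] by simp
        have "R (\<lambda>p c. 0) = (\<lambda>p c. 0)" if R: "P R" for R
        proof -
          \<comment> \<open>An additive operator maps zero to zero.\<close>
          have "R (\<lambda>p c. 0 + 0) = (\<lambda>p c. R (\<lambda>p c. 0) p c + R (\<lambda>p c. 0) p c)"
            by (rule P_add[OF R z z])
          then show ?thesis by (simp add: fun_eq_iff)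
        qed
        then show ?case using M \<open>P N\<close> by simp
      next
        case (Suc k)
        have k: "k < DIM('e)" using Suc.prems by simp
        let ?S = "\<lambda>p c. \<Sum>\<alpha><k. coef \<alpha> (fst p) (Y p) *\<^sub>R basic A (X \<alpha>) p c"
        let ?T = "\<lambda>p c. coef k (fst p) (Y p) *\<^sub>R basic A (X k) p c"
        have S: "?S \<in> along_tau A"
          using k by (intro along_tau_sum summand) auto
        have "R (\<lambda>p c. ?S p c + ?T p c) = (\<lambda>p c. R ?S p c +
            (coef k (fst p) (Y p) *\<^sub>R along_frame (\<lambda>\<beta>. connection_coeff A X \<Gamma> \<beta> k) p c
              + vf_apply ?B \<Gamma> (\<lambda>p. coef k (fst p) (Y p)) p *\<^sub>R basic A (X k) p c))" if R: "P R" for R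
        proof -
          have 1: "R (\<lambda>p c. ?S p c + ?T p c) = (\<lambda>p c. R ?S p c + R ?T p c)"
            by (rule P_add[OF R S summand[OF k]])
          have 2: "R ?T = (\<lambda>p c. coef k (fst p) (Y p) *\<^sub>R R (basic A (X k)) p c
              + vf_apply ?B \<Gamma> (\<lambda>p. coef k (fst p) (Y p)) p *\<^sub>R basic A (X k) p c)"
            by (rule P_scaleR[OF R coef_smooth_along[OF Y k] basic_along_tau[OF frame_vector_field[OF k]]])
          have 3: "R (basic A (X k)) = along_frame (\<lambda>\<beta>. connection_coeff A X \<Gamma> \<beta> k)"
            by (rule P_basic[OF R k])
          show ?thesis unfolding 1 2 3 ..
        qed
        then show ?case
          using M \<open>P N\<close> Suc by simp
      qed
      from this[of "DIM('e)"] show ?thesis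
        using along_tau_expansion[OF Y] by (simp add: along_frame_def[abs_def] lin_comb_def)
    qed
  qed
  ultimately have "(THE N. P N) = N"
    by (rule the_equality)
  moreover have "dyn_cov_deriv A X \<Gamma> = (THE N. P N)"
    unfolding dyn_cov_deriv_def P_def along_frame_def[abs_def] ..
  ultimately show ?thesis
    using assms by (simp add: N_def)
qed

end

section \<open>Lagrangian dynamics in a frame\<close>

locale lagrangian_system = framed_atlas A X
  for A :: "('q, 'e::euclidean_space) chart set" and X :: "nat \<Rightarrow> 'q \<Rightarrow> ('q, 'e) tvec" +
  fixes L :: "('q, 'e) tpoint \<Rightarrow> real"
  assumes smooth_L: "smooth_fun (tangent_bundle A) L"
    and regular_L: "regular A X L"
begin

abbreviation momentum :: "nat \<Rightarrow> ('q, 'e) tpoint \<Rightarrow> real" where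
  "momentum \<alpha> \<equiv> vf_apply (tangent_bundle A) (XV \<alpha>) L"

abbreviation g :: "nat \<Rightarrow> nat \<Rightarrow> ('q, 'e) tpoint \<Rightarrow> real" where
  "g \<equiv> hess_coeff A X L"

text \<open>
The Euler-Lagrange expression \<open>G(Y\<^sup>V(L)) - Y\<^sup>C(L)\<close> at a point, for a vector \<open>G\<close> in place of a second-order
field.
\<close>

definition euler_lagrange ::
    "('q, 'e) tpoint \<Rightarrow> (('q, 'e) tpoint, 'e \<times> 'e) tvec \<Rightarrow> ('q \<Rightarrow> ('q, 'e) tvec) \<Rightarrow> real" where
  "euler_lagrange p G Y =
     dir_deriv (tangent_bundle A) p G (vf_apply (tangent_bundle A) (vertical_lift A (basic A Y)) L)
     - dir_deriv (tangent_bundle A) p (complete_lift A Y p) L"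

lemma momentum_smooth: "\<alpha> < DIM('e) \<Longrightarrow> smooth_fun (tangent_bundle A) (momentum \<alpha>)"
  by (intro TB.vf_apply_smooth XV_vector_field smooth_L)

lemma g_eq: "g \<alpha> \<beta> p = dir_deriv (tangent_bundle A) p (XV \<alpha> p) (momentum \<beta>)"
  by (simp add: hess_coeff_def vf_apply_def)

lemma g_smooth: "\<alpha> < DIM('e) \<Longrightarrow> \<beta> < DIM('e) \<Longrightarrow> smooth_fun (tangent_bundle A) (g \<alpha> \<beta>)"
  unfolding hess_coeff_def by (intro TB.vf_apply_smooth XV_vector_field momentum_smooth)

lemma g_nonsingular:
  "p \<in> TQ \<Longrightarrow> Determinant.det (mat DIM('e) DIM('e) (\<lambda>(\<alpha>, \<beta>). g \<alpha> \<beta> p)) \<noteq> 0"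
  using regular_L by (simp add: regular_def)

text \<open>
The forces enter the Euler-Lagrange equations of the frame linearly, through the Hessian.
\<close>

lemma euler_lagrange_frame:
  assumes p: "p \<in> TQ" and \<beta>: "\<beta> < DIM('e)"
  shows "euler_lagrange p (second_order F p) (X \<beta>) = (\<Sum>\<alpha><DIM('e). F \<alpha> * g \<alpha> \<beta> p)
    - (dir_deriv (tangent_bundle A) p (XC \<beta> p) L
      - (\<Sum>\<alpha><DIM('e). quasi_velocity X \<alpha> p * dir_deriv (tangent_bundle A) p (XC \<alpha> p) (momentum \<beta>)))"
  unfolding euler_lagrange_def dir_deriv_second_order[OF p momentum_smooth[OF \<beta>]] g_eq
  by (simp add: sum.distrib)

text \<open>
In general neither of the two terms is linear over functions in \<open>Y = \<eta>\<^sup>\<alpha> X\<^sub>\<alpha>\<close>. Both produce the extra term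
\<open>(d\<eta>\<^sup>\<alpha>/dt) X\<^sub>\<alpha>\<^sup>V(L)\<close>, the first because the base component of a second-order vector is the velocity, and
it cancels. So it is enough to test the equations on the frame.
\<close>

lemma euler_lagrange_tensorial:
  assumes p: "p \<in> TQ" and Y: "vector_field A Y"
  shows "euler_lagrange p (second_order F p) Y =
    (\<Sum>\<alpha><DIM('e). coef \<alpha> (fst p) (Y (fst p)) * euler_lagrange p (second_order F p) (X \<alpha>))"
proof -
  let ?B = "tangent_bundle A"
  let ?G = "second_order F p"
  let ?h = "\<lambda>\<alpha> q. coef \<alpha> q (Y q)"
  have h: "smooth_fun ?B (\<lambda>p. ?h \<alpha> (fst p))" if "\<alpha> < DIM('e)" for \<alpha>
    by (rule smooth_fun_base[OF coef_smooth_base[OF Y that]])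
  have "vf_apply ?B (vertical_lift A (basic A Y)) L p = (\<Sum>\<alpha><DIM('e). ?h \<alpha> (fst p) * momentum \<alpha> p)"
    if p: "p \<in> TQ" for p
  proof -
    have "vertical_lift A (basic A Y) p = (\<lambda>d. \<Sum>\<alpha><DIM('e). ?h \<alpha> (fst p) *\<^sub>R XV \<alpha> p d)"
      by (rule ext) (rule vertical_lift_expansion[OF Y])
    then show ?thesis
      unfolding vf_apply_def
      by (simp only: TB.dir_deriv_sum[OF p smooth_L] TB.dir_deriv_scaleR[OF p smooth_L])
  qed
  then have "dir_deriv ?B p ?G (vf_apply ?B (vertical_lift A (basic A Y)) L) =
      dir_deriv ?B p ?G (\<lambda>p. \<Sum>\<alpha><DIM('e). ?h \<alpha> (fst p) * momentum \<alpha> p)"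
    by (rule TB.dir_deriv_fun_cong[OF p])
  also have "\<dots> = (\<Sum>\<alpha><DIM('e). dir_deriv ?B p ?G (\<lambda>p. ?h \<alpha> (fst p) * momentum \<alpha> p))"
    by (intro TB.dir_deriv_fun_sum[OF p] TB.smooth_fun_mult h momentum_smooth) auto
  also have "\<dots> = (\<Sum>\<alpha><DIM('e). ?h \<alpha> (fst p) * dir_deriv ?B p ?G (momentum \<alpha>)
      + dir_deriv A (fst p) (snd p) (?h \<alpha>) * momentum \<alpha> p)"
  proof (rule sum.cong)
    fix \<alpha> assume "\<alpha> \<in> {..<DIM('e)}"
    then have \<alpha>: "\<alpha> < DIM('e)" by simp
    have "dir_deriv ?B p ?G (\<lambda>p. ?h \<alpha> (fst p)) = dir_deriv A (fst p) (snd p) (?h \<alpha>)"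
      by (rule dir_deriv_base[OF p coef_smooth_base[OF Y \<alpha>] fibre_vector[OF p]])
        (simp add: second_order_chart)
    then show "dir_deriv ?B p ?G (\<lambda>p. ?h \<alpha> (fst p) * momentum \<alpha> p) =
        ?h \<alpha> (fst p) * dir_deriv ?B p ?G (momentum \<alpha>) + dir_deriv A (fst p) (snd p) (?h \<alpha>) * momentum \<alpha> p"
      using TB.dir_deriv_fun_mult[OF p h[OF \<alpha>] momentum_smooth[OF \<alpha>]] by simp
  qed simp
  finally have 1: "dir_deriv ?B p ?G (vf_apply ?B (vertical_lift A (basic A Y)) L) = \<dots>" .
  have "complete_lift A Y p = (\<lambda>d. \<Sum>\<alpha><DIM('e). ?h \<alpha> (fst p) *\<^sub>R XC \<alpha> p d
      + dir_deriv A (fst p) (snd p) (?h \<alpha>) *\<^sub>R XV \<alpha> p d)"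
    by (rule ext) (rule complete_lift_expansion[OF Y p])
  then have 2: "dir_deriv ?B p (complete_lift A Y p) L = (\<Sum>\<alpha><DIM('e).
      ?h \<alpha> (fst p) * dir_deriv ?B p (XC \<alpha> p) L + dir_deriv A (fst p) (snd p) (?h \<alpha>) * momentum \<alpha> p)"
    unfolding vf_apply_def
    by (simp only: TB.dir_deriv_sum[OF p smooth_L] TB.dir_deriv_add[OF p smooth_L]
        TB.dir_deriv_scaleR[OF p smooth_L])
  show ?thesis
    unfolding euler_lagrange_def 1 2
    by (simp add: sum.distrib sum_subtractf right_diff_distrib)
qed

lemma sode_with_second_order:
  "sode_with A X F \<Gamma> \<Longrightarrow> p \<in> TQ \<Longrightarrow> \<Gamma> p = second_order (\<lambda>\<alpha>. F \<alpha> p) p"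
  by (simp add: sode_with_def second_order_def fun_eq_iff)

lemma sode_with_I:
  assumes "\<And>\<alpha>. \<alpha> < DIM('e) \<Longrightarrow> smooth_fun (tangent_bundle A) (F \<alpha>)"
    and "vector_field (tangent_bundle A) \<Gamma>"
    and "\<And>p. p \<in> TQ \<Longrightarrow> \<Gamma> p = second_order (\<lambda>\<alpha>. F \<alpha> p) p"
  shows "sode_with A X F \<Gamma>"
  using assms by (simp add: sode_with_def second_order_def)

lemma euler_lagrange_zeroI:
  assumes p: "p \<in> TQ" and Y: "vector_field A Y"
    and "\<And>\<alpha>. \<alpha> < DIM('e) \<Longrightarrow> coef \<alpha> (fst p) (Y (fst p)) = 0 \<or> euler_lagrange p (second_order F p) (X \<alpha>) = 0"
  shows "euler_lagrange p (second_order F p) Y = 0"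
  unfolding euler_lagrange_tensorial[OF p Y] using assms(3) by (intro sum.neutral) auto

text \<open>
Testing on the frame turns the equations into the linear system \<open>F\<^sup>\<alpha> g\<^sub>\<alpha>\<^sub>\<beta> = r\<^sub>\<beta>\<close> for the forces, with
smooth coefficients and a nonsingular matrix.
\<close>

lemma lagrangian_field_exists_unique:
  "\<exists>!\<Gamma>. sode A X \<Gamma> \<and>
     (\<forall>Y. vector_field A Y \<longrightarrow> (\<forall>p\<in>TQ. euler_lagrange p (\<Gamma> p) Y = 0))"
proof -
  let ?B = "tangent_bundle A"
  let ?n = "DIM('e)"
  define r where "r \<beta> p = dir_deriv ?B p (XC \<beta> p) L
      - (\<Sum>\<alpha><?n. quasi_velocity X \<alpha> p * dir_deriv ?B p (XC \<alpha> p) (momentum \<beta>))" for \<beta> p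
  define F where "F \<alpha> p = (\<Sum>\<beta><?n. r \<beta> p * matrix_inverse ?n (\<lambda>\<alpha> \<beta>. g \<alpha> \<beta> p) \<beta> \<alpha>)" for \<alpha> p
  define \<Gamma> where "\<Gamma> p = second_order (\<lambda>\<alpha>. F \<alpha> p) p" for p
  have "smooth_fun ?B (r \<beta>)" if "\<beta> < ?n" for \<beta>
  proof -
    have "smooth_fun ?B (\<lambda>p. vf_apply ?B (XC \<beta>) L p
        - (\<Sum>\<alpha><?n. quasi_velocity X \<alpha> p * vf_apply ?B (XC \<alpha>) (momentum \<beta>) p))"
      using that by (intro TB.smooth_fun_diff TB.smooth_fun_sum TB.smooth_fun_mult TB.vf_apply_smooth
          XC_vector_field quasi_velocity_smooth momentum_smooth smooth_L) auto
    then show ?thesis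
      by (simp add: r_def[abs_def] vf_apply_def)
  qed
  then have F: "smooth_fun ?B (F \<alpha>)" if "\<alpha> < ?n" for \<alpha>
    unfolding F_def[abs_def] using that g_smooth g_nonsingular
    by (intro TB.smooth_fun_sum TB.smooth_fun_mult TB.smooth_fun_matrix_inverse) auto
  have sode: "sode_with A X F \<Gamma>"
    by (rule sode_with_I) (auto simp: F \<Gamma>_def[abs_def] intro!: second_order_vector_field)
  have el: "euler_lagrange p (\<Gamma> p) (X \<beta>) = 0" if p: "p \<in> TQ" and \<beta>: "\<beta> < ?n" for p \<beta>
    unfolding \<Gamma>_def euler_lagrange_frame[OF p \<beta>]
    using matrix_inverse_solves[OF g_nonsingular[OF p] \<beta>, of "\<lambda>\<beta>. r \<beta> p"]
    by (simp add: F_def r_def)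
  show ?thesis
  proof (rule ex1I[of _ \<Gamma>])
    have "euler_lagrange p (\<Gamma> p) Y = 0" if "vector_field A Y" "p \<in> TQ" for Y p
      using el[OF that(2)] unfolding \<Gamma>_def by (intro euler_lagrange_zeroI that) auto
    then show "sode A X \<Gamma> \<and> (\<forall>Y. vector_field A Y \<longrightarrow> (\<forall>p\<in>TQ. euler_lagrange p (\<Gamma> p) Y = 0))"
      using sode by (auto simp: sode_def)
  next
    fix \<Delta> assume \<Delta>: "sode A X \<Delta> \<and> (\<forall>Y. vector_field A Y \<longrightarrow> (\<forall>p\<in>TQ. euler_lagrange p (\<Delta> p) Y = 0))"
    then obtain H where H: "sode_with A X H \<Delta>"
      by (auto simp: sode_def)
    show "\<Delta> = \<Gamma>"
    proof
      fix p
      show "\<Delta> p = \<Gamma> p"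
      proof (cases "p \<in> TQ")
        case True
        have "H \<alpha> p = F \<alpha> p" if "\<alpha> < ?n" for \<alpha>
        proof (rule nonsingular_left_cancel[OF g_nonsingular[OF True] _ that])
          fix \<beta> assume \<beta>: "\<beta> < ?n"
          have "euler_lagrange p (\<Delta> p) (X \<beta>) = euler_lagrange p (\<Gamma> p) (X \<beta>)"
            using \<Delta> frame_vector_field[OF \<beta>] True el[OF True \<beta>] by simp
          then show "(\<Sum>\<alpha><?n. H \<alpha> p * g \<alpha> \<beta> p) = (\<Sum>\<alpha><?n. F \<alpha> p * g \<alpha> \<beta> p)"
            unfolding sode_with_second_order[OF H True] \<Gamma>_def euler_lagrange_frame[OF True \<beta>] by simp
        qed
        then show ?thesis
          unfolding sode_with_second_order[OF H True] \<Gamma>_def by (simp add: second_order_def)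
      next
        case False
        then show ?thesis
          using H sode TB.vector_field_outside by (simp add: sode_with_def)
      qed
    qed
  qed
qed

lemma lagrangian_field:
  shows "sode A X (lagrangian_field A X L)"
    and "vector_field A Y \<Longrightarrow> p \<in> TQ \<Longrightarrow> euler_lagrange p (lagrangian_field A X L p) Y = 0"
proof -
  have "lagrangian_field A X L = (THE \<Gamma>. sode A X \<Gamma> \<and>
     (\<forall>Y. vector_field A Y \<longrightarrow> (\<forall>p\<in>TQ. euler_lagrange p (\<Gamma> p) Y = 0)))"
    by (simp add: lagrangian_field_def euler_lagrange_def vf_apply_def)
  then show "sode A X (lagrangian_field A X L)"
    and "vector_field A Y \<Longrightarrow> p \<in> TQ \<Longrightarrow> euler_lagrange p (lagrangian_field A X L p) Y = 0"
    using theI'[OF lagrangian_field_exists_unique] by simp_all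
qed

end

section \<open>The constrained system\<close>

locale nonholonomic_system = lagrangian_system A X L
  for A :: "('q, 'e::euclidean_space) chart set" and X :: "nat \<Rightarrow> 'q \<Rightarrow> ('q, 'e) tvec"
    and L :: "('q, 'e) tpoint \<Rightarrow> real" +
  fixes m :: nat and D :: "'q \<Rightarrow> ('q, 'e) tvec set"
  assumes adapted: "adapted_frame A m D X"
    and regular_D: "regular_wrt_distribution A m X L"
begin

abbreviation \<C> :: "('q, 'e) tpoint set" where
  "\<C> \<equiv> constraint_manifold A D"

lemma rank_le: "m \<le> DIM('e)"
  using adapted by (simp add: adapted_frame_def)

lemma g_nonsingular_D: "p \<in> TQ \<Longrightarrow> Determinant.det (mat m m (\<lambda>(a, b). g a b p)) \<noteq> 0"
  using regular_D by (simp add: regular_wrt_distribution_def)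

text \<open>
As the frame is adapted, the distribution is cut out by the transverse coefficients.
\<close>

lemma in_distribution_iff:
  assumes q: "q \<in> points A" and v: "v \<in> tangent_space A q"
  shows "v \<in> D q \<longleftrightarrow> (\<forall>\<alpha>. m \<le> \<alpha> \<and> \<alpha> < DIM('e) \<longrightarrow> coef \<alpha> q v = 0)"
proof
  assume "v \<in> D q"
  then obtain w where w: "v = lin_comb {..<m} w (\<lambda>a. X a q)"
    using adapted q by (auto simp: adapted_frame_def)
  have "v = lin_comb {..<DIM('e)} (\<lambda>\<alpha>. if \<alpha> < m then w \<alpha> else 0) (\<lambda>\<alpha>. X \<alpha> q)"
    unfolding w lin_comb_def using rank_le
    by (intro ext sum.mono_neutral_cong_left) auto
  from coef_eqI[OF q this] show "\<forall>\<alpha>. m \<le> \<alpha> \<and> \<alpha> < DIM('e) \<longrightarrow> coef \<alpha> q v = 0"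
    by simp
next
  assume 0: "\<forall>\<alpha>. m \<le> \<alpha> \<and> \<alpha> < DIM('e) \<longrightarrow> coef \<alpha> q v = 0"
  have "v = lin_comb {..<DIM('e)} (\<lambda>\<alpha>. coef \<alpha> q v) (\<lambda>\<alpha>. X \<alpha> q)"
    by (rule frame_expansion[OF q v])
  also have "\<dots> = lin_comb {..<m} (\<lambda>\<alpha>. coef \<alpha> q v) (\<lambda>\<alpha>. X \<alpha> q)"
    unfolding lin_comb_def using rank_le 0
    by (intro ext sum.mono_neutral_right) auto
  finally show "v \<in> D q"
    using adapted q by (auto simp: adapted_frame_def)
qed

lemma frame_in_distribution: "a < m \<Longrightarrow> q \<in> points A \<Longrightarrow> X a q \<in> D q"
  using adapted unfolding adapted_frame_def
  by (auto simp: lin_comb_def fun_eq_iff if_distrib[of "\<lambda>r. r *\<^sub>R _"] cong: if_cong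
      intro!: exI[of _ "\<lambda>b. if b = a then 1 else 0"])

lemma along_tau_in_iff:
  assumes "Z \<in> along_tau A"
  shows "Z \<in> along_tau_in A D \<longleftrightarrow>
    (\<forall>p\<in>TQ. \<forall>\<alpha>. m \<le> \<alpha> \<and> \<alpha> < DIM('e) \<longrightarrow> coef \<alpha> (fst p) (Z p) = 0)"
  using assms in_distribution_iff[OF base_point along_tau_tangent[OF assms]]
  by (simp add: along_tau_in_def)

text \<open>
Grouped by the second argument, so that orthogonality to the distribution can be read off from the
inner sums.
\<close>

lemma hessian_eq:
  "hessian A X L Y Z p = (\<Sum>\<beta><DIM('e). coef \<beta> (fst p) (Z p) * (\<Sum>\<alpha><DIM('e). coef \<alpha> (fst p) (Y p) * g \<alpha> \<beta> p))"
  unfolding hessian_def sum_distrib_left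
  by (subst sum.swap) (simp add: mult_ac)

lemma along_tau_orth_iff:
  assumes Z: "Z \<in> along_tau A"
  shows "Z \<in> along_tau_orth A D X L \<longleftrightarrow>
    (\<forall>p\<in>TQ. \<forall>b<m. (\<Sum>\<alpha><DIM('e). coef \<alpha> (fst p) (Z p) * g \<alpha> b p) = 0)"
    (is "_ \<longleftrightarrow> (\<forall>p\<in>TQ. \<forall>b<m. ?s b p = 0)")
proof (intro iffI ballI allI impI)
  fix p b assume orth: "Z \<in> along_tau_orth A D X L" and p: "p \<in> TQ" and b: "b < m"
  have bn: "b < DIM('e)"
    using b rank_le by simp
  have "basic A (X b) \<in> along_tau_in A D"
    using basic_along_tau[OF frame_vector_field[OF bn]] frame_in_distribution[OF b] base_point
    by (simp add: along_tau_in_def basic_def)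
  then have "hessian A X L Z (basic A (X b)) p = 0"
    using orth p by (simp add: along_tau_orth_def)
  then have "(\<Sum>\<beta><DIM('e). (if \<beta> = b then 1 else 0) * ?s \<beta> p) = 0"
    by (simp add: hessian_eq coef_basic[OF p bn])
  then show "?s b p = 0"
    using bn by (simp add: if_distrib[of "\<lambda>r. r * _"] cong: if_cong)
next
  assume s: "\<forall>p\<in>TQ. \<forall>b<m. ?s b p = 0"
  have "hessian A X L Z W p = 0" if W: "W \<in> along_tau_in A D" and p: "p \<in> TQ" for W p
  proof -
    have "W \<in> along_tau A"
      using W by (simp add: along_tau_in_def)
    then have "coef \<beta> (fst p) (W p) = 0 \<or> ?s \<beta> p = 0" if "\<beta> < DIM('e)" for \<beta>
      using W s p that along_tau_in_iff by (cases "\<beta> < m") auto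
    then show ?thesis
      unfolding hessian_eq by (intro sum.neutral) auto
  qed
  then show "Z \<in> along_tau_orth A D X L"
    using Z by (simp add: along_tau_orth_def)
qed

text \<open>
Only the first \<open>m\<close> components of \<open>Y\<close> have to be corrected, by the solution \<open>\<pi>\<close> of
\<open>\<pi>\<^sup>a g\<^sub>a\<^sub>b = y\<^sup>\<alpha> g\<^sub>\<alpha>\<^sub>b\<close>; the matrix is the restriction of the Hessian to the distribution, which is
nonsingular.
\<close>

lemma orth_projection_exists_unique:
  assumes Y: "Y \<in> along_tau A"
  shows "\<exists>!Z. Z \<in> along_tau_orth A D X L \<and> (\<lambda>p c. Y p c - Z p c) \<in> along_tau_in A D"
proof -
  let ?B = "tangent_bundle A"
  let ?n = "DIM('e)"
  let ?y = "\<lambda>\<alpha> p. coef \<alpha> (fst p) (Y p)"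
  define r where "r b p = (\<Sum>\<alpha><?n. ?y \<alpha> p * g \<alpha> b p)" for b p
  define \<pi> where "\<pi> a p = (\<Sum>b<m. r b p * matrix_inverse m (\<lambda>a b. g a b p) b a)" for a p
  define \<xi> where "\<xi> \<alpha> p = (if \<alpha> < m then ?y \<alpha> p - \<pi> \<alpha> p else ?y \<alpha> p)" for \<alpha> p
  have y: "smooth_fun ?B (?y \<alpha>)" if "\<alpha> < ?n" for \<alpha>
    by (rule coef_smooth_along[OF Y that])
  have "smooth_fun ?B (r b)" if "b < m" for b
    unfolding r_def[abs_def] using that rank_le
    by (intro TB.smooth_fun_sum TB.smooth_fun_mult y g_smooth) auto
  then have \<pi>: "smooth_fun ?B (\<pi> a)" if "a < m" for a
    unfolding \<pi>_def[abs_def] using that g_smooth g_nonsingular_D rank_le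
    by (intro TB.smooth_fun_sum TB.smooth_fun_mult TB.smooth_fun_matrix_inverse) auto
  have \<xi>: "smooth_fun ?B (\<xi> \<alpha>)" if "\<alpha> < ?n" for \<alpha>
    unfolding \<xi>_def[abs_def] using TB.smooth_fun_diff[OF y[OF that] \<pi>] y[OF that] by (cases "\<alpha> < m") auto
  note Z = along_frame_in[of \<xi>, OF \<xi>]
  have coef_diff_Y: "coef \<alpha> (fst p) (\<lambda>c. Y p c - W p c) = ?y \<alpha> p - coef \<alpha> (fst p) (W p)"
    if "W \<in> along_tau A" "p \<in> TQ" "\<alpha> < ?n" for W \<alpha> p
    by (rule coef_diff[OF base_point[OF that(2)] along_tau_tangent[OF Y that(2)]
          along_tau_tangent[OF that(1,2)] that(3)])
  show ?thesis
  proof (rule ex1I[of _ "along_frame \<xi>"], rule conjI)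
    have "(\<Sum>\<alpha><?n. \<xi> \<alpha> p * g \<alpha> b p) = 0" if p: "p \<in> TQ" and b: "b < m" for p b
    proof -
      have "(\<Sum>\<alpha><?n. \<xi> \<alpha> p * g \<alpha> b p) =
          (\<Sum>\<alpha><?n. ?y \<alpha> p * g \<alpha> b p) - (\<Sum>\<alpha><?n. (if \<alpha> < m then \<pi> \<alpha> p else 0) * g \<alpha> b p)"
        unfolding sum_subtractf[symmetric] by (rule sum.cong) (auto simp: \<xi>_def left_diff_distrib)
      also have "(\<Sum>\<alpha><?n. (if \<alpha> < m then \<pi> \<alpha> p else 0) * g \<alpha> b p) = (\<Sum>a<m. \<pi> a p * g a b p)"
        using rank_le by (intro sum.mono_neutral_cong_right) auto
      also have "\<dots> = r b p"
        unfolding \<pi>_def by (rule matrix_inverse_solves[OF g_nonsingular_D[OF p] b])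
      finally show ?thesis by (simp add: r_def)
    qed
    then show "along_frame \<xi> \<in> along_tau_orth A D X L"
      using along_tau_orth_iff[OF Z] by (simp add: coef_along_frame)
    show "(\<lambda>p c. Y p c - along_frame \<xi> p c) \<in> along_tau_in A D"
      by (auto simp: along_tau_in_iff[OF along_tau_diff[OF Y Z]] coef_diff_Y[OF Z] coef_along_frame \<xi>_def)
  next
    fix W assume W: "W \<in> along_tau_orth A D X L \<and> (\<lambda>p c. Y p c - W p c) \<in> along_tau_in A D"
    then have WA: "W \<in> along_tau A"
      by (simp add: along_tau_orth_def)
    have low: "coef \<alpha> (fst p) (W p) = \<xi> \<alpha> p" if "p \<in> TQ" "m \<le> \<alpha>" "\<alpha> < ?n" for p \<alpha>
      using W that coef_diff_Y[OF WA that(1,3)] along_tau_in_iff[OF along_tau_diff[OF Y WA]]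
      by (auto simp: \<xi>_def)
    show "W = along_frame \<xi>"
    proof (subst along_tau_expansion[OF WA], rule along_frame_eqI)
      fix p \<alpha> assume p: "p \<in> TQ" and \<alpha>: "\<alpha> < ?n"
      show "coef \<alpha> (fst p) (W p) = \<xi> \<alpha> p"
      proof (cases "\<alpha> < m")
        case True
        have "?y \<alpha> p - coef \<alpha> (fst p) (W p) = \<pi> \<alpha> p"
        proof (rule nonsingular_left_cancel[OF g_nonsingular_D[OF p] _ True, where x = "\<lambda>\<alpha>. ?y \<alpha> p - coef \<alpha> (fst p) (W p)"])
          fix b assume b: "b < m"
          have "(\<Sum>a<m. (?y a p - coef a (fst p) (W p)) * g a b p) =
              (\<Sum>\<alpha><?n. (?y \<alpha> p - coef \<alpha> (fst p) (W p)) * g \<alpha> b p)"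
            using rank_le low[OF p] by (intro sum.mono_neutral_left) (auto simp: \<xi>_def)
          also have "\<dots> = r b p - (\<Sum>\<alpha><?n. coef \<alpha> (fst p) (W p) * g \<alpha> b p)"
            by (simp add: left_diff_distrib sum_subtractf r_def)
          also have "(\<Sum>\<alpha><?n. coef \<alpha> (fst p) (W p) * g \<alpha> b p) = 0"
            using W along_tau_orth_iff[OF WA] p b by simp
          also have "r b p - 0 = (\<Sum>a<m. \<pi> a p * g a b p)"
            unfolding \<pi>_def by (simp add: matrix_inverse_solves[OF g_nonsingular_D[OF p] b])
          finally show "(\<Sum>a<m. (?y a p - coef a (fst p) (W p)) * g a b p) = (\<Sum>a<m. \<pi> a p * g a b p)" .
        qed
        then show ?thesis
          using True by (simp add: \<xi>_def)
      qed (use low[OF p _ \<alpha>] in simp)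
    qed
  qed
qed

lemma constraint_point: "p \<in> \<C> \<Longrightarrow> p \<in> TQ"
  by (simp add: constraint_manifold_def)

lemma constraint_velocity:
  assumes "p \<in> \<C>" "m \<le> \<alpha>" "\<alpha> < DIM('e)"
  shows "quasi_velocity X \<alpha> p = 0"
  using assms in_distribution_iff[OF base_point[of p] fibre_vector[of p]]
  by (simp add: constraint_manifold_def)

text \<open>
Sufficient conditions on the forces of a second-order field for its restriction to the constraint
manifold to be the nonholonomic field: no transverse forces, and the Euler-Lagrange equations for the
frame of the distribution. The first condition amounts to tangency. Uniqueness holds since the forces along
the distribution solve a linear system with the restricted Hessian as its matrix.
\<close>

lemma nonholonomic_field_eqI:
  assumes f: "\<And>\<alpha>. \<alpha> < DIM('e) \<Longrightarrow> smooth_fun (tangent_bundle A) (f \<alpha>)"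
    and f0: "\<And>p \<alpha>. p \<in> \<C> \<Longrightarrow> m \<le> \<alpha> \<Longrightarrow> \<alpha> < DIM('e) \<Longrightarrow> f \<alpha> p = 0"
    and el: "\<And>p b. p \<in> \<C> \<Longrightarrow> b < m \<Longrightarrow> euler_lagrange p (second_order (\<lambda>\<alpha>. f \<alpha> p) p) (X b) = 0"
  shows "nonholonomic_field A m D X L =
    (\<lambda>p. if p \<in> \<C> then second_order (\<lambda>\<alpha>. f \<alpha> p) p else (\<lambda>_. 0))" (is "_ = ?\<Gamma>")
proof -
  let ?B = "tangent_bundle A"
  let ?n = "DIM('e)"
  have restrict: "(\<Sum>a<m. quasi_velocity X a p *\<^sub>R XC a p d + h a *\<^sub>R XV a p d) =
      second_order h p d" if "p \<in> \<C>" "\<And>\<alpha>. m \<le> \<alpha> \<Longrightarrow> \<alpha> < ?n \<Longrightarrow> h \<alpha> = 0" for p h d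
    unfolding second_order_def using rank_le that constraint_velocity
    by (intro sum.mono_neutral_left) auto
  define P where "P \<Gamma> \<longleftrightarrow>
     (\<forall>p\<in>\<C>. \<Gamma> p \<in> tangent_space ?B p \<and>
        (\<forall>i\<in>{m..<?n}. vf_apply ?B \<Gamma> (quasi_velocity X i) p = 0)) \<and>
     (\<forall>p. p \<notin> \<C> \<longrightarrow> \<Gamma> p = (\<lambda>_. 0)) \<and>
     (\<exists>f. (\<forall>a<m. smooth_fun_on ?B \<C> (f a)) \<and>
        (\<forall>p\<in>\<C>. \<forall>d. \<Gamma> p d = (\<Sum>a<m. quasi_velocity X a p *\<^sub>R XC a p d + f a p *\<^sub>R XV a p d))) \<and>
     (\<forall>Y. vector_field A Y \<and> (\<forall>q\<in>points A. Y q \<in> D q) \<longrightarrow>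
        (\<forall>p\<in>\<C>. euler_lagrange p (\<Gamma> p) Y = 0))" for \<Gamma>
  have "P ?\<Gamma>"
    unfolding P_def
  proof (intro conjI ballI allI impI exI[of _ f])
    fix p assume p: "p \<in> \<C>"
    note pT = constraint_point[OF p]
    show "?\<Gamma> p \<in> tangent_space ?B p"
      using p by (simp add: second_order_tangent[OF pT])
    show "vf_apply ?B ?\<Gamma> (quasi_velocity X i) p = 0" if "i \<in> {m..<?n}" for i
      using p that f0[OF p, of i] quasi_velocity_second_order[OF pT, of i] by (simp add: vf_apply_def)
    show "?\<Gamma> p d = (\<Sum>a<m. quasi_velocity X a p *\<^sub>R XC a p d + f a p *\<^sub>R XV a p d)" for d
      using p restrict[OF p f0[OF p]] by simp
  next
    fix a assume a: "a < m"
    \<comment> \<open>The forces are defined on all of the tangent bundle, which serves as the neighbourhood.\<close>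
    have "openin (atlas_topology ?B) TQ"
      using TB.inj_chart TB.open_chart TB.in_points
      by (subst openin_atlas_topology) (auto simp: Int_absorb1 subset_iff)
    then show "smooth_fun_on ?B \<C> (f a)"
      using f[of a] a rank_le constraint_point unfolding smooth_fun_on_def
      by (intro ballI exI[of _ TQ] exI[of _ "f a"]) auto
  next
    fix Y p assume Y: "vector_field A Y \<and> (\<forall>q\<in>points A. Y q \<in> D q)" and p: "p \<in> \<C>"
    note pT = constraint_point[OF p]
    have "coef \<alpha> (fst p) (Y (fst p)) = 0" if "m \<le> \<alpha>" "\<alpha> < ?n" for \<alpha>
      using Y that in_distribution_iff[OF base_point[OF pT] vector_field_tangent[OF _ base_point[OF pT]]]
        base_point[OF pT] by blast
    then show "euler_lagrange p (?\<Gamma> p) Y = 0"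
      using p Y el[OF p] euler_lagrange_zeroI[OF pT, of Y "\<lambda>\<alpha>. f \<alpha> p"] not_le by auto
  qed simp
  moreover have "\<Delta> = ?\<Gamma>" if \<Delta>: "P \<Delta>" for \<Delta>
  proof
    fix p
    show "\<Delta> p = ?\<Gamma> p"
    proof (cases "p \<in> \<C>")
      case p: True
      note pT = constraint_point[OF p]
      obtain h where h: "\<forall>p\<in>\<C>. \<forall>d. \<Delta> p d =
          (\<Sum>a<m. quasi_velocity X a p *\<^sub>R XC a p d + h a p *\<^sub>R XV a p d)"
        using \<Delta> unfolding P_def by auto
      let ?h = "\<lambda>\<alpha>. if \<alpha> < m then h \<alpha> p else 0"
      have \<Delta>p: "\<Delta> p = second_order ?h p"
      proof
        show "\<Delta> p d = second_order ?h p d" for d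
          using restrict[OF p, of ?h d] h[THEN bspec, OF p, THEN spec, of d] by simp
      qed
      have "h a p = f a p" if a: "a < m" for a
      proof (rule nonsingular_left_cancel[OF g_nonsingular_D[OF pT] _ a, where x = "\<lambda>a. h a p"])
        fix b assume b: "b < m"
        have bn: "b < ?n" using b rank_le by simp
        have "euler_lagrange p (\<Delta> p) (X b) = 0"
          using \<Delta> p frame_vector_field[OF bn] frame_in_distribution[OF b] unfolding P_def by auto
        with el[OF p b] have "(\<Sum>\<alpha><?n. ?h \<alpha> * g \<alpha> b p) = (\<Sum>\<alpha><?n. f \<alpha> p * g \<alpha> b p)"
          unfolding \<Delta>p euler_lagrange_frame[OF pT bn] by simp
        moreover have "(\<Sum>\<alpha><?n. ?h \<alpha> * g \<alpha> b p) = (\<Sum>a<m. h a p * g a b p)"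
          using rank_le by (intro sum.mono_neutral_cong_right) auto
        moreover have "(\<Sum>\<alpha><?n. f \<alpha> p * g \<alpha> b p) = (\<Sum>a<m. f a p * g a b p)"
          using rank_le f0[OF p] by (intro sum.mono_neutral_right) auto
        ultimately show "(\<Sum>a<m. h a p * g a b p) = (\<Sum>a<m. f a p * g a b p)"
          by simp
      qed
      then have "second_order ?h p = second_order (\<lambda>\<alpha>. f \<alpha> p) p"
        using f0[OF p] unfolding second_order_def by (intro ext sum.cong) auto
      then show ?thesis
        using p \<Delta>p by simp
    next
      case False
      have "\<Delta> p = (\<lambda>_. 0)"
        using \<Delta> False unfolding P_def by blast
      then show ?thesis
        using False by simp
    qed
  qed
  ultimately have "(THE \<Gamma>. P \<Gamma>) = ?\<Gamma>"
    by (rule the_equality)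
  moreover have "nonholonomic_field A m D X L = (THE \<Gamma>. P \<Gamma>)"
    by (simp add: nonholonomic_field_def P_def euler_lagrange_def vf_apply_def)
  ultimately show ?thesis by simp
qed

text \<open>
The projection of the canonical field vanishes on the constraint manifold. Therefore its covariant
derivative is there just its derivative along \<open>\<Gamma>\<close>, and the conditions of \<open>nonholonomic_field_eqI\<close> come
from differentiating the equations that define the projection.
\<close>

subsection \<open>The extension property\<close>

theorem projected_canonical_field_extension:
  "sode_extension A m D X L (\<lambda>p d. lagrangian_field A X L p d
     - vertical_lift A (dyn_cov_deriv A X (lagrangian_field A X L)
         (orth_projection A D X L (canonical_field A X))) p d)"
proof -
  let ?B = "tangent_bundle A"
  let ?n = "DIM('e)"
  let ?\<Gamma> = "lagrangian_field A X L"
  let ?T = "canonical_field A X"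
  define Z where "Z = orth_projection A D X L ?T"
  define \<xi> where "\<xi> \<alpha> p = coef \<alpha> (fst p) (Z p)" for \<alpha> p
  define \<nu> where "\<nu> = covariant_coeff ?\<Gamma> Z"
  obtain F where F: "sode_with A X F ?\<Gamma>"
    using lagrangian_field(1) by (auto simp: sode_def)
  define G where "G \<alpha> p = F \<alpha> p - \<nu> \<alpha> p" for \<alpha> p
  define \<Delta> where "\<Delta> p = (\<lambda>d. ?\<Gamma> p d - vertical_lift A (along_frame \<nu>) p d)" for p
  have "Z \<in> along_tau_orth A D X L \<and> (\<lambda>p c. ?T p c - Z p c) \<in> along_tau_in A D"
    unfolding Z_def orth_projection_def
    by (rule theI'[OF orth_projection_exists_unique[OF canonical_field_along_tau]])
  then have Z_orth: "Z \<in> along_tau_orth A D X L" and TZ: "(\<lambda>p c. ?T p c - Z p c) \<in> along_tau_in A D"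
    by auto
  then have Z: "Z \<in> along_tau A"
    by (simp add: along_tau_orth_def)
  have \<xi>_smooth: "smooth_fun ?B (\<xi> \<alpha>)" if "\<alpha> < ?n" for \<alpha>
    unfolding \<xi>_def[abs_def] by (rule coef_smooth_along[OF Z that])
  have \<nu>_smooth: "smooth_fun ?B (\<nu> \<alpha>)" if "\<alpha> < ?n" for \<alpha>
    unfolding \<nu>_def by (rule covariant_coeff_smooth[OF lagrangian_field(1) Z that])
  \<comment> \<open>The two facts that determine the projection.\<close>
  have \<xi>_transverse: "\<xi> i p = quasi_velocity X i p" if "p \<in> TQ" "m \<le> i" "i < ?n" for p i
  proof -
    have "coef i (fst p) (\<lambda>c. ?T p c - Z p c) = 0"
      using TZ along_tau_in_iff[OF along_tau_diff[OF canonical_field_along_tau Z]] that by simp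
    moreover have "coef i (fst p) (\<lambda>c. ?T p c - Z p c) = coef i (fst p) (?T p) - coef i (fst p) (Z p)"
      by (rule coef_diff[OF base_point[OF that(1)] along_tau_tangent[OF canonical_field_along_tau that(1)]
            along_tau_tangent[OF Z that(1)] that(3)])
    ultimately show ?thesis
      using that(1) by (simp add: \<xi>_def canonical_field_eq)
  qed
  have \<xi>_orth: "(\<Sum>\<alpha><?n. \<xi> \<alpha> p * g \<alpha> b p) = 0" if "p \<in> TQ" "b < m" for p b
    using Z_orth that unfolding \<xi>_def along_tau_orth_iff[OF Z] by blast
  have \<xi>_zero: "\<xi> \<alpha> p = 0" if p: "p \<in> \<C>" and \<alpha>: "\<alpha> < ?n" for p \<alpha>
  proof (cases "\<alpha> < m")
    case True
    note pT = constraint_point[OF p]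
    show ?thesis
    proof (rule nonsingular_left_cancel[OF g_nonsingular_D[OF pT] _ True, where y = "\<lambda>_. 0" and x = "\<lambda>\<alpha>. \<xi> \<alpha> p"])
      fix b assume b: "b < m"
      have "(\<Sum>a<m. \<xi> a p * g a b p) = (\<Sum>\<alpha><?n. \<xi> \<alpha> p * g \<alpha> b p)"
        using rank_le \<xi>_transverse[OF pT] constraint_velocity[OF p]
        by (intro sum.mono_neutral_left) auto
      then show "(\<Sum>a<m. \<xi> a p * g a b p) = (\<Sum>a<m. 0 * g a b p)"
        using \<xi>_orth[OF pT b] by simp
    qed
  next
    case False
    then show ?thesis
      using \<xi>_transverse[OF constraint_point[OF p] _ \<alpha>] constraint_velocity[OF p _ \<alpha>] by simp
  qed
  \<comment> \<open>The connection coefficients are multiplied by components of the projection, which vanish here.\<close>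
  have \<nu>_eq: "\<nu> \<alpha> p = dir_deriv ?B p (?\<Gamma> p) (\<xi> \<alpha>)" if p: "p \<in> \<C>" and \<alpha>: "\<alpha> < ?n" for p \<alpha>
    using \<xi>_zero[OF p] by (simp add: \<nu>_def covariant_coeff_def vf_apply_def \<xi>_def[abs_def])
  have \<nu>_transverse: "\<nu> i p = F i p" if p: "p \<in> \<C>" and i: "m \<le> i" "i < ?n" for p i
  proof -
    note pT = constraint_point[OF p]
    have "\<nu> i p = dir_deriv ?B p (?\<Gamma> p) (quasi_velocity X i)"
      unfolding \<nu>_eq[OF p i(2)] by (rule TB.dir_deriv_fun_cong[OF pT]) (rule \<xi>_transverse[OF _ i])
    then show ?thesis
      unfolding sode_with_second_order[OF F pT] quasi_velocity_second_order[OF pT i(2)] .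
  qed
  \<comment> \<open>In the derivative of \<open>\<xi>\<^sup>\<alpha> g\<^sub>\<alpha>\<^sub>b = 0\<close> the derivatives of the Hessian are multiplied by \<open>\<xi>\<^sup>\<alpha> = 0\<close>.\<close>
  have \<nu>_orth: "(\<Sum>\<alpha><?n. \<nu> \<alpha> p * g \<alpha> b p) = 0" if p: "p \<in> \<C>" and b: "b < m" for p b
  proof -
    note pT = constraint_point[OF p]
    have bn: "b < ?n" using b rank_le by simp
    have "(\<Sum>\<alpha><?n. \<nu> \<alpha> p * g \<alpha> b p) = (\<Sum>\<alpha><?n. dir_deriv ?B p (?\<Gamma> p) (\<lambda>p. \<xi> \<alpha> p * g \<alpha> b p))"
      by (rule sum.cong) (simp_all add: TB.dir_deriv_fun_mult[OF pT \<xi>_smooth g_smooth[OF _ bn]] \<xi>_zero[OF p] \<nu>_eq[OF p])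
    also have "\<dots> = dir_deriv ?B p (?\<Gamma> p) (\<lambda>p. \<Sum>\<alpha><?n. \<xi> \<alpha> p * g \<alpha> b p)"
      by (rule TB.dir_deriv_fun_sum[OF pT, symmetric]) (auto intro!: TB.smooth_fun_mult \<xi>_smooth g_smooth bn)
    also have "\<dots> = dir_deriv ?B p (?\<Gamma> p) (\<lambda>p. 0)"
      by (rule TB.dir_deriv_fun_cong[OF pT]) (rule \<xi>_orth[OF _ b])
    also have "\<dots> = 0"
      by (rule TB.dir_deriv_fun_const[OF pT])
    finally show ?thesis .
  qed
  have G_smooth: "smooth_fun ?B (G \<alpha>)" if "\<alpha> < ?n" for \<alpha>
    unfolding G_def[abs_def] using F that
    by (intro TB.smooth_fun_diff \<nu>_smooth) (auto simp: sode_with_def)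
  have \<Delta>_second_order: "\<Delta> p = second_order (\<lambda>\<alpha>. G \<alpha> p) p" if "p \<in> TQ" for p
    unfolding \<Delta>_def sode_with_second_order[OF F that] vertical_lift_along_frame G_def second_order_def
    by (simp add: fun_eq_iff scaleR_diff_left sum_subtractf sum.distrib)
  have "vector_field ?B \<Delta>"
    unfolding \<Delta>_def[abs_def] using F
    by (intro TB.vector_field_diff vector_field_vertical_lift along_frame_in \<nu>_smooth) (auto simp: sode_with_def)
  then have "sode_with A X G \<Delta>"
    by (intro sode_with_I G_smooth \<Delta>_second_order)
  then have sode: "sode A X \<Delta>"
    by (auto simp: sode_def)
  have "nonholonomic_field A m D X L = (\<lambda>p. if p \<in> \<C> then second_order (\<lambda>\<alpha>. G \<alpha> p) p else (\<lambda>_. 0))"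
  proof (rule nonholonomic_field_eqI[OF G_smooth])
    show "G i p = 0" if "p \<in> \<C>" "m \<le> i" "i < ?n" for p i
      using \<nu>_transverse[OF that] by (simp add: G_def)
    fix p b assume p: "p \<in> \<C>" and b: "b < m"
    note pT = constraint_point[OF p]
    have bn: "b < ?n" using b rank_le by simp
    have "euler_lagrange p (second_order (\<lambda>\<alpha>. F \<alpha> p) p) (X b) = 0"
      using lagrangian_field(2)[OF frame_vector_field[OF bn] pT] sode_with_second_order[OF F pT] by simp
    then show "euler_lagrange p (second_order (\<lambda>\<alpha>. G \<alpha> p) p) (X b) = 0"
      unfolding euler_lagrange_frame[OF pT bn] G_def
      by (simp add: left_diff_distrib sum_subtractf \<nu>_orth[OF p b])
  qed auto
  then have agree: "nonholonomic_field A m D X L p = \<Delta> p" if "p \<in> \<C>" for p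
    using that \<Delta>_second_order[OF constraint_point[OF that]] by simp
  have "sode_extension A m D X L \<Delta>"
    unfolding sode_extension_def base_integral_curve_def integral_curve_def
    using sode agree constraint_point by (auto simp: image_subset_iff)
  then show ?thesis
    unfolding \<Delta>_def[abs_def] \<nu>_def Z_def
    using dyn_cov_deriv_eq[OF lagrangian_field(1) Z] by (simp add: Z_def)
qed

end

theorem proposition2:
  fixes A :: "('q, 'e::euclidean_space) chart set"
    and D :: "'q \<Rightarrow> ('q, 'e) tvec set"
    and X :: "nat \<Rightarrow> 'q \<Rightarrow> ('q, 'e) tvec"
    and L :: "('q, 'e) tpoint \<Rightarrow> real"
    and m :: nat
  assumes "smooth_manifold A"
    and "distribution A m D"
    and "adapted_frame A m D X"
    and "smooth_fun (tangent_bundle A) L"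
    and "regular A X L"
    and "regular_wrt_distribution A m X L"
  shows "sode_extension A m D X L (\<lambda>p d.
           lagrangian_field A X L p d
           - vertical_lift A
               (dyn_cov_deriv A X (lagrangian_field A X L)
                  (orth_projection A D X L (canonical_field A X))) p d)"
proof -
  interpret smooth_atlas A
    by (rule smooth_manifold_imp_smooth_atlas[OF assms(1)])
  interpret nonholonomic_system A X L m D
    by unfold_locales (use assms in \<open>auto simp: adapted_frame_def\<close>)
  show ?thesis
    by (rule projected_canonical_field_extension)
qed

end
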